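(* Let $\mathcal{G}$ be a class of graphs of bounded expansion. There is a polynomial $f$ such that, for every $p\in\mathbb{N}$, there is a polynomial-time algorithm which, given an instance $(G,t,k)$ of \textsc{$p$-Bounded Harmless Set} with $G\in\mathcal{G}$, outputs an equivalent instance $(G',t',k',K')$ of \textsc{Annotated $p$-Bounded Harmless Set} whose size is at most $f(p)\cdot k$ (that is, \textsc{$p$-Bounded Harmless Set} over bounded expansion classes admits a bikernel into \textsc{Annotated $p$-Bounded Harmless Set} of size $f(p)\cdot k$).
   Context: \textsc{$p$-Bounded Harmless Set}: given a graph $G$, a threshold function $t\colon V(G)\to\{1,\dots,p\}$ and an integer $k$, decide whether there is $S\subseteq V(G)$ with $|S|\ge k$ such that every $v\in V(G)$ has fewer than $t(v)$ neighbours in $S$. \textsc{Annotated $p$-Bounded Harmless Set}: given $G$, $t\colon V(G)\to\{1,\dots,p\}$, an integer $k$ and a set $K\subseteq V(G)$, decide whether there is such an $S$ with additionally $S\subseteq K$. Two instances are equivalent if both are yes-instances or both are no-instances. For a graph $G$, $\nabla_r(G)=\sup_{H}\|H\|/|H|$, the supremum over all $r$-shallow minors $H$ of $G$ (graphs obtained by contracting pairwise disjoint connected sets of radius at most $r$ and deleting vertices/edges), where $|H|,\|H\|$ are the numbers of vertices and edges. A class $\mathcal{G}$ has bounded expansion if there is a function $f_0$ with $\nabla_r(G)\le f_0(r)$ for all $G\in\mathcal{G}$ and $r\in\mathbb{N}$. *)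

theory Defs
  imports Complex_Main "HOL-Computational_Algebra.Polynomial" "HOL-Library.Log_Nat"
begin

section \<open>Finite simple graphs, shallow minors, bounded expansion\<close>

record 'a graph =
  verts :: "'a set"
  edges :: "'a set set"

definition simple_graph :: "'a graph \<Rightarrow> bool" where
  "simple_graph G \<longleftrightarrow> finite (verts G) \<and> (\<forall>e\<in>edges G. e \<subseteq> verts G \<and> card e = 2)"

definition nbrs :: "'a graph \<Rightarrow> 'a \<Rightarrow> 'a set" where
  "nbrs G v = {u \<in> verts G. {u, v} \<in> edges G}"

definition arcs_within :: "'a graph \<Rightarrow> 'a set \<Rightarrow> ('a \<times> 'a) set" where
  "arcs_within G B = {(u, v). u \<in> B \<and> v \<in> B \<and> {u, v} \<in> edges G}"

text \<open>The subgraph induced by \<open>B\<close> is connected and has radius at most \<open>r\<close>: some centre in \<open>B\<close>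
  reaches every vertex of \<open>B\<close> by a walk of length at most \<open>r\<close> inside \<open>B\<close>.  In particular
  \<open>B\<close> is nonempty.\<close>

definition connected_radius_le :: "'a graph \<Rightarrow> nat \<Rightarrow> 'a set \<Rightarrow> bool" where
  "connected_radius_le G r B \<longleftrightarrow> (\<exists>c\<in>B. \<forall>v\<in>B. \<exists>l\<le>r. (c, v) \<in> arcs_within G B ^^ l)"

text \<open>\<open>\<phi> h\<close> is the set of vertices of \<open>G\<close> contracted to the vertex \<open>h\<close> of \<open>H\<close>.
  Deletion of vertices and edges is accounted for by the branch sets not having to cover
  \<open>verts G\<close> and by the implication (rather than equivalence) for edges.\<close>

definition shallow_minor :: "nat \<Rightarrow> 'b graph \<Rightarrow> 'a graph \<Rightarrow> bool" where
  "shallow_minor r H G \<longleftrightarrow> simple_graph H \<and>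
     (\<exists>\<phi>. (\<forall>h\<in>verts H. \<phi> h \<subseteq> verts G \<and> connected_radius_le G r (\<phi> h)) \<and>
          (\<forall>h\<in>verts H. \<forall>h'\<in>verts H. h \<noteq> h' \<longrightarrow> \<phi> h \<inter> \<phi> h' = {}) \<and>
          (\<forall>h h'. {h, h'} \<in> edges H \<longrightarrow> (\<exists>u\<in>\<phi> h. \<exists>v\<in>\<phi> h'. {u, v} \<in> edges G)))"

text \<open>A minor of \<open>G\<close> has at most as many vertices as \<open>G\<close>, so up to isomorphism all of them live
  on the vertex type of \<open>G\<close>.  For finite \<open>G\<close> the set of densities is bounded.  The empty minor
  contributes \<open>0 / 0 = 0\<close>, which never increases the supremum of the densities of the nonempty
  minors and gives the value \<open>0\<close> for the empty graph.\<close>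

definition nabla :: "nat \<Rightarrow> 'a graph \<Rightarrow> real" where
  "nabla r G = (SUP H\<in>{H :: 'a graph. shallow_minor r H G}.
                  real (card (edges H)) / real (card (verts H)))"

definition bounded_expansion :: "'a graph set \<Rightarrow> bool" where
  "bounded_expansion \<G> \<longleftrightarrow> (\<exists>f\<^sub>0 :: nat \<Rightarrow> real. \<forall>G\<in>\<G>. \<forall>r. nabla r G \<le> f\<^sub>0 r)"


section \<open>Harmless sets\<close>

definition harmless :: "'a graph \<Rightarrow> ('a \<Rightarrow> nat) \<Rightarrow> 'a set \<Rightarrow> bool" where
  "harmless G t S \<longleftrightarrow> S \<subseteq> verts G \<and> (\<forall>v\<in>verts G. card (nbrs G v \<inter> S) < t v)"

text \<open>Instances of the two problems, and what it means to be a yes-instance.  The integer \<open>k\<close>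
  is taken to be a natural number, since it is the parameter of the size bound.\<close>

definition bhs_instance :: "nat \<Rightarrow> 'a graph \<Rightarrow> ('a \<Rightarrow> nat) \<Rightarrow> nat \<Rightarrow> bool" where
  "bhs_instance p G t k \<longleftrightarrow> simple_graph G \<and> (\<forall>v\<in>verts G. t v \<in> {1..p})"

definition bhs_yes :: "'a graph \<Rightarrow> ('a \<Rightarrow> nat) \<Rightarrow> nat \<Rightarrow> bool" where
  "bhs_yes G t k \<longleftrightarrow> (\<exists>S. harmless G t S \<and> k \<le> card S)"

definition annotated_bhs_instance ::
    "nat \<Rightarrow> 'a graph \<Rightarrow> ('a \<Rightarrow> nat) \<Rightarrow> nat \<Rightarrow> 'a set \<Rightarrow> bool" where
  "annotated_bhs_instance p G t k K \<longleftrightarrow> bhs_instance p G t k \<and> K \<subseteq> verts G"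

definition annotated_bhs_yes :: "'a graph \<Rightarrow> ('a \<Rightarrow> nat) \<Rightarrow> nat \<Rightarrow> 'a set \<Rightarrow> bool" where
  "annotated_bhs_yes G t k K \<longleftrightarrow> (\<exists>S. harmless G t S \<and> S \<subseteq> K \<and> k \<le> card S)"

text \<open>The threshold of a vertex (at most the constant \<open>p\<close>) and its membership in \<open>K\<close> are labels
  on vertices and are counted with the vertex.\<close>

definition annotated_bhs_size :: "'a graph \<Rightarrow> ('a \<Rightarrow> nat) \<Rightarrow> nat \<Rightarrow> 'a set \<Rightarrow> nat" where
  "annotated_bhs_size G t k K = card (verts G) + card (edges G) + k"


section \<open>Polynomial-time algorithms\<close>

text \<open>Structured programs for a random access machine: a store of
  named arrays of natural numbers, every command taking unit time.  The arithmetic operations are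
  addition and truncated subtraction only.  Since the maximal length of the stored numbers grows by
  at most a constant in each step, polynomial time on this machine (with respect to the binary
  length of the input) is polynomial time on Turing machines; unit-cost multiplication would
  break this.\<close>

type_synonym name = string
type_synonym store = "name \<Rightarrow> nat \<Rightarrow> nat"

datatype expr =
    Const nat
  | Read name expr
  | Add expr expr
  | Sub expr expr

datatype prog =
    Skip
  | Write name expr expr
  | Seq prog prog
  | Cond expr prog prog
  | While expr prog

primrec eval_expr :: "expr \<Rightarrow> store \<Rightarrow> nat" where
  "eval_expr (Const n) s = n"
| "eval_expr (Read x e) s = s x (eval_expr e s)"
| "eval_expr (Add e e') s = eval_expr e s + eval_expr e' s"
| "eval_expr (Sub e e') s = eval_expr e s - eval_expr e' s"

text \<open>\<open>exec c s \<tau> s'\<close>: started in \<open>s\<close>, the program \<open>c\<close> halts in \<open>s'\<close> after \<open>\<tau>\<close> steps.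
  Conditions hold if they evaluate to a nonzero number.\<close>

inductive exec :: "prog \<Rightarrow> store \<Rightarrow> nat \<Rightarrow> store \<Rightarrow> bool" where
  Skip: "exec Skip s 1 s"
| Write: "exec (Write x i e) s 1 (s(x := (s x)(eval_expr i s := eval_expr e s)))"
| Seq: "exec c s \<tau> s' \<Longrightarrow> exec c' s' \<tau>' s'' \<Longrightarrow> exec (Seq c c') s (\<tau> + \<tau>') s''"
| CondTrue: "eval_expr b s \<noteq> 0 \<Longrightarrow> exec c s \<tau> s' \<Longrightarrow> exec (Cond b c c') s (\<tau> + 1) s'"
| CondFalse: "eval_expr b s = 0 \<Longrightarrow> exec c' s \<tau> s' \<Longrightarrow> exec (Cond b c c') s (\<tau> + 1) s'"
| WhileFalse: "eval_expr b s = 0 \<Longrightarrow> exec (While b c) s 1 s"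
| WhileTrue: "eval_expr b s \<noteq> 0 \<Longrightarrow> exec c s \<tau> s' \<Longrightarrow> exec (While b c) s' \<tau>' s'' \<Longrightarrow>
    exec (While b c) s (\<tau> + \<tau>' + 1) s''"

definition load :: "nat list \<Rightarrow> store" where
  "load w = (\<lambda>x i. if x = ''in'' \<and> i < length w then w ! i
                   else if x = ''inlen'' \<and> i = 0 then length w
                   else 0)"

definition result :: "store \<Rightarrow> nat list" where
  "result s = map (s ''out'') [0..<s ''outlen'' 0]"

text \<open>Producing the output is charged for as well, since \<open>result\<close> may contain cells that were
  never written to.\<close>

definition computes_within :: "prog \<Rightarrow> nat list \<Rightarrow> nat list \<Rightarrow> nat \<Rightarrow> bool" where
  "computes_within c w w' T \<longleftrightarrow>
     (\<exists>\<tau> s. exec c (load w) \<tau> s \<and> result s = w' \<and> \<tau> + length w' \<le> T)"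

text \<open>Length of a word of binary numbers, with one separator for each number.\<close>

definition word_size :: "nat list \<Rightarrow> nat" where
  "word_size w = (\<Sum>n\<leftarrow>w. floorlog 2 n + 1)"


section \<open>Encoding of instances\<close>

text \<open>Graphs are given by adjacency matrices with respect to an enumeration \<open>vs\<close> of the vertices,
  so that the encoding does not depend on the vertex names.\<close>

definition enumerates :: "'a list \<Rightarrow> 'a graph \<Rightarrow> bool" where
  "enumerates vs G \<longleftrightarrow> distinct vs \<and> set vs = verts G"

definition adjacency_matrix :: "'a list \<Rightarrow> 'a graph \<Rightarrow> nat list" where
  "adjacency_matrix vs G = concat (map (\<lambda>u. map (\<lambda>v. of_bool ({u, v} \<in> edges G)) vs) vs)"

definition encode_bhs :: "'a list \<Rightarrow> 'a graph \<Rightarrow> ('a \<Rightarrow> nat) \<Rightarrow> nat \<Rightarrow> nat list" where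
  "encode_bhs vs G t k = [k, length vs] @ map t vs @ adjacency_matrix vs G"

definition encode_annotated_bhs ::
    "'a list \<Rightarrow> 'a graph \<Rightarrow> ('a \<Rightarrow> nat) \<Rightarrow> nat \<Rightarrow> 'a set \<Rightarrow> nat list" where
  "encode_annotated_bhs vs G t k K =
     [k, length vs] @ map t vs @ map (\<lambda>v. of_bool (v \<in> K)) vs @ adjacency_matrix vs G"

end

theory Submission
  imports Defs "HOL-Library.FuncSet"
begin

text \<open>Let \<open>K\<close> be the set of candidates, initially all vertices.  Every vertex of \<open>K\<close> that is adjacent to a
  vertex of threshold 1 can be dropped.  Moreover \<open>u\<close> can be dropped if there are a set \<open>A\<close> of bounded
  size and more than \<open>p * card A\<close> other candidates that look like \<open>u\<close> from \<open>A\<close>, such that all candidates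
  interfering with them away from \<open>A\<close> are adjacent to \<open>A\<close> and distinct ones have no common
  interference: a solution has fewer than \<open>p\<close> members at each vertex of \<open>A\<close>, hence leaves one of these
  candidates undisturbed, and \<open>u\<close> can be exchanged for it.  For fixed \<open>p\<close> the sizes are constants, so
  the rule is a first-order condition that nested loops decide in polynomial time.

  Suppose that the rule no longer applies and that \<open>K\<close> is large compared to \<open>k\<close>.  In a class of bounded
  expansion there are a set \<open>R\<close> and a much larger \<open>I \<subseteq> K\<close> whose members have pairwise disjoint balls of
  radius 2 outside \<open>R\<close>.  Add to \<open>R\<close> the vertices with many neighbours in \<open>K\<close> and the candidates without
  such a neighbour; the latter are few, since otherwise \<open>k\<close> of them have disjoint
  neighbourhoods and form a harmless set.  Contracting the balls, most members of \<open>I\<close> see boundedly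
  many vertices of \<open>R\<close>, and they see only \<open>O(card R)\<close> different sets.  So many of them see the same
  set \<open>A\<close> in the same way, and the rule applies after all.  Hence a large irreducible \<open>K\<close> means a
  yes-instance.  Otherwise \<open>K\<close> has size linear in \<open>k\<close>, and so has the number of neighbourhoods in \<open>K\<close> of
  the other vertices; a vertex of least threshold for each of them suffices.\<close>

text \<open>The bound must be polynomial in \<open>p\<close>, with one polynomial for the whole
  class, and the class supplies only a density constant \<open>d\<close>. Hence the size of
  \<open>A\<close> is bounded by \<open>4 * d\<close>, without \<open>p\<close>: a candidate can
  look at \<open>A\<close> in at most \<open>2 ^ (4 * d) * (p + 2) ^ (2 ^ (4 * d))\<close> ways, a
  polynomial in \<open>p\<close> whose degree is fixed by the class. The number
  \<open>4 * d * p + 1\<close> of exchange partners may depend on \<open>p\<close>: it enters the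
  bound polynomially, and the loop depth it causes is harmless because the program is chosen after
  \<open>p\<close>. Radius 2 is the reach of an interference: a constraint next to a candidate, then
  another candidate next to that constraint. If interfering candidates were not adjacent to
  \<open>A\<close>, a solution could meet all the disjoint zones; so every candidate outside
  \<open>R\<close> must have a neighbour in \<open>R\<close>, which is what the vertices added to
  \<open>R\<close> achieve. Finally \<open>I\<close> has to outnumber the types over
  \<open>R\<close>, whose number grows with \<open>card R\<close>; so scattering is proved for an
  arbitrary ratio \<open>B\<close>, at a loss polynomial in \<open>B\<close>.\<close>

section \<open>Sparse bipartite graphs\<close>

lemma handshake:
  assumes "finite X" "\<And>e. e \<in> F \<Longrightarrow> e \<subseteq> X \<and> card e = 2"
  shows "(\<Sum>x\<in>X. card {e\<in>F. x \<in> e}) = 2 * card F"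
proof -
  have finF: "finite F"
    using assms by (meson PowI finite_Pow_iff finite_subset subsetI)
  have "(\<Sum>x\<in>X. card {e\<in>F. x \<in> e}) = (\<Sum>e\<in>F. card {x\<in>X. x \<in> e})"
    using sum.swap_restrict[OF assms(1) finF, of "\<lambda>_ _. 1::nat" "\<lambda>x e. x \<in> e"] by simp
  also have "\<dots> = (\<Sum>e\<in>F. 2)"
  proof (rule sum.cong)
    fix e assume "e \<in> F"
    then have "{x\<in>X. x \<in> e} = e" "card e = 2" using assms(2) by auto
    then show "card {x\<in>X. x \<in> e} = 2" by simp
  qed simp
  finally show ?thesis by simp
qed

lemma low_degree:
  assumes "finite X" "X \<noteq> {}" "\<And>e. e \<in> F \<Longrightarrow> e \<subseteq> X \<and> card e = 2" "card F \<le> D * card X"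
  shows "\<exists>x\<in>X. card {e\<in>F. x \<in> e} \<le> 2 * D"
proof (rule ccontr)
  assume "\<not> ?thesis"
  then have *: "\<And>x. x \<in> X \<Longrightarrow> 2 * D + 1 \<le> card {e\<in>F. x \<in> e}" by force
  have "(2 * D + 1) * card X \<le> (\<Sum>x\<in>X. card {e\<in>F. x \<in> e})"
    using sum_bounded_below[of X "2 * D + 1"] * by (simp add: mult.commute)
  also have "\<dots> = 2 * card F" by (rule handshake[OF assms(1,3)])
  also have "\<dots> \<le> 2 * D * card X" using assms(4) by simp
  finally show False using assms(1,2) by (simp add: card_gt_0_iff)
qed

text \<open>Greedy choice: density \<open>D\<close> in every induced subgraph provides a vertex of
  degree at most \<open>2 * D\<close>. It joins \<open>I\<close>, and at most
  \<open>2 * D + 1\<close> vertices, itself and its neighbours, are discarded.\<close>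

lemma independent_set:
  assumes "finite X" "\<And>e. e \<in> F \<Longrightarrow> card e = 2"
    and "\<And>X'. X' \<subseteq> X \<Longrightarrow> card {e\<in>F. e \<subseteq> X'} \<le> D * card X'"
  shows "\<exists>I\<subseteq>X. (\<forall>e\<in>F. \<not> e \<subseteq> I) \<and> card X \<le> (2 * D + 1) * card I"
  using assms
proof (induction "card X" arbitrary: X rule: less_induct)
  case less
  show ?case
  proof (cases "X = {}")
    case True
    have "\<not> e \<subseteq> {}" if "e \<in> F" for e using less.prems(2)[OF that] by auto
    then show ?thesis using True by (intro exI[of _ "{}"]) auto
  next
    case False
    obtain x where x: "x \<in> X" "card {e\<in>{e\<in>F. e \<subseteq> X}. x \<in> e} \<le> 2 * D"
      using low_degree[of X "{e\<in>F. e \<subseteq> X}" D] less.prems False by auto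
    define M where "M = {e\<in>F. e \<subseteq> X \<and> x \<in> e}"
    have M: "card M \<le> 2 * D" using x(2) by (simp add: M_def conj_commute conj_left_commute conj_assoc)
    have finM: "finite M" using less.prems(1) by (simp add: M_def)
    define Z where "Z = insert x (\<Union>M)"
    have e2: "\<exists>y. e = {x, y}" if "e \<in> M" for e
      using that less.prems(2)[of e] by (auto simp: M_def card_2_iff)
    have Z: "Z = insert x ((\<lambda>e. the_elem (e - {x})) ` M)"
    proof -
      have "e \<subseteq> insert x {the_elem (e - {x})} \<and> the_elem (e - {x}) \<in> e" if "e \<in> M" for e
      proof -
        obtain y where "e = {x, y}" using e2[OF \<open>e \<in> M\<close>] by blast
        moreover have "card e = 2" using that less.prems(2)[of e] by (auto simp: M_def)
        ultimately have "y \<noteq> x" by auto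
        then have "e - {x} = {y}" using \<open>e = {x,y}\<close> by auto
        then show ?thesis using \<open>e = {x,y}\<close> by simp
      qed
      then show ?thesis unfolding Z_def by blast
    qed
    have cZ: "card Z \<le> 2 * D + 1"
    proof -
      have "card Z \<le> Suc (card ((\<lambda>e. the_elem (e - {x})) ` M))" unfolding Z by (rule card_insert_le_m1) auto
      also have "\<dots> \<le> Suc (card M)" using card_image_le[OF finM] by simp
      finally show ?thesis using M by simp
    qed
    have finZ: "finite Z" unfolding Z using finM by simp
    define X' where "X' = X - Z"
    have sub: "X' \<subset> X" using x(1) by (auto simp: X'_def Z_def)
    then have "card X' < card X" using less.prems(1) by (simp add: psubset_card_mono)
    moreover have "finite X'" using sub less.prems(1) finite_subset by blast
    ultimately obtain I where I: "I \<subseteq> X'" "\<forall>e\<in>F. \<not> e \<subseteq> I" "card X' \<le> (2 * D + 1) * card I"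
      using less.hyps[of X'] less.prems sub by (metis psubset_imp_subset subset_trans)
    have xI: "x \<notin> I" "finite I" using I(1) \<open>finite X'\<close> finite_subset by (auto simp: X'_def Z_def)
    have "\<not> e \<subseteq> insert x I" if e: "e \<in> F" for e
    proof
      assume s: "e \<subseteq> insert x I"
      show False
      proof (cases "x \<in> e")
        case True
        then have "e \<in> M" using e s I(1) x(1) by (auto simp: M_def X'_def)
        then have "e \<subseteq> Z" by (auto simp: Z_def)
        then have "e \<subseteq> {x}" using s I(1) by (auto simp: X'_def)
        then show False using less.prems(2)[OF e] card_mono[of "{x}" e] by auto
      next
        case False
        then show False using s e I(2) by blast
      qed
    qed
    moreover have "card X \<le> card X' + card Z"
      using finZ by (simp add: X'_def) (metis card_Un_le diff_add_inverse diff_card_le_card_Diff le_diff_conv)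
    then have "card X \<le> (2 * D + 1) * card (insert x I)" using cZ I(3) xI by simp
    moreover have "insert x I \<subseteq> X" using I(1) x(1) by (auto simp: X'_def)
    ultimately show ?thesis by blast
  qed
qed

text \<open>Remove a vertex \<open>x\<close> of degree at most \<open>2 * D\<close>. A clique
  containing \<open>x\<close> is determined by the edges at \<open>x\<close> that it uses, so at
  most \<open>2 ^ (2 * D)\<close> cliques disappear with each vertex.\<close>

lemma card_cliques:
  assumes "finite X" "\<And>e. e \<in> F \<Longrightarrow> card e = 2"
    and "\<And>X'. X' \<subseteq> X \<Longrightarrow> card {e\<in>F. e \<subseteq> X'} \<le> D * card X'"
  shows "card {Q. Q \<subseteq> X \<and> Q \<noteq> {} \<and> (\<forall>e\<subseteq>Q. card e = 2 \<longrightarrow> e \<in> F)} \<le> 4 ^ D * card X"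
  using assms
proof (induction "card X" arbitrary: X rule: less_induct)
  case less
  let ?C = "\<lambda>X. {Q. Q \<subseteq> X \<and> Q \<noteq> {} \<and> (\<forall>e\<subseteq>Q. card e = 2 \<longrightarrow> e \<in> F)}"
  show ?case
  proof (cases "X = {}")
    case True
    then have eq: "?C X = {}" by auto
    show ?thesis unfolding eq by simp
  next
    case False
    obtain x where x: "x \<in> X" "card {e\<in>{e\<in>F. e \<subseteq> X}. x \<in> e} \<le> 2 * D"
      using low_degree[of X "{e\<in>F. e \<subseteq> X}" D] less.prems False by auto
    define M where "M = {e\<in>F. e \<subseteq> X \<and> x \<in> e}"
    have M: "card M \<le> 2 * D" using x(2) by (simp add: M_def conj_commute conj_left_commute conj_assoc)
    have finM: "finite M" using less.prems(1) by (simp add: M_def)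
    have IH: "card (?C (X - {x})) \<le> 4 ^ D * card (X - {x})"
      using less.prems x(1) by (intro less.hyps) (auto simp: card_Diff1_less simp del: card_Diff_insert card_Diff_singleton)
    have split: "?C X \<subseteq> ?C (X - {x}) \<union> {Q\<in>?C X. x \<in> Q}" by auto
    have "{Q\<in>?C X. x \<in> Q} \<subseteq> (\<lambda>N. insert x (\<Union>N)) ` Pow M"
    proof
      fix Q assume Q: "Q \<in> {Q\<in>?C X. x \<in> Q}"
      have "{{x, y} |y. y \<in> Q \<and> y \<noteq> x} \<subseteq> M" using Q by (auto simp: M_def)
      moreover have "Q = insert x (\<Union>{{x, y} |y. y \<in> Q \<and> y \<noteq> x})" using Q by auto
      ultimately show "Q \<in> (\<lambda>N. insert x (\<Union>N)) ` Pow M" by blast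
    qed
    then have "card {Q\<in>?C X. x \<in> Q} \<le> card (Pow M)"
      using finM by (meson card_image_le card_mono finite_Pow_iff finite_imageI le_trans)
    also have "\<dots> \<le> 2 ^ (2 * D)" using finM M by (simp add: card_Pow power_increasing)
    also have "\<dots> = 4 ^ D" by (simp add: power_mult)
    finally have b: "card {Q\<in>?C X. x \<in> Q} \<le> 4 ^ D" .
    have "card (?C X) \<le> card (?C (X - {x})) + card {Q\<in>?C X. x \<in> Q}"
    proof -
      have "finite (?C (X - {x}) \<union> {Q\<in>?C X. x \<in> Q})"
        using less.prems(1) by (auto intro: finite_subset[of _ "Pow X"])
      then show ?thesis using card_mono[OF _ split] card_Un_le le_trans by blast
    qed
    also have "\<dots> \<le> 4 ^ D * card (X - {x}) + 4 ^ D" using IH b by linarith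
    also have "\<dots> = 4 ^ D * card X"
      using x(1) less.prems(1) by (metis card_Suc_Diff1 mult_Suc_right add.commute)
    finally show ?thesis .
  qed
qed

section \<open>Bipartite graphs whose contractions are sparse\<close>

text \<open>A bipartite graph between \<open>X\<close> and \<open>Y\<close>, given by the neighbourhoods \<open>N y\<close> of the vertices of \<open>Y\<close>.
  The second density condition concerns the graphs on \<open>X\<close> obtained by contracting distinct
  vertices \<open>\<iota> e\<close> of \<open>Y\<close> to edges \<open>e\<close>.\<close>

definition bip :: "nat \<Rightarrow> 'a set \<Rightarrow> 'b set \<Rightarrow> ('b \<Rightarrow> 'a set) \<Rightarrow> bool" where
  "bip d X Y N \<longleftrightarrow> finite X \<and> finite Y \<and> (\<forall>y\<in>Y. N y \<subseteq> X) \<and>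
     (\<forall>X'\<subseteq>X. \<forall>Y'\<subseteq>Y. (\<Sum>y\<in>Y'. card (N y \<inter> X')) \<le> d * (card X' + card Y')) \<and>
     (\<forall>X'\<subseteq>X. \<forall>F \<iota>. inj_on \<iota> F \<and> (\<forall>e\<in>F. e \<subseteq> X' \<and> card e = 2 \<and> \<iota> e \<in> Y \<and> e \<subseteq> N (\<iota> e)) \<longrightarrow>
        card F \<le> d * card X')"

lemma bipD:
  assumes "bip d X Y N"
  shows "finite X" "finite Y" "y \<in> Y \<Longrightarrow> N y \<subseteq> X"
    and "X' \<subseteq> X \<Longrightarrow> Y' \<subseteq> Y \<Longrightarrow> (\<Sum>y\<in>Y'. card (N y \<inter> X')) \<le> d * (card X' + card Y')"
  using assms by (simp_all add: bip_def)

lemma bip_matching_card: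
  assumes "bip d X Y N" "X' \<subseteq> X" "inj_on \<iota> F"
    and "\<And>e. e \<in> F \<Longrightarrow> e \<subseteq> X' \<and> card e = 2 \<and> \<iota> e \<in> Y \<and> e \<subseteq> N (\<iota> e)"
  shows "card F \<le> d * card X'"
proof -
  have "inj_on \<iota> F \<and> (\<forall>e\<in>F. e \<subseteq> X' \<and> card e = 2 \<and> \<iota> e \<in> Y \<and> e \<subseteq> N (\<iota> e))"
    using assms(3,4) by blast
  then show ?thesis using assms(1,2) unfolding bip_def by blast
qed

lemma bip_subset:
  assumes "bip d X Y N" "X' \<subseteq> X" "Y' \<subseteq> Y"
  shows "bip d X' Y' (\<lambda>y. N y \<inter> X')"
  unfolding bip_def
proof (intro conjI allI impI ballI)
  show "finite X'" "finite Y'" using bipD(1,2)[OF assms(1)] assms(2,3) finite_subset by auto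
  fix X'' assume "X'' \<subseteq> X'"
  then have *: "N y \<inter> X' \<inter> X'' = N y \<inter> X''" "X'' \<subseteq> X" for y using assms(2) by auto
  show "(\<Sum>y\<in>Y''. card (N y \<inter> X' \<inter> X'')) \<le> d * (card X'' + card Y'')" if "Y'' \<subseteq> Y'" for Y''
    using bipD(4)[OF assms(1) *(2), of Y''] that assms(3) * by simp
  show "card F \<le> d * card X''"
    if "inj_on \<iota> F \<and> (\<forall>e\<in>F. e \<subseteq> X'' \<and> card e = 2 \<and> \<iota> e \<in> Y' \<and> e \<subseteq> N (\<iota> e) \<inter> X')" for F \<iota>
    using that assms(3) by (intro bip_matching_card[OF assms(1) *(2), of \<iota>]) auto
qed auto

lemma bip_cong:
  assumes "bip d X Y N" "\<And>y. y \<in> Y \<Longrightarrow> N y = N' y"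
  shows "bip d X Y N'"
  unfolding bip_def
proof (intro conjI allI impI ballI)
  show "finite X" "finite Y" using bipD(1,2)[OF assms(1)] .
  show "N' y \<subseteq> X" if "y \<in> Y" for y using bipD(3)[OF assms(1) that] assms(2)[OF that] by simp
  fix X' assume X': "X' \<subseteq> X"
  show "(\<Sum>y\<in>Y'. card (N' y \<inter> X')) \<le> d * (card X' + card Y')" if "Y' \<subseteq> Y" for Y'
  proof -
    have "(\<Sum>y\<in>Y'. card (N' y \<inter> X')) = (\<Sum>y\<in>Y'. card (N y \<inter> X'))"
      using assms(2) that by (intro sum.cong) auto
    then show ?thesis using bipD(4)[OF assms(1) X' that] by simp
  qed
  show "card F \<le> d * card X'"
    if "inj_on \<iota> F \<and> (\<forall>e\<in>F. e \<subseteq> X' \<and> card e = 2 \<and> \<iota> e \<in> Y \<and> e \<subseteq> N' (\<iota> e))" for F \<iota>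
    using that assms(2) by (intro bip_matching_card[OF assms(1) X', of \<iota>]) auto
qed

text \<open>Pairs from \<open>X\<close> are matched to distinct common neighbours in
  \<open>Y\<close>; the density bounds the size of such a matching, so a maximum one exists. A
  vertex \<open>y\<close> outside its range \<open>Y0\<close> could serve any unmatched pair inside
  \<open>N y\<close>, so \<open>N y\<close> is a clique in \<open>F\<close>. This splits
  \<open>Y\<close> into few exceptions and vertices with clique neighbourhoods.\<close>

lemma bip_maximal_matching:
  assumes "bip d X Y N"
  obtains F Y0 where "Y0 \<subseteq> Y" "card Y0 \<le> d * card X" "\<And>e. e \<in> F \<Longrightarrow> e \<subseteq> X \<and> card e = 2"
    "\<And>X'. X' \<subseteq> X \<Longrightarrow> card {e\<in>F. e \<subseteq> X'} \<le> d * card X'"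
    "\<And>y e. y \<in> Y - Y0 \<Longrightarrow> e \<subseteq> N y \<Longrightarrow> card e = 2 \<Longrightarrow> e \<in> F"
proof -
  define P where "P F \<iota> \<longleftrightarrow> inj_on \<iota> F \<and> (\<forall>e\<in>F. e \<subseteq> X \<and> card e = 2 \<and> \<iota> e \<in> Y \<and> e \<subseteq> N (\<iota> e))"
    for F and \<iota> :: "'a set \<Rightarrow> 'b"
  have 1: "\<exists>\<iota>. P {} \<iota>" by (simp add: P_def)
  have 2: "\<forall>F. (\<exists>\<iota>. P F \<iota>) \<longrightarrow> card F < Suc (d * card X)"
  proof (intro allI impI)
    fix F assume "\<exists>\<iota>. P F \<iota>"
    then obtain \<iota> where "P F \<iota>" ..
    then show "card F < Suc (d * card X)"
      using bip_matching_card[OF assms order_refl, of \<iota> F] unfolding P_def less_Suc_eq_le by simp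
  qed
  obtain F where F: "\<exists>\<iota>. P F \<iota>" "\<forall>F'. (\<exists>\<iota>. P F' \<iota>) \<longrightarrow> card F' \<le> card F"
    using ex_has_greatest_nat[OF 1 2] that by blast
  obtain \<iota> where "P F \<iota>" using F(1) ..
  then have \<iota>: "inj_on \<iota> F" "\<And>e. e \<in> F \<Longrightarrow> e \<subseteq> X \<and> card e = 2 \<and> \<iota> e \<in> Y \<and> e \<subseteq> N (\<iota> e)"
    by (simp_all add: P_def)
  have finX: "finite X" using assms by (simp add: bip_def)
  have finF: "finite F" by (rule finite_subset[of _ "Pow X"]) (use \<iota> finX in auto)
  show ?thesis
  proof (rule that[of "\<iota> ` F" F])
    show "\<iota> ` F \<subseteq> Y" using \<iota> by blast
    show "card (\<iota> ` F) \<le> d * card X"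
      using card_image_le[OF finF, of \<iota>] bip_matching_card[OF assms order_refl \<iota>] by simp
    show "e \<subseteq> X \<and> card e = 2" if "e \<in> F" for e using \<iota> that by blast
    show "card {e\<in>F. e \<subseteq> X'} \<le> d * card X'" if "X' \<subseteq> X" for X'
      using \<iota> by (intro bip_matching_card[OF assms that, of \<iota>]) (auto simp: inj_on_def)
    show "e \<in> F" if y: "y \<in> Y - \<iota> ` F" and e: "e \<subseteq> N y" "card e = 2" for y e
    proof (rule ccontr)
      assume "e \<notin> F"
      have "e \<subseteq> X" using y e bipD(3)[OF assms, of y] by blast
      have "P (insert e F) (\<iota>(e := y))"
        using \<iota> y e \<open>e \<notin> F\<close> \<open>e \<subseteq> X\<close> by (auto simp: P_def inj_on_def)
      then have "card (insert e F) \<le> card F" using F(2) by blast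
      then show False using finF \<open>e \<notin> F\<close> by simp
    qed
  qed
qed

text \<open>The exceptional vertices \<open>Y0\<close> contribute at most \<open>d * card X\<close>
  sets; all others are nonempty cliques of the sparse graph \<open>F\<close>, counted by
  \<open>card_cliques\<close>.\<close>

lemma bip_neighbourhoods:
  assumes "bip d X Y N"
  shows "card {N y |y. y \<in> Y \<and> N y \<noteq> {}} \<le> (d + 4 ^ d) * card X"
proof -
  obtain F Y0 where F: "Y0 \<subseteq> Y" "card Y0 \<le> d * card X" "\<And>e. e \<in> F \<Longrightarrow> e \<subseteq> X \<and> card e = 2"
    "\<And>X'. X' \<subseteq> X \<Longrightarrow> card {e\<in>F. e \<subseteq> X'} \<le> d * card X'"
    "\<And>y e. y \<in> Y - Y0 \<Longrightarrow> e \<subseteq> N y \<Longrightarrow> card e = 2 \<Longrightarrow> e \<in> F"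
    by (rule bip_maximal_matching[OF assms]) blast
  let ?C = "{Q. Q \<subseteq> X \<and> Q \<noteq> {} \<and> (\<forall>e\<subseteq>Q. card e = 2 \<longrightarrow> e \<in> F)}"
  have fin: "finite X" "finite Y0" using bipD(1,2)[OF assms] F(1) finite_subset by auto
  then have finC: "finite ?C" by (auto intro: finite_subset[of _ "Pow X"])
  have C: "card ?C \<le> 4 ^ d * card X" using F(3,4) fin(1) by (intro card_cliques) auto
  have "{N y |y. y \<in> Y \<and> N y \<noteq> {}} \<subseteq> N ` Y0 \<union> ?C"
  proof
    fix Q assume "Q \<in> {N y |y. y \<in> Y \<and> N y \<noteq> {}}"
    then obtain y where y: "Q = N y" "y \<in> Y" "N y \<noteq> {}" by blast
    show "Q \<in> N ` Y0 \<union> ?C" using y bipD(3)[OF assms y(2)] F(5)[of y] by (cases "y \<in> Y0") auto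
  qed
  then have "card {N y |y. y \<in> Y \<and> N y \<noteq> {}} \<le> card (N ` Y0 \<union> ?C)"
    using fin finC by (intro card_mono) auto
  also have "\<dots> \<le> card (N ` Y0) + card ?C" by (rule card_Un_le)
  also have "\<dots> \<le> d * card X + 4 ^ d * card X"
    using card_image_le[OF fin(2), of N] F(2) C by linarith
  finally show ?thesis by (simp add: algebra_simps)
qed

lemma card_pairs_le:
  assumes "finite A" "card A \<le> h"
  shows "card {e. e \<subseteq> A \<and> card e = 2} \<le> h * card A"
proof -
  have "{e. e \<subseteq> A \<and> card e = 2} \<subseteq> (\<lambda>(a, b). {a, b}) ` (A \<times> A)" by (auto simp: card_2_iff)
  then have "card {e. e \<subseteq> A \<and> card e = 2} \<le> card (A \<times> A)"
    using assms(1) by (meson card_image_le card_mono finite_SigmaI finite_imageI le_trans)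
  also have "\<dots> \<le> h * card A" using assms(2) by (simp add: card_cartesian_product)
  finally show ?thesis .
qed

text \<open>Pairs with a common neighbour outside \<open>Y0\<close> already belong to
  \<open>F\<close>. A vertex of \<open>Y0\<close> of degree at most \<open>h\<close> adds at most
  \<open>h\<close> times its degree many pairs, and the degrees over \<open>Y0\<close> sum to at
  most \<open>d * (card X + d * card X)\<close>.\<close>

lemma bip_conflicts:
  assumes "bip d X Y N"
  shows "card {e. e \<subseteq> X \<and> card e = 2 \<and> (\<exists>y\<in>Y. e \<subseteq> N y \<and> card (N y) \<le> h)} \<le> (h * d * (d + 1) + d) * card X"
proof -
  obtain F Y0 where F: "Y0 \<subseteq> Y" "card Y0 \<le> d * card X" "\<And>e. e \<in> F \<Longrightarrow> e \<subseteq> X \<and> card e = 2"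
    "\<And>X'. X' \<subseteq> X \<Longrightarrow> card {e\<in>F. e \<subseteq> X'} \<le> d * card X'"
    "\<And>y e. y \<in> Y - Y0 \<Longrightarrow> e \<subseteq> N y \<Longrightarrow> card e = 2 \<Longrightarrow> e \<in> F"
    by (rule bip_maximal_matching[OF assms]) blast
  have fin: "finite X" "finite Y0" and NX: "\<And>y. y \<in> Y \<Longrightarrow> N y \<subseteq> X"
    using bipD(1-3)[OF assms] F(1) finite_subset by auto
  define Y1 where "Y1 = {y\<in>Y0. card (N y) \<le> h}"
  have Y1: "Y1 \<subseteq> Y0" "finite Y1" using fin by (auto simp: Y1_def)
  let ?U = "\<Union>y\<in>Y1. {e. e \<subseteq> N y \<and> card e = 2}"
  have "{e. e \<subseteq> X \<and> card e = 2 \<and> (\<exists>y\<in>Y. e \<subseteq> N y \<and> card (N y) \<le> h)} \<subseteq> ?U \<union> {e\<in>F. e \<subseteq> X}"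
    using F(5) by (auto simp: Y1_def)
  moreover have "?U \<subseteq> Pow X" using NX F(1) Y1 by blast
  then have fU: "finite ?U" using fin(1) by (meson finite_Pow_iff finite_subset)
  ultimately have "card {e. e \<subseteq> X \<and> card e = 2 \<and> (\<exists>y\<in>Y. e \<subseteq> N y \<and> card (N y) \<le> h)} \<le> card (?U \<union> {e\<in>F. e \<subseteq> X})"
    using fin(1) by (intro card_mono) (auto intro: finite_subset[of _ "Pow X"])
  also have "\<dots> \<le> card ?U + card {e\<in>F. e \<subseteq> X}" by (rule card_Un_le)
  also have "card ?U \<le> h * d * (d + 1) * card X"
  proof -
    have "card ?U \<le> (\<Sum>y\<in>Y1. card {e. e \<subseteq> N y \<and> card e = 2})" using Y1 by (intro card_UN_le)
    also have "\<dots> \<le> (\<Sum>y\<in>Y1. h * card (N y))"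
    proof (rule sum_mono)
      fix y assume "y \<in> Y1"
      then show "card {e. e \<subseteq> N y \<and> card e = 2} \<le> h * card (N y)"
        using NX F(1) fin(1) by (intro card_pairs_le) (auto simp: Y1_def intro: finite_subset)
    qed
    also have "\<dots> = h * (\<Sum>y\<in>Y1. card (N y))" by (simp add: sum_distrib_left)
    also have "(\<Sum>y\<in>Y1. card (N y)) = (\<Sum>y\<in>Y1. card (N y \<inter> X))"
      using NX F(1) Y1 by (intro sum.cong) (auto simp: Int_absorb2 subset_iff)
    also have "\<dots> \<le> d * (card X + card Y1)" using F(1) Y1 by (intro bipD(4)[OF assms]) auto
    also have "\<dots> \<le> d * (card X + d * card X)"
      using F(2) card_mono[OF fin(2) Y1(1)] by simp
    finally show ?thesis by (simp add: algebra_simps)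
  qed
  also have "card {e\<in>F. e \<subseteq> X} \<le> d * card X" using F(4) by simp
  finally show ?thesis by (simp add: algebra_simps)
qed

text \<open>An independent set of the conflict graph, in which two vertices of \<open>X\<close> are
  joined when they have a common neighbour. The degree bound \<open>h\<close> makes that graph
  sparse in every induced subgraph.\<close>

lemma bip_packing:
  assumes "bip d X Y N" "\<And>y. y \<in> Y \<Longrightarrow> card (N y) \<le> h"
  shows "\<exists>I\<subseteq>X. card X \<le> (2 * (h * d * (d + 1) + d) + 1) * card I \<and> (\<forall>y\<in>Y. card (N y \<inter> I) \<le> 1)"
proof -
  let ?F = "{e. card e = 2 \<and> (\<exists>y\<in>Y. e \<subseteq> N y)}"
  note fin = bipD(1)[OF assms(1)] and NX = bipD(3)[OF assms(1)]
  have "card {e\<in>?F. e \<subseteq> X'} \<le> (h * d * (d + 1) + d) * card X'" if "X' \<subseteq> X" for X'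
  proof -
    have "card (N y \<inter> X') \<le> h" if "y \<in> Y" for y
    proof -
      have "card (N y \<inter> X') \<le> card (N y)"
        using fin NX[OF that] by (intro card_mono) (auto intro: finite_subset)
      then show ?thesis using assms(2)[OF that] by simp
    qed
    then have "{e\<in>?F. e \<subseteq> X'} = {e. e \<subseteq> X' \<and> card e = 2 \<and> (\<exists>y\<in>Y. e \<subseteq> N y \<inter> X' \<and> card (N y \<inter> X') \<le> h)}"
      by auto
    then show ?thesis using bip_conflicts[OF bip_subset[OF assms(1) that order_refl], of h] by simp
  qed
  then obtain I where I: "I \<subseteq> X" "\<forall>e\<in>?F. \<not> e \<subseteq> I" "card X \<le> (2 * (h * d * (d + 1) + d) + 1) * card I"
    using independent_set[OF fin, of ?F "h * d * (d + 1) + d"] by auto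
  show ?thesis
  proof (intro exI[of _ I] conjI ballI I(1,3))
    fix y assume y: "y \<in> Y"
    show "card (N y \<inter> I) \<le> 1"
    proof (rule ccontr)
      assume "\<not> ?thesis"
      then obtain e where "e \<subseteq> N y \<inter> I" "card e = 2"
        by (metis not_less_eq_eq One_nat_def numeral_2_eq_2 obtain_subset_with_card_n)
      then show False using I(2) y by auto
    qed
  qed
qed

text \<open>The form is \<open>\<kappa> * b ^ (4 * d)\<close> with \<open>b = \<kappa> * B\<close>.
  The factor \<open>\<kappa> = 12 * d^2 * (d + 2)\<close> combines 2 for the half of
  \<open>X\<close> that is lost, \<open>3 * d * (d + 2)\<close> for the packing at degree bound
  \<open>2 * d * b ^ j\<close>, and the \<open>2 * d\<close> in that bound. The exponent does not
  involve \<open>B\<close>.\<close>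

definition scat :: "nat \<Rightarrow> nat \<Rightarrow> nat" where
  "scat d B = 12 * d^2 * (d + 2) * (12 * d^2 * (d + 2) * B) ^ (4 * d)"

text \<open>The degrees of \<open>Y\<close> are split into \<open>4 * d\<close> windows with ratio \<open>b\<close>.  The edge density bounds the
  total number of edges at vertices of degree at least \<open>2 * d\<close>, so some window meets at most half of
  \<open>X\<close>.  The vertices above it form \<open>D\<close>; after deleting the neighbours of the window, only vertices
  below it cause conflicts, and the gap \<open>b\<close> makes \<open>D\<close> small compared to an independent set of the
  conflict graph.\<close>

lemma scatter:
  assumes "bip d X Y N" "1 \<le> d" "1 \<le> B"
  shows "\<exists>D\<subseteq>Y. \<exists>I\<subseteq>X. B * card D \<le> card I \<and> card X \<le> scat d B * card I \<and>
    (\<forall>y\<in>Y - D. card (N y \<inter> I) \<le> 1)"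
proof -
  define \<kappa> where "\<kappa> = 12 * d^2 * (d + 2)"
  define b where "b = \<kappa> * B"
  have "0 < \<kappa>" using assms(2) by (simp add: \<kappa>_def del: add_2_eq_Suc add_2_eq_Suc')
  then have "1 \<le> \<kappa>" by simp
  then have b1: "1 \<le> b" using assms(3) by (simp add: b_def)
  define L where "L j = 2 * d * b ^ j" for j
  have L1: "1 \<le> L j" "2 * d \<le> L j" for j
  proof -
    have "1 \<le> b ^ j" using b1 by simp
    then have "2 * d * 1 \<le> 2 * d * b ^ j" by (rule mult_le_mono2)
    then show "2 * d \<le> L j" by (simp add: L_def)
    then show "1 \<le> L j" using assms(2) by simp
  qed
  have Lmono: "L i \<le> L j" if "i \<le> j" for i j using that b1 by (simp add: L_def power_increasing)
  note fin = bipD(1,2)[OF assms(1)]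
  define Yp where "Yp = {y\<in>Y. 2 * d \<le> card (N y)}"
  have Yp: "Yp \<subseteq> Y" "finite Yp" using fin by (auto simp: Yp_def)
  have sumYp: "(\<Sum>y\<in>Yp. card (N y)) \<le> 2 * d * card X"
  proof -
    have "(\<Sum>y\<in>Yp. card (N y \<inter> X)) \<le> d * (card X + card Yp)"
      using Yp by (intro bipD(4)[OF assms(1)]) auto
    moreover have "N y \<inter> X = N y" if "y \<in> Yp" for y using bipD(3)[OF assms(1)] Yp that by blast
    ultimately have "(\<Sum>y\<in>Yp. card (N y)) \<le> d * card X + d * card Yp" by (simp add: algebra_simps)
    \<comment> \<open>Degrees of at least \<open>2 * d\<close> let half of the degree sum absorb the
      term \<open>d * card Yp\<close>.\<close>
    moreover have "2 * d * card Yp \<le> (\<Sum>y\<in>Yp. card (N y))"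
      using sum_bounded_below[of Yp "2 * d" "\<lambda>y. card (N y)"] by (simp add: Yp_def mult.commute)
    ultimately show ?thesis by linarith
  qed
  define W where "W j = {y\<in>Y. L j \<le> card (N y) \<and> card (N y) < L (Suc j)}" for j
  have W: "W j \<subseteq> Yp" "finite (W j)" for j
    using L1(2)[of j] fin by (auto simp: W_def Yp_def intro: order_trans)
  have Wless: "W i \<inter> W j = {}" if "i < j" for i j
    using Lmono[of "Suc i" j] that by (auto simp: W_def)
  have Wdisj: "W i \<inter> W j = {}" if "i \<noteq> j" for i j
    using Wless[of i j] Wless[of j i] that by (cases i j rule: linorder_cases) auto
  obtain j where j: "j < 4 * d" "2 * (\<Sum>y\<in>W j. card (N y)) \<le> card X"
  proof -
    have "\<exists>j<4 * d. 2 * (\<Sum>y\<in>W j. card (N y)) \<le> card X"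
    proof (rule ccontr)
      assume "\<not> ?thesis"
      then have *: "card X + 1 \<le> 2 * (\<Sum>y\<in>W j. card (N y))" if "j < 4 * d" for j using that by force
      have "4 * d * (card X + 1) \<le> (\<Sum>j<4 * d. 2 * (\<Sum>y\<in>W j. card (N y)))"
        using sum_bounded_below[of "{..<4 * d}" "card X + 1" "\<lambda>j. 2 * (\<Sum>y\<in>W j. card (N y))"] * by simp
      also have "\<dots> = 2 * (\<Sum>y\<in>(\<Union>j<4 * d. W j). card (N y))"
        using W Wdisj by (subst sum.UNION_disjoint) (auto simp: sum_distrib_left)
      also have "\<dots> \<le> 2 * (\<Sum>y\<in>Yp. card (N y))"
        using W(1) Yp by (intro mult_left_mono sum_mono2) auto
      also have "\<dots> \<le> 4 * d * card X" using sumYp by simp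
      finally show False using assms(2) by simp
    qed
    then show ?thesis using that by blast
  qed
  define X0 where "X0 = X - (\<Union>y\<in>W j. N y)"
  have X0: "X0 \<subseteq> X" "card X \<le> 2 * card X0"
  proof -
    have NW: "(\<Union>y\<in>W j. N y) \<subseteq> X" using bipD(3)[OF assms(1)] by (auto simp: W_def)
    have "card (\<Union>y\<in>W j. N y) \<le> (\<Sum>y\<in>W j. card (N y))" using W by (intro card_UN_le)
    moreover have "card X0 = card X - card (\<Union>y\<in>W j. N y)"
      unfolding X0_def using NW fin finite_subset by (intro card_Diff_subset) auto
    ultimately show "card X \<le> 2 * card X0" using j(2) by linarith
  qed (auto simp: X0_def)
  define D where "D = {y\<in>Y. L (Suc j) \<le> card (N y)}"
  have D: "D \<subseteq> Y" "D \<subseteq> Yp" using L1(2)[of "Suc j"] by (auto simp: D_def Yp_def)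
  have cD: "card D * L (Suc j) \<le> 2 * d * card X"
  proof -
    have "card D * L (Suc j) \<le> (\<Sum>y\<in>D. card (N y))"
      using sum_bounded_below[of D "L (Suc j)" "\<lambda>y. card (N y)"] by (simp add: D_def)
    also have "\<dots> \<le> (\<Sum>y\<in>Yp. card (N y))" using D Yp by (intro sum_mono2) auto
    finally show ?thesis using sumYp by simp
  qed
  have "bip d X0 (Y - D) (\<lambda>y. N y \<inter> X0)" using X0 by (intro bip_subset[OF assms(1)]) auto
  moreover have "card (N y \<inter> X0) \<le> L j" if "y \<in> Y - D" for y
  proof (cases "y \<in> W j")
    case True
    then have "N y \<inter> X0 = {}" by (auto simp: X0_def)
    then show ?thesis by simp
  next
    case False
    then have "card (N y) \<le> L j" using that by (auto simp: W_def D_def)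
    moreover have "card (N y \<inter> X0) \<le> card (N y)"
      using that bipD(3)[OF assms(1), of y] fin by (intro card_mono) (auto intro: finite_subset)
    ultimately show ?thesis by simp
  qed
  ultimately obtain I where I: "I \<subseteq> X0" "card X0 \<le> (2 * (L j * d * (d + 1) + d) + 1) * card I"
      "\<forall>y\<in>Y - D. card (N y \<inter> X0 \<inter> I) \<le> 1"
    using bip_packing[of d X0 "Y - D" "\<lambda>y. N y \<inter> X0" "L j"] by blast
  have cX: "card X \<le> \<kappa> * b ^ j * card I"
  proof -
    have "d \<le> d * L j" using L1(1)[of j] by simp
    moreover have "3 * d * (d + 2) * L j = 2 * (L j * d * (d + 1)) + d * d * L j + 4 * (d * L j)"
      by (simp add: algebra_simps)
    ultimately have "2 * (L j * d * (d + 1) + d) + 1 \<le> 3 * d * (d + 2) * L j"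
      using assms(2) unfolding distrib_left[of 2] by linarith
    then have "card X0 \<le> 3 * d * (d + 2) * L j * card I" using I(2) by (meson le_trans mult_le_mono1)
    then have "card X \<le> 2 * (3 * d * (d + 2) * L j * card I)" using X0 by linarith
    then show ?thesis by (simp add: L_def \<kappa>_def power2_eq_square algebra_simps)
  qed
  show ?thesis
  proof (intro exI[of _ D] exI[of _ I] conjI ballI)
    show "D \<subseteq> Y" by fact
    show "I \<subseteq> X" using I X0 by blast
    show "card (N y \<inter> I) \<le> 1" if "y \<in> Y - D" for y
      using bspec[OF I(3) that] I(1) by (simp add: Int_assoc Int_absorb1)
    have "b ^ j \<le> b ^ (4 * d)" using j b1 by (simp add: power_increasing)
    then show "card X \<le> scat d B * card I"
      using cX unfolding scat_def \<kappa>_def[symmetric] b_def[symmetric]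
      by (meson le_trans mult_le_mono1 mult_le_mono2)
    \<comment> \<open>The next window starts a factor \<open>b = \<kappa> * B\<close> higher: one
      factor \<open>\<kappa>\<close> pays for the loss from \<open>X\<close> to \<open>I\<close>,
      and the ratio \<open>B\<close> remains.\<close>
    have "2 * d * b ^ j * (b * card D) = card D * L (Suc j)" by (simp add: L_def)
    also have "\<dots> \<le> 2 * d * card X" by (rule cD)
    also have "\<dots> \<le> 2 * d * (\<kappa> * b ^ j * card I)" using cX by (rule mult_le_mono2)
    also have "\<dots> = 2 * d * b ^ j * (\<kappa> * card I)" by simp
    finally have "2 * d * b ^ j * (b * card D) \<le> 2 * d * b ^ j * (\<kappa> * card I)" .
    moreover have "0 < 2 * d * b ^ j" using assms(2) b1 by simp
    ultimately have "b * card D \<le> \<kappa> * card I" by (simp only: nat_mult_le_cancel1)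
    then have "\<kappa> * (B * card D) \<le> \<kappa> * card I" by (simp add: b_def algebra_simps)
    then show "B * card D \<le> card I" using \<open>1 \<le> \<kappa>\<close> by simp
  qed
qed

section \<open>Scattered sets in graphs with sparse shallow minors\<close>

text \<open>Depth 5 covers all contractions below. Attaching branch sets of radius \<open>r'\<close>
  to one of radius \<open>r\<close> gives radius \<open>r + 1 + 2 * r'\<close>, and the extreme case
  is \<open>r = 0\<close>, \<open>r' = 2\<close>, where balls of radius 2 are contracted into single
  vertices of \<open>R\<close>.\<close>

definition sparse :: "nat \<Rightarrow> 'a graph \<Rightarrow> bool" where
  "sparse d G \<longleftrightarrow> (\<forall>H :: 'a graph. shallow_minor 5 H G \<longrightarrow> card (edges H) \<le> d * card (verts H))"

section \<open>Walks, radii and branch sets\<close>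

lemma relpow_subset:
  fixes R S :: "('a \<times> 'a) set"
  assumes "R \<subseteq> S" shows "R ^^ n \<subseteq> S ^^ n"
proof (induction n)
  case (Suc n)
  show ?case using relcomp_mono[of "R ^^ n" "S ^^ n" R S] Suc assms by simp
qed simp

lemma arcs_within_mono: "B \<subseteq> B' \<Longrightarrow> arcs_within G B \<subseteq> arcs_within G B'"
  by (auto simp: arcs_within_def)

lemma sym_arcs_within_relpow: "(u, v) \<in> arcs_within G B ^^ l \<Longrightarrow> (v, u) \<in> arcs_within G B ^^ l"
proof (induction l arbitrary: v)
  case (Suc l)
  then obtain w where w: "(u, w) \<in> arcs_within G B ^^ l" "(w, v) \<in> arcs_within G B" by auto
  then have "(v, w) \<in> arcs_within G B" by (auto simp: arcs_within_def insert_commute)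
  then show ?case using Suc.IH[OF w(1)] by (rule relpow_Suc_I2)
qed simp

lemma connected_radius_le_mono:
  "connected_radius_le G r B \<Longrightarrow> r \<le> r' \<Longrightarrow> connected_radius_le G r' B"
  unfolding connected_radius_le_def by (meson order_trans)

lemma connected_radius_le_singleton [simp]: "connected_radius_le G r {v}"
  by (auto simp: connected_radius_le_def intro!: exI[of _ 0])

text \<open>A walk runs from the centre of \<open>B\<close> to the connecting edge, across it, from
  there to the centre of \<open>C i\<close>, and on to its target; the lengths are at most
  \<open>r\<close>, 1, \<open>r'\<close> and \<open>r'\<close>.\<close>

lemma connected_radius_le_attach:
  assumes "connected_radius_le G r B"
    and "\<And>i. i \<in> J \<Longrightarrow> connected_radius_le G r' (C i) \<and> (\<exists>u\<in>B. \<exists>v\<in>C i. {u, v} \<in> edges G)"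
  shows "connected_radius_le G (r + 1 + 2 * r') (B \<union> (\<Union>i\<in>J. C i))"
proof -
  let ?U = "B \<union> (\<Union>i\<in>J. C i)"
  obtain c where c: "c \<in> B" "\<And>v. v \<in> B \<Longrightarrow> \<exists>l\<le>r. (c, v) \<in> arcs_within G B ^^ l"
    using assms(1) unfolding connected_radius_le_def by blast
  have "\<exists>l\<le>r + 1 + 2 * r'. (c, v) \<in> arcs_within G ?U ^^ l" if v: "v \<in> ?U" for v
  proof (cases "v \<in> B")
    case True
    then obtain l where "l \<le> r" "(c, v) \<in> arcs_within G B ^^ l" using c by blast
    then show ?thesis using relpow_subset[OF arcs_within_mono[of B ?U G], of l]
      by (intro exI[of _ l]) auto
  next
    case False
    then obtain i where i: "i \<in> J" "v \<in> C i" using v by blast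
    obtain u w where uw: "u \<in> B" "w \<in> C i" "{u, w} \<in> edges G" using assms(2)[OF i(1)] by blast
    obtain c' where c': "\<And>v. v \<in> C i \<Longrightarrow> \<exists>l\<le>r'. (c', v) \<in> arcs_within G (C i) ^^ l"
      using assms(2)[OF i(1)] unfolding connected_radius_le_def by blast
    obtain l1 where l1: "l1 \<le> r" "(c, u) \<in> arcs_within G B ^^ l1" using c uw by blast
    obtain l2 where l2: "l2 \<le> r'" "(c', w) \<in> arcs_within G (C i) ^^ l2" using c' uw by blast
    obtain l3 where l3: "l3 \<le> r'" "(c', v) \<in> arcs_within G (C i) ^^ l3" using c' i by blast
    have sub: "arcs_within G B ^^ l \<subseteq> arcs_within G ?U ^^ l" "arcs_within G (C i) ^^ l \<subseteq> arcs_within G ?U ^^ l" for l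
      using i(1) by (auto intro!: relpow_subset arcs_within_mono)
    have "(c, u) \<in> arcs_within G ?U ^^ l1" using l1 sub by blast
    moreover have "(u, w) \<in> arcs_within G ?U" using uw i(1) by (auto simp: arcs_within_def)
    ultimately have "(c, w) \<in> arcs_within G ?U ^^ (Suc l1)" by (rule relpow_Suc_I)
    moreover have "(w, c') \<in> arcs_within G ?U ^^ l2"
      using sym_arcs_within_relpow[OF l2(2)] sub by blast
    moreover have "(c', v) \<in> arcs_within G ?U ^^ l3" using l3 sub by blast
    ultimately have "(c, v) \<in> arcs_within G ?U ^^ (Suc l1 + l2 + l3)"
      unfolding relpow_add by blast
    then show ?thesis using l1 l2 l3 by (intro exI[of _ "Suc l1 + l2 + l3"]) auto
  qed
  then show ?thesis using c(1) unfolding connected_radius_le_def by blast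
qed

lemma sparse_minor:
  fixes G :: "'a graph" and X :: "'a set"
  assumes "sparse d G" "finite X" "\<And>e. e \<in> F \<Longrightarrow> e \<subseteq> X \<and> card e = 2"
    and "\<And>x. x \<in> X \<Longrightarrow> \<phi> x \<subseteq> verts G \<and> connected_radius_le G 5 (\<phi> x)"
    and "\<And>x x'. x \<in> X \<Longrightarrow> x' \<in> X \<Longrightarrow> x \<noteq> x' \<Longrightarrow> \<phi> x \<inter> \<phi> x' = {}"
    and "\<And>x x'. {x, x'} \<in> F \<Longrightarrow> \<exists>u\<in>\<phi> x. \<exists>v\<in>\<phi> x'. {u, v} \<in> edges G"
  shows "card F \<le> d * card X"
proof -
  have "shallow_minor 5 \<lparr>verts = X, edges = F\<rparr> G"
    unfolding shallow_minor_def simple_graph_def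
  proof (intro conjI exI[of _ \<phi>])
    show "\<forall>h\<in>verts \<lparr>verts = X, edges = F\<rparr>. \<forall>h'\<in>verts \<lparr>verts = X, edges = F\<rparr>. h \<noteq> h' \<longrightarrow> \<phi> h \<inter> \<phi> h' = {}"
      using assms(5) by simp
  qed (use assms(2-4,6) in auto)
  then have "card (edges \<lparr>verts = X, edges = F\<rparr>) \<le> d * card (verts \<lparr>verts = X, edges = F\<rparr>)"
    using assms(1) unfolding sparse_def by blast
  then show ?thesis by simp
qed

text \<open>The edge density is that of the minor with branch sets \<open>\<beta>\<close>. For the
  second density condition each \<open>\<beta> (\<iota> e)\<close> is absorbed by one end
  \<open>a e\<close> of the pair \<open>e\<close>, which makes it adjacent to the other end.
  Injectivity of \<open>\<iota>\<close> keeps the enlarged branch sets disjoint, and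
  \<open>connected_radius_le_attach\<close> bounds their radius.\<close>

lemma bip_branch_sets:
  fixes G :: "'a graph" and X Y :: "'a set"
  assumes "sparse d G" "finite X" "finite Y" "X \<inter> Y = {}"
    and sub: "\<And>z. z \<in> X \<union> Y \<Longrightarrow> \<beta> z \<subseteq> verts G"
    and disj: "\<And>z z'. z \<in> X \<union> Y \<Longrightarrow> z' \<in> X \<union> Y \<Longrightarrow> z \<noteq> z' \<Longrightarrow> \<beta> z \<inter> \<beta> z' = {}"
    and rX: "\<And>x. x \<in> X \<Longrightarrow> connected_radius_le G r (\<beta> x)"
    and rY: "\<And>y. y \<in> Y \<Longrightarrow> connected_radius_le G r' (\<beta> y)"
    and "r + 1 + 2 * r' \<le> 5"
  shows "bip d X Y (\<lambda>y. {x\<in>X. \<exists>u\<in>\<beta> x. \<exists>v\<in>\<beta> y. {u, v} \<in> edges G})" (is "bip d X Y ?N")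
  unfolding bip_def
proof (intro conjI allI impI ballI)
  have r5: "connected_radius_le G 5 (\<beta> z)" if "z \<in> X \<union> Y" for z
    using that connected_radius_le_mono[OF rX, of z 5] connected_radius_le_mono[OF rY, of z 5] assms(9) by auto
  fix X' assume X': "X' \<subseteq> X"
  then have fX': "finite X'" using assms(2) finite_subset by blast
  show "(\<Sum>y\<in>Y'. card (?N y \<inter> X')) \<le> d * (card X' + card Y')" if Y': "Y' \<subseteq> Y" for Y'
  proof -
    have fY': "finite Y'" using assms(3) Y' finite_subset by blast
    let ?F = "(\<lambda>(y, x). {x, y}) ` (SIGMA y:Y'. ?N y \<inter> X')"
    have "(\<Sum>y\<in>Y'. card (?N y \<inter> X')) = card (SIGMA y:Y'. ?N y \<inter> X')"
      using fY' assms(2) by simp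
    also have "\<dots> = card ?F"
    proof (rule card_image[symmetric], rule inj_onI, clarify)
      fix x y x' y' assume "y \<in> Y'" "y' \<in> Y'" "x \<in> X'" "x' \<in> X'" "{x, y} = {x', y'}"
      then show "y = y' \<and> x = x'" using X' Y' assms(4) by (auto simp: doubleton_eq_iff)
    qed
    also have "\<dots> \<le> d * card (X' \<union> Y')"
    proof (rule sparse_minor[OF assms(1), of _ _ \<beta>])
      show "finite (X' \<union> Y')" using fX' fY' by simp
      show "e \<subseteq> X' \<union> Y' \<and> card e = 2" if e: "e \<in> ?F" for e
      proof -
        obtain x y where "e = {x, y}" "x \<in> X'" "y \<in> Y'" using e by auto
        moreover then have "x \<noteq> y" using X' Y' assms(4) by blast
        ultimately show ?thesis by auto
      qed
      show "\<beta> x \<subseteq> verts G \<and> connected_radius_le G 5 (\<beta> x)" if "x \<in> X' \<union> Y'" for x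
        using that X' Y' sub r5 by blast
      show "\<beta> x \<inter> \<beta> x' = {}" if "x \<in> X' \<union> Y'" "x' \<in> X' \<union> Y'" "x \<noteq> x'" for x x'
        using that X' Y' by (intro disj) auto
      show "\<exists>u\<in>\<beta> x. \<exists>v\<in>\<beta> x'. {u, v} \<in> edges G" if e: "{x, x'} \<in> ?F" for x x'
      proof -
        obtain a b where ab: "{x, x'} = {a, b}" "\<exists>u\<in>\<beta> a. \<exists>v\<in>\<beta> b. {u, v} \<in> edges G"
          using e by auto
        moreover from ab(2) have "\<exists>u\<in>\<beta> b. \<exists>v\<in>\<beta> a. {u, v} \<in> edges G" by (metis insert_commute)
        ultimately show ?thesis by (auto simp: doubleton_eq_iff)
      qed
    qed
    also have "card (X' \<union> Y') = card X' + card Y'"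
      using X' Y' assms(4) fX' fY' by (intro card_Un_disjoint) auto
    finally show ?thesis .
  qed
  show "card F \<le> d * card X'"
    if "inj_on \<iota> F \<and> (\<forall>e\<in>F. e \<subseteq> X' \<and> card e = 2 \<and> \<iota> e \<in> Y \<and> e \<subseteq> ?N (\<iota> e))" for F \<iota>
  proof -
    have inj: "inj_on \<iota> F" and F: "\<And>e. e \<in> F \<Longrightarrow> e \<subseteq> X' \<and> card e = 2 \<and> \<iota> e \<in> Y"
      and N: "\<And>e x. e \<in> F \<Longrightarrow> x \<in> e \<Longrightarrow> \<exists>u\<in>\<beta> x. \<exists>v\<in>\<beta> (\<iota> e). {u, v} \<in> edges G"
      using that by auto
    define a where "a e = (SOME x. x \<in> e)" for e :: "'a set"
    have a: "a e \<in> e" if "e \<in> F" for e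
    proof -
      have "e \<noteq> {}" using F[OF that] by auto
      then show ?thesis unfolding a_def by (simp add: some_in_eq)
    qed
    define \<phi> where "\<phi> x = \<beta> x \<union> (\<Union>e\<in>{e\<in>F. a e = x}. \<beta> (\<iota> e))" for x
    show ?thesis
    proof (rule sparse_minor[OF assms(1) fX', of _ \<phi>])
      show "e \<subseteq> X' \<and> card e = 2" if "e \<in> F" for e using F[OF that] by blast
      show "\<phi> x \<subseteq> verts G \<and> connected_radius_le G 5 (\<phi> x)" if x: "x \<in> X'" for x
      proof
        show "\<phi> x \<subseteq> verts G" using x X' F sub unfolding \<phi>_def by blast
        have "connected_radius_le G (r + 1 + 2 * r') (\<phi> x)"
          unfolding \<phi>_def using x X' F a N rX rY by (intro connected_radius_le_attach) auto
        then show "connected_radius_le G 5 (\<phi> x)" using assms(9) connected_radius_le_mono by blast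
      qed
      show "\<phi> x \<inter> \<phi> x' = {}" if x: "x \<in> X'" "x' \<in> X'" "x \<noteq> x'" for x x'
      proof -
        have 1: "\<beta> x \<inter> \<beta> x' = {}" using x X' by (intro disj) auto
        have 2: "\<beta> z \<inter> \<beta> (\<iota> e) = {}" if "z \<in> X'" "e \<in> F" for z e
          using that F[OF that(2)] X' assms(4) by (intro disj) auto
        have 3: "\<beta> (\<iota> e) \<inter> \<beta> (\<iota> e') = {}" if "e \<in> F" "e' \<in> F" "e \<noteq> e'" for e e'
          using that F[of e] F[of e'] inj_onD[OF inj, of e e'] by (intro disj) auto
        show ?thesis using 1 2 3 x unfolding \<phi>_def by blast
      qed
      show "\<exists>u\<in>\<phi> x. \<exists>v\<in>\<phi> x'. {u, v} \<in> edges G" if e: "{x, x'} \<in> F" for x x'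
      proof -
        consider "a {x, x'} = x" | "a {x, x'} = x'" using a[OF e] by auto
        then show ?thesis
        proof cases
          case 1
          obtain u v where "u \<in> \<beta> x'" "v \<in> \<beta> (\<iota> {x, x'})" "{u, v} \<in> edges G" using N[OF e, of x'] by auto
          moreover have "\<beta> (\<iota> {x, x'}) \<subseteq> \<phi> x" using 1 e by (auto simp: \<phi>_def)
          ultimately have "v \<in> \<phi> x" "u \<in> \<phi> x'" "{v, u} \<in> edges G" by (auto simp: \<phi>_def insert_commute)
          then show ?thesis by blast
        next
          case 2
          obtain u v where "u \<in> \<beta> x" "v \<in> \<beta> (\<iota> {x, x'})" "{u, v} \<in> edges G" using N[OF e, of x] by auto
          moreover have "\<beta> (\<iota> {x, x'}) \<subseteq> \<phi> x'" using 2 e by (auto simp: \<phi>_def)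
          ultimately have "u \<in> \<phi> x" "v \<in> \<phi> x'" "{u, v} \<in> edges G" by (auto simp: \<phi>_def)
          then show ?thesis by blast
        qed
      qed
    qed
  qed
qed (use assms in auto)

section \<open>Scattering balls of radius 2\<close>

definition nbhd :: "'a graph \<Rightarrow> 'a set \<Rightarrow> 'a set" where
  "nbhd G S = {v \<in> verts G. \<exists>u\<in>S. {u, v} \<in> edges G}"

text \<open>Iterated on \<open>{x}\<close> with \<open>x\<close> outside \<open>D\<close>, this
  yields the balls around \<open>x\<close> in the graph without \<open>D\<close>.\<close>

definition grow :: "'a graph \<Rightarrow> 'a set \<Rightarrow> 'a set \<Rightarrow> 'a set" where
  "grow G D S = S \<union> (nbhd G S - D)"

lemma grow_mono: "D' \<subseteq> D \<Longrightarrow> S \<subseteq> S' \<Longrightarrow> grow G D S \<subseteq> grow G D' S'"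
  by (auto simp: grow_def nbhd_def)

lemma grow_subset_verts: "S \<subseteq> verts G \<Longrightarrow> grow G D S \<subseteq> verts G"
  by (auto simp: grow_def nbhd_def)

lemma connected_radius_le_grow:
  assumes "connected_radius_le G r S"
  shows "connected_radius_le G (Suc r) (grow G D S)"
proof -
  have "connected_radius_le G (r + 1 + 2 * 0) (S \<union> (\<Union>v\<in>nbhd G S - D. {v}))"
    using assms by (intro connected_radius_le_attach) (auto simp: nbhd_def)
  then show ?thesis by (simp add: grow_def)
qed

text \<open>Grown balls can collide in two ways. Collisions through an edge between two balls are
  excluded by passing to an independent set \<open>X0\<close> of the contracted graph. Collisions in
  a vertex outside all these balls are handled by \<open>scatter\<close>, applied to the balls
  against the remaining vertices: outside \<open>D\<close> each such vertex touches at most one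
  chosen ball.\<close>

lemma scatter_step:
  fixes G :: "'a graph" and X :: "'a set"
  assumes "sparse d G" "finite (verts G)" "1 \<le> d" "1 \<le> B" "finite X" "r \<le> 4"
    and sub: "\<And>x. x \<in> X \<Longrightarrow> \<beta> x \<subseteq> verts G \<and> connected_radius_le G r (\<beta> x) \<and> x \<in> \<beta> x"
    and disj: "\<And>x x'. x \<in> X \<Longrightarrow> x' \<in> X \<Longrightarrow> x \<noteq> x' \<Longrightarrow> \<beta> x \<inter> \<beta> x' = {}"
  shows "\<exists>D\<subseteq>verts G. \<exists>X'\<subseteq>X. B * card D \<le> card X' \<and> card X \<le> (2 * d + 1) * scat d B * card X' \<and>
    (\<forall>x\<in>X'. D \<inter> \<beta> x = {}) \<and>
    (\<forall>x\<in>X'. \<forall>x'\<in>X'. x \<noteq> x' \<longrightarrow> grow G D (\<beta> x) \<inter> grow G D (\<beta> x') = {})"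
proof -
  define adj where "adj x x' \<longleftrightarrow> (\<exists>u\<in>\<beta> x. \<exists>v\<in>\<beta> x'. {u, v} \<in> edges G)" for x x'
  have disj': "x = x'" if "x \<in> X" "x' \<in> X" "v \<in> \<beta> x" "v \<in> \<beta> x'" for x x' v
    using disj[of x x'] that by blast
  have adj_sym: "adj x x' \<Longrightarrow> adj x' x" for x x' unfolding adj_def by (metis insert_commute)
  define F where "F = {e. \<exists>x\<in>X. \<exists>x'\<in>X. x \<noteq> x' \<and> e = {x, x'} \<and> adj x x'}"
  have F2: "card e = 2" if "e \<in> F" for e using that by (auto simp: F_def)
  have "card {e\<in>F. e \<subseteq> X'} \<le> d * card X'" if "X' \<subseteq> X" for X'
  proof (rule sparse_minor[OF assms(1), of _ _ \<beta>])
    show "finite X'" using that assms(5) finite_subset by blast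
    show "\<beta> x \<subseteq> verts G \<and> connected_radius_le G 5 (\<beta> x)" if "x \<in> X'" for x
      using sub[of x] that \<open>X' \<subseteq> X\<close> assms(6) connected_radius_le_mono[of G r "\<beta> x" 5] by auto
    show "\<exists>u\<in>\<beta> x. \<exists>v\<in>\<beta> x'. {u, v} \<in> edges G" if "{x, x'} \<in> {e\<in>F. e \<subseteq> X'}" for x x'
      using that adj_sym unfolding adj_def[symmetric] by (auto simp: F_def doubleton_eq_iff)
    show "\<beta> x \<inter> \<beta> x' = {}" if "x \<in> X'" "x' \<in> X'" "x \<noteq> x'" for x x'
      using disj[of x x'] that \<open>X' \<subseteq> X\<close> by blast
  qed (use F2 in auto)
  then obtain X0 where X0: "X0 \<subseteq> X" "\<forall>e\<in>F. \<not> e \<subseteq> X0" "card X \<le> (2 * d + 1) * card X0"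
    using independent_set[OF assms(5), of F d] F2 by metis
  have ind: "\<not> adj x x'" if "x \<in> X0" "x' \<in> X0" "x \<noteq> x'" for x x'
  proof
    assume "adj x x'"
    then have "{x, x'} \<in> F" using that X0(1) by (auto simp: F_def)
    then have "\<not> {x, x'} \<subseteq> X0" by (rule bspec[OF X0(2)])
    then show False using that by simp
  qed
  define Y where "Y = verts G - (\<Union>x\<in>X0. \<beta> x)"
  define \<gamma> where "\<gamma> z = (if z \<in> X0 then \<beta> z else {z})" for z
  have self: "x \<in> \<beta> x" if "x \<in> X0" for x using sub[OF subsetD[OF X0(1) that]] by blast
  then have XY: "X0 \<inter> Y = {}" by (auto simp: Y_def)
  let ?N = "\<lambda>y. {x\<in>X0. \<exists>u\<in>\<gamma> x. \<exists>v\<in>\<gamma> y. {u, v} \<in> edges G}"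
  have "bip d X0 Y ?N"
  proof (rule bip_branch_sets[OF assms(1) _ _ XY, of \<gamma> r 0])
    show "finite X0" by (rule finite_subset[OF X0(1) assms(5)])
    show "finite Y" using assms(2) by (simp add: Y_def)
    show "\<gamma> z \<subseteq> verts G" if "z \<in> X0 \<union> Y" for z
      using that sub[of z] subsetD[OF X0(1), of z] by (auto simp: \<gamma>_def Y_def)
    show "\<gamma> z \<inter> \<gamma> z' = {}" if "z \<in> X0 \<union> Y" "z' \<in> X0 \<union> Y" "z \<noteq> z'" for z z'
      using that disj'[of z z'] X0(1) by (auto simp: \<gamma>_def Y_def)
    show "connected_radius_le G r (\<gamma> x)" if "x \<in> X0" for x
      using sub[OF subsetD[OF X0(1) that]] that by (simp add: \<gamma>_def)
    show "connected_radius_le G 0 (\<gamma> y)" if "y \<in> Y" for y using that XY by (auto simp: \<gamma>_def)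
    show "r + 1 + 2 * 0 \<le> 5" using assms(6) by simp
  qed
  obtain D I where I: "D \<subseteq> Y" "I \<subseteq> X0" "B * card D \<le> card I" "card X0 \<le> scat d B * card I"
    "\<forall>y\<in>Y - D. card (?N y \<inter> I) \<le> 1"
    using scatter[OF \<open>bip d X0 Y ?N\<close> assms(3,4)] by blast
  have finI: "finite I" by (rule finite_subset[OF I(2) finite_subset[OF X0(1) assms(5)]])
  show ?thesis
  proof (rule exI[of _ D], intro conjI exI[of _ I] ballI impI)
    show "D \<subseteq> verts G" using I(1) by (auto simp: Y_def)
    show "I \<subseteq> X" "B * card D \<le> card I" using I(2,3) X0(1) by auto
    show "card X \<le> (2 * d + 1) * scat d B * card I"
      using X0(3) mult_le_mono2[OF I(4), of "2 * d + 1"] by (simp only: mult.assoc)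
    show "D \<inter> \<beta> x = {}" if "x \<in> I" for x using that I(1,2) by (auto simp: Y_def)
    show "grow G D (\<beta> x) \<inter> grow G D (\<beta> x') = {}" if x: "x \<in> I" "x' \<in> I" "x \<noteq> x'" for x x'
    proof (rule ccontr)
      assume "\<not> ?thesis"
      then obtain v where v: "v \<in> grow G D (\<beta> x)" "v \<in> grow G D (\<beta> x')" by blast
      have x0: "x \<in> X0" "x' \<in> X0" using x I(2) by auto
      \<comment> \<open>A common vertex \<open>v\<close> of two grown balls lies in no ball of
        \<open>X0\<close>, since those balls are pairwise nonadjacent. It is therefore a vertex of
        \<open>Y - D\<close> that touches two chosen balls.\<close>
      have "z \<in> X0 \<Longrightarrow> v \<in> \<beta> z \<Longrightarrow> z = x'" for z
      proof (rule ccontr)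
        assume z: "z \<in> X0" "v \<in> \<beta> z" "z \<noteq> x'"
        then have "v \<in> nbhd G (\<beta> x')" using v(2) disj'[of z x' v] x0 X0(1) by (auto simp: grow_def)
        then have "adj x' z" using z by (auto simp: nbhd_def adj_def)
        then show False using ind[of x' z] z x0 by simp
      qed
      moreover have "z \<in> X0 \<Longrightarrow> v \<in> \<beta> z \<Longrightarrow> z = x" for z
      proof (rule ccontr)
        assume z: "z \<in> X0" "v \<in> \<beta> z" "z \<noteq> x"
        then have "v \<in> nbhd G (\<beta> x)" using v(1) disj'[of z x v] x0 X0(1) by (auto simp: grow_def)
        then have "adj x z" using z by (auto simp: nbhd_def adj_def)
        then show False using ind[of x z] z x0 by simp
      qed
      ultimately have no: "z \<in> X0 \<Longrightarrow> v \<notin> \<beta> z" for z using x(3) by blast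
      then have v': "v \<in> nbhd G (\<beta> x)" "v \<in> nbhd G (\<beta> x')" "v \<notin> D" using v x0 by (auto simp: grow_def)
      then have "v \<in> Y - D" using no by (auto simp: nbhd_def Y_def)
      moreover have "v \<notin> X0" using no self by blast
      then have "{x, x'} \<subseteq> ?N v \<inter> I" using v' x x0 by (auto simp: nbhd_def \<gamma>_def)
      then have "card {x, x'} \<le> card (?N v \<inter> I)" using finI by (intro card_mono) auto
      ultimately show False using bspec[OF I(5), of v] x(3) by simp
    qed
  qed
qed

text \<open>Two rounds of \<open>scatter_step\<close>. The second round shrinks the set by up to
  \<open>q = (2 * d + 1) * scat d (2 * B)\<close>, so the first one asks for ratio
  \<open>2 * B * q\<close> to keep its deleted set small compared to the final set. The factor 2
  leaves room for the union of both deleted sets.\<close>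

definition scat2 :: "nat \<Rightarrow> nat \<Rightarrow> nat" where
  "scat2 d B = (2 * d + 1) * scat d (2 * B * ((2 * d + 1) * scat d (2 * B))) * ((2 * d + 1) * scat d (2 * B))"

lemma scat_pos: "1 \<le> d \<Longrightarrow> 1 \<le> B \<Longrightarrow> 0 < scat d B"
  by (simp add: scat_def)

lemma scatter_radius_2:
  fixes G :: "'a graph"
  assumes "sparse d G" "finite (verts G)" "1 \<le> d" "1 \<le> B" "X \<subseteq> verts G"
  shows "\<exists>D\<subseteq>verts G. \<exists>X'\<subseteq>X. B * card D \<le> card X' \<and> card X \<le> scat2 d B * card X' \<and>
    (\<forall>x\<in>X'. \<forall>x'\<in>X'. x \<noteq> x' \<longrightarrow> grow G D (grow G D {x}) \<inter> grow G D (grow G D {x'}) = {})"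
proof -
  define q where "q = (2 * d + 1) * scat d (2 * B)"
  have "0 < scat d (2 * B)" using assms(3,4) by (intro scat_pos) auto
  then have q: "0 < q" by (simp add: q_def)
  have B: "1 \<le> 2 * B * q" "1 \<le> 2 * B" using q assms(4) by auto
  have finX: "finite X" using assms(2,5) finite_subset by blast
  have s0: "{x} \<subseteq> verts G \<and> connected_radius_le G 0 {x} \<and> x \<in> {x}" if "x \<in> X" for x
    using that assms(5) by auto
  have disj0: "{x} \<inter> {x'} = {}" if "x \<noteq> x'" for x x' :: 'a using that by simp
  obtain D1 X1 where 1: "D1 \<subseteq> verts G" "X1 \<subseteq> X" "2 * B * q * card D1 \<le> card X1"
      "card X \<le> (2 * d + 1) * scat d (2 * B * q) * card X1"
      "\<forall>x\<in>X1. \<forall>x'\<in>X1. x \<noteq> x' \<longrightarrow> grow G D1 {x} \<inter> grow G D1 {x'} = {}"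
    using scatter_step[OF assms(1,2,3) B(1) finX le0 s0 disj0] by blast
  have finX1: "finite X1" using 1(2) finX finite_subset by blast
  have c1: "connected_radius_le G 1 (grow G D1 {x})" for x
    using connected_radius_le_grow[of G 0 "{x}" D1] by simp
  have sub1: "grow G D1 {x} \<subseteq> verts G \<and> connected_radius_le G 1 (grow G D1 {x}) \<and> x \<in> grow G D1 {x}"
    if "x \<in> X1" for x
    using that 1(2) assms(5) grow_subset_verts[of "{x}" G D1] c1 by (auto simp: grow_def)
  have disj1: "grow G D1 {x} \<inter> grow G D1 {x'} = {}" if "x \<in> X1" "x' \<in> X1" "x \<noteq> x'" for x x'
    using 1(5) that by blast
  obtain D2 X2 where 2: "D2 \<subseteq> verts G" "X2 \<subseteq> X1" "2 * B * card D2 \<le> card X2"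
      "card X1 \<le> (2 * d + 1) * scat d (2 * B) * card X2"
      "\<forall>x\<in>X2. \<forall>x'\<in>X2. x \<noteq> x' \<longrightarrow> grow G D2 (grow G D1 {x}) \<inter> grow G D2 (grow G D1 {x'}) = {}"
    using scatter_step[OF assms(1,2,3) B(2) finX1 one_le_numeral sub1 disj1] by blast
  show ?thesis
  proof (rule exI[of _ "D1 \<union> D2"], intro conjI exI[of _ X2] ballI impI)
    show "D1 \<union> D2 \<subseteq> verts G" "X2 \<subseteq> X" using 1 2 by auto
    have "q * (2 * B * card D1) = 2 * B * q * card D1" by simp
    also have "\<dots> \<le> q * card X2" using le_trans[OF 1(3) 2(4)] unfolding q_def .
    finally have "q * (2 * B * card D1) \<le> q * card X2" .
    then have "2 * B * card D1 \<le> card X2" using q by simp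
    moreover have "B * card (D1 \<union> D2) \<le> B * (card D1 + card D2)" by (intro mult_le_mono2 card_Un_le)
    ultimately show "B * card (D1 \<union> D2) \<le> card X2" using 2(3) unfolding distrib_left by linarith
    have "card X \<le> (2 * d + 1) * scat d (2 * B * q) * (q * card X2)"
      using 1(4) mult_le_mono2[OF 2(4), of "(2 * d + 1) * scat d (2 * B * q)"] unfolding q_def by (meson le_trans)
    then show "card X \<le> scat2 d B * card X2" by (simp add: scat2_def q_def mult.assoc)
    have sub: "grow G (D1 \<union> D2) (grow G (D1 \<union> D2) {x}) \<subseteq> grow G D2 (grow G D1 {x})" for x
      by (intro grow_mono) auto
    show "grow G (D1 \<union> D2) (grow G (D1 \<union> D2) {x}) \<inter> grow G (D1 \<union> D2) (grow G (D1 \<union> D2) {x'}) = {}"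
      if "x \<in> X2" "x' \<in> X2" "x \<noteq> x'" for x x'
    proof -
      have "grow G D2 (grow G D1 {x}) \<inter> grow G D2 (grow G D1 {x'}) = {}" using 2(5) that by blast
      then show ?thesis using sub[of x] sub[of x'] by blast
    qed
  qed
qed

section \<open>Density consequences for the graph itself\<close>

lemma sparse_edges:
  fixes G :: "'a graph"
  assumes "sparse d G" "simple_graph G" "X \<subseteq> verts G"
  shows "card {e\<in>edges G. e \<subseteq> X} \<le> d * card X"
proof (rule sparse_minor[OF assms(1), of _ _ "\<lambda>x. {x}"])
  show "finite X" using assms(2,3) finite_subset unfolding simple_graph_def by blast
  show "e \<subseteq> X \<and> card e = 2" if "e \<in> {e\<in>edges G. e \<subseteq> X}" for e
    using that assms(2) by (auto simp: simple_graph_def)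
qed (use assms(3) in auto)

lemma bip_nbrs:
  fixes G :: "'a graph"
  assumes "sparse d G" "simple_graph G" "X \<subseteq> verts G" "Y \<subseteq> verts G" "X \<inter> Y = {}"
  shows "bip d X Y (\<lambda>y. nbrs G y \<inter> X)"
proof -
  have "bip d X Y (\<lambda>y. {x\<in>X. \<exists>u\<in>{x}. \<exists>v\<in>{y}. {u, v} \<in> edges G})"
  proof (rule bip_branch_sets[OF assms(1), of _ _ "\<lambda>z. {z}" 0 0])
    show "finite X" "finite Y" using assms(2-4) finite_subset unfolding simple_graph_def by blast+
  qed (use assms in auto)
  moreover have "{x\<in>X. \<exists>u\<in>{x}. \<exists>v\<in>{y}. {u, v} \<in> edges G} = nbrs G y \<inter> X" for y
    using assms(3) by (auto simp: nbrs_def)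
  ultimately show ?thesis by simp
qed

lemma nbrs_sym: "u \<in> verts G \<Longrightarrow> v \<in> nbrs G u \<Longrightarrow> u \<in> nbrs G v"
  by (simp add: nbrs_def insert_commute)

lemma nbrs_subset: "nbrs G v \<subseteq> verts G"
  by (auto simp: nbrs_def)

text \<open>\<open>bip_packing\<close> needs two disjoint sides, so \<open>X\<close> is first
  thinned to an independent set \<open>I\<close>. Vertices in \<open>I\<close> then see nothing of
  \<open>I\<close>, and all others form the second side.\<close>

lemma packing:
  fixes G :: "'a graph"
  assumes "sparse d G" "simple_graph G" "X \<subseteq> verts G"
    and "\<And>v. v \<in> verts G \<Longrightarrow> card (nbrs G v \<inter> X) \<le> L"
  shows "\<exists>P\<subseteq>X. card X \<le> (2 * d + 1) * (2 * (L * d * (d + 1) + d) + 1) * card P \<and>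
    (\<forall>v\<in>verts G. card (nbrs G v \<inter> P) \<le> 1)"
proof -
  have fin: "finite (verts G)" "finite X"
    using assms(2,3) finite_subset unfolding simple_graph_def by auto
  have e2: "card e = 2" if "e \<in> edges G" for e using that assms(2) by (auto simp: simple_graph_def)
  have dens: "card {e\<in>edges G. e \<subseteq> X'} \<le> d * card X'" if "X' \<subseteq> X" for X'
    using sparse_edges[OF assms(1,2)] that assms(3) by blast
  obtain I where I: "I \<subseteq> X" "\<forall>e\<in>edges G. \<not> e \<subseteq> I" "card X \<le> (2 * d + 1) * card I"
    using independent_set[OF fin(2) e2 dens] by metis
  have "bip d I (verts G - I) (\<lambda>y. nbrs G y \<inter> I)"
    using I(1) assms(3) by (intro bip_nbrs[OF assms(1,2)]) auto
  moreover have "card (nbrs G v \<inter> I) \<le> L" if "v \<in> verts G - I" for v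
  proof -
    have "card (nbrs G v \<inter> I) \<le> card (nbrs G v \<inter> X)" using I(1) fin by (intro card_mono) auto
    then show ?thesis using assms(4)[of v] that by simp
  qed
  ultimately obtain P where P: "P \<subseteq> I" "card I \<le> (2 * (L * d * (d + 1) + d) + 1) * card P"
      "\<forall>v\<in>verts G - I. card (nbrs G v \<inter> I \<inter> P) \<le> 1"
    using bip_packing[of d I "verts G - I" "\<lambda>y. nbrs G y \<inter> I" L] by blast
  show ?thesis
  proof (intro exI[of _ P] conjI ballI)
    show "P \<subseteq> X" using P(1) I(1) by blast
    show "card X \<le> (2 * d + 1) * (2 * (L * d * (d + 1) + d) + 1) * card P"
      using I(3) mult_le_mono2[OF P(2), of "2 * d + 1"] unfolding mult.assoc by (rule le_trans)
    show "card (nbrs G v \<inter> P) \<le> 1" if v: "v \<in> verts G" for v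
    proof (cases "v \<in> I")
      case True
      have "nbrs G v \<inter> I = {}"
      proof (rule ccontr)
        assume "nbrs G v \<inter> I \<noteq> {}"
        then obtain u where u: "u \<in> I" "{u, v} \<in> edges G" by (auto simp: nbrs_def)
        then have "\<not> {u, v} \<subseteq> I" using I(2) by blast
        then show False using u True by simp
      qed
      then have "nbrs G v \<inter> P = {}" using P(1) by blast
      then show ?thesis by simp
    next
      case False
      have "nbrs G v \<inter> I \<inter> P = nbrs G v \<inter> P" using P(1) by blast
      then show ?thesis using bspec[OF P(3), of v] v False by simp
    qed
  qed
qed

text \<open>The vertices of high degree may lie in \<open>X\<close> themselves, so edges are counted
  in the subgraph induced by the union of both sets. Since \<open>4 * d \<le> L\<close>, the
  contribution of the high-degree set to the density bound is at most half of the left-hand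
  side.\<close>

lemma card_high_degree:
  fixes G :: "'a graph"
  assumes "sparse d G" "simple_graph G" "X \<subseteq> verts G" "4 * d \<le> L"
  shows "L * card {v\<in>verts G. L \<le> card (nbrs G v \<inter> X)} \<le> 4 * d * card X"
proof -
  let ?D = "{v\<in>verts G. L \<le> card (nbrs G v \<inter> X)}"
  let ?F = "{e\<in>edges G. e \<subseteq> X \<union> ?D}"
  have fin: "finite (verts G)" using assms(2) by (simp add: simple_graph_def)
  then have finX: "finite (X \<union> ?D)" using assms(3) finite_subset by auto
  have finF: "finite ?F" by (rule finite_subset[of _ "Pow (X \<union> ?D)"]) (use finX in auto)
  have F: "e \<subseteq> X \<union> ?D \<and> card e = 2" if "e \<in> ?F" for e
    using that assms(2) by (auto simp: simple_graph_def)
  have "L * card ?D \<le> (\<Sum>v\<in>?D. card {e\<in>?F. v \<in> e})"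
  proof -
    have "L \<le> card {e\<in>?F. v \<in> e}" if v: "v \<in> ?D" for v
    proof -
      have "(\<lambda>u. {u, v}) ` (nbrs G v \<inter> X) \<subseteq> {e\<in>?F. v \<in> e}" using v by (auto simp: nbrs_def)
      then have "card ((\<lambda>u. {u, v}) ` (nbrs G v \<inter> X)) \<le> card {e\<in>?F. v \<in> e}"
        by (intro card_mono finite_subset[OF _ finF]) auto
      moreover have "inj_on (\<lambda>u. {u, v}) (nbrs G v \<inter> X)" by (auto simp: inj_on_def doubleton_eq_iff)
      ultimately show ?thesis using v by (simp add: card_image)
    qed
    then show ?thesis using sum_bounded_below[of ?D L "\<lambda>v. card {e\<in>?F. v \<in> e}"] by (simp add: mult.commute)
  qed
  also have "\<dots> \<le> (\<Sum>v\<in>X \<union> ?D. card {e\<in>?F. v \<in> e})" using finX by (intro sum_mono2) auto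
  also have "\<dots> = 2 * card ?F" using handshake[OF finX F] .
  also have "card ?F \<le> d * card (X \<union> ?D)" using assms(3) by (intro sparse_edges[OF assms(1,2)]) auto
  also have "card (X \<union> ?D) \<le> card X + card ?D" by (rule card_Un_le)
  finally have "L * card ?D \<le> 2 * d * card X + 2 * d * card ?D" by (simp add: algebra_simps)
  moreover have "4 * d * card ?D \<le> L * card ?D" using assms(4) by (rule mult_le_mono1)
  ultimately show ?thesis by linarith
qed

section \<open>Exchanging candidates\<close>

text \<open>If no member of a solution lies in the zone of \<open>c\<close>, then adding \<open>c\<close> to it affects only constraints
  that also see \<open>u\<close>, or that are at least as loose as a constraint seeing \<open>u\<close>.  All zones lie in
  the neighbourhood of the small set \<open>A\<close>, so a solution meets only few of the disjoint zones.\<close>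

definition zone :: "'a graph \<Rightarrow> 'a set \<Rightarrow> 'a set \<Rightarrow> 'a \<Rightarrow> 'a set" where
  "zone G K A c = insert c {s \<in> K - A. \<exists>x\<in>nbrs G c - A. s \<in> nbrs G x}"

text \<open>A constraint in \<open>A\<close> sees \<open>c\<close> exactly if it sees
  \<open>u\<close>, so it cannot notice the exchange. A constraint \<open>x\<close> outside
  \<open>A\<close> that sees \<open>c\<close> may also see solution members in \<open>A\<close>,
  which \<open>zone\<close> disregards. The last condition therefore asks for a constraint
  \<open>x'\<close> that sees \<open>u\<close> together with all of these and is at least as
  tight.\<close>

definition exchangeable ::
    "'a graph \<Rightarrow> ('a \<Rightarrow> nat) \<Rightarrow> 'a set \<Rightarrow> 'a set \<Rightarrow> 'a set \<Rightarrow> 'a \<Rightarrow> bool" where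
  "exchangeable G t K A C u \<longleftrightarrow>
     (\<forall>c\<in>C. nbrs G c \<inter> A = nbrs G u \<inter> A) \<and>
     (\<forall>c\<in>C. \<forall>s\<in>zone G K A c. \<exists>y\<in>A. s \<in> nbrs G y) \<and>
     (\<forall>c\<in>C. \<forall>c'\<in>C. c \<noteq> c' \<longrightarrow> zone G K A c \<inter> zone G K A c' = {}) \<and>
     (\<forall>c\<in>C. \<forall>x\<in>nbrs G c - A. \<exists>x'\<in>nbrs G u - A. nbrs G x \<inter> A \<inter> K \<subseteq> nbrs G x' \<and> t x' \<le> t x)"

definition reducible :: "nat \<Rightarrow> nat \<Rightarrow> 'a graph \<Rightarrow> ('a \<Rightarrow> nat) \<Rightarrow> 'a set \<Rightarrow> 'a \<Rightarrow> bool" where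
  "reducible a m G t K u \<longleftrightarrow>
     (\<exists>x\<in>nbrs G u. t x \<le> 1) \<or>
     (\<exists>A C. A \<subseteq> verts G \<and> card A \<le> a \<and> C \<subseteq> K - {u} \<and> card C = m \<and> exchangeable G t K A C u)"

lemma exchange:
  assumes G: "simple_graph G" and t: "\<And>v. v \<in> verts G \<Longrightarrow> t v \<le> p" and K: "K \<subseteq> verts G" and u: "u \<in> K"
    and A: "A \<subseteq> verts G" "card A \<le> a" and C: "C \<subseteq> K - {u}" "card C = m" "a * p < m"
    and ex: "exchangeable G t K A C u"
    and S: "harmless G t S" "S \<subseteq> K" "u \<in> S"
  shows "\<exists>c\<in>C - S. harmless G t (insert c (S - {u}))"
proof -
  have fin: "finite (verts G)" "finite S" "finite A" "finite C"
  proof -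
    show 1: "finite (verts G)" using G by (simp add: simple_graph_def)
    show "finite S" using S(2) K by (intro finite_subset[OF _ 1]) auto
    show "finite A" by (rule finite_subset[OF A(1) 1])
    show "finite C" using C(1) K by (intro finite_subset[OF _ 1]) auto
  qed
  have 1: "\<And>c. c \<in> C \<Longrightarrow> nbrs G c \<inter> A = nbrs G u \<inter> A"
    and 2: "\<And>c s. c \<in> C \<Longrightarrow> s \<in> zone G K A c \<Longrightarrow> \<exists>y\<in>A. s \<in> nbrs G y"
    and 3: "\<And>c c'. c \<in> C \<Longrightarrow> c' \<in> C \<Longrightarrow> c \<noteq> c' \<Longrightarrow> zone G K A c \<inter> zone G K A c' = {}"
    and 4: "\<And>c x. c \<in> C \<Longrightarrow> x \<in> nbrs G c - A \<Longrightarrow>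
        \<exists>x'\<in>nbrs G u - A. nbrs G x \<inter> A \<inter> K \<subseteq> nbrs G x' \<and> t x' \<le> t x"
    using ex unfolding exchangeable_def by blast+
  have Sv: "\<And>v. v \<in> verts G \<Longrightarrow> card (nbrs G v \<inter> S) < t v" and SV: "S \<subseteq> verts G"
    using S(1) by (auto simp: harmless_def)
  have "\<exists>c\<in>C. zone G K A c \<inter> S = {}"
  proof (rule ccontr)
    assume no: "\<not> ?thesis"
    define g where "g c = (SOME s. s \<in> zone G K A c \<inter> S)" for c
    have g: "g c \<in> zone G K A c \<inter> S" if "c \<in> C" for c
    proof -
      have "\<exists>s. s \<in> zone G K A c \<inter> S" using no that by blast
      then show ?thesis unfolding g_def by (rule someI_ex)
    qed
    have "inj_on g C"
    proof (rule inj_onI, rule ccontr)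
      fix c c' assume c: "c \<in> C" "c' \<in> C" "g c = g c'" "c \<noteq> c'"
      show False using g[OF c(1)] g[OF c(2)] 3[OF c(1,2,4)] c(3) by auto
    qed
    then have "m = card (g ` C)" using C(2) by (simp add: card_image)
    also have "\<dots> \<le> card (\<Union>y\<in>A. nbrs G y \<inter> S)"
    proof (rule card_mono)
      show "finite (\<Union>y\<in>A. nbrs G y \<inter> S)" using fin by auto
      show "g ` C \<subseteq> (\<Union>y\<in>A. nbrs G y \<inter> S)" using g 2 by blast
    qed
    also have "\<dots> \<le> (\<Sum>y\<in>A. card (nbrs G y \<inter> S))" using fin by (intro card_UN_le) auto
    also have "\<dots> \<le> (\<Sum>y\<in>A. p)"
    proof (rule sum_mono)
      fix y assume "y \<in> A"
      then show "card (nbrs G y \<inter> S) \<le> p" using Sv[of y] t[of y] A(1) by auto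
    qed
    also have "\<dots> \<le> a * p" using A(2) by simp
    finally show False using C(3) by simp
  qed
  then obtain c where c: "c \<in> C" "zone G K A c \<inter> S = {}" by blast
  have cS: "c \<notin> S" using c(2) by (auto simp: zone_def)
  have cV: "c \<in> verts G" "u \<in> verts G" using c(1) C(1) K u by auto
  have "card (nbrs G v \<inter> insert c (S - {u})) < t v" if v: "v \<in> verts G" for v
  proof -
    let ?S = "insert c (S - {u})"
    have cI: "card (insert u (nbrs G v \<inter> S - {u})) = Suc (card (nbrs G v \<inter> S - {u}))"
      using fin by (intro card_insert_disjoint) auto
    consider "c \<notin> nbrs G v" | "c \<in> nbrs G v" "v \<in> A" | "c \<in> nbrs G v" "v \<notin> A" by blast
    then show ?thesis
    proof cases
      case 1
      then have "card (nbrs G v \<inter> ?S) \<le> card (nbrs G v \<inter> S)" using fin by (intro card_mono) auto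
      then show ?thesis using Sv[OF v] by simp
    next
      case 2
      then have "v \<in> nbrs G u" using nbrs_sym[OF v 2(1)] 1[OF c(1)] by blast
      then have "u \<in> nbrs G v" by (rule nbrs_sym[OF cV(2)])
      then have "insert u (nbrs G v \<inter> S - {u}) \<subseteq> nbrs G v \<inter> S" using S(3) by blast
      then have "card (insert u (nbrs G v \<inter> S - {u})) \<le> card (nbrs G v \<inter> S)"
        using fin by (intro card_mono) auto
      moreover have "nbrs G v \<inter> ?S = insert c (nbrs G v \<inter> S - {u})" using 2 by blast
      then have "card (nbrs G v \<inter> ?S) \<le> Suc (card (nbrs G v \<inter> S - {u}))"
        using fin by (simp add: card_insert_if)
      ultimately show ?thesis using Sv[OF v] cI by linarith
    next
      case 3
      have vc: "v \<in> nbrs G c - A" using nbrs_sym[OF v 3(1)] 3(2) by blast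
      obtain x where x: "x \<in> nbrs G u - A" "nbrs G v \<inter> A \<inter> K \<subseteq> nbrs G x" "t x \<le> t v"
        using 4[OF c(1) vc] by blast
      \<comment> \<open>As the zone of \<open>c\<close> is avoided, \<open>v\<close> sees members of
        \<open>S\<close> only inside \<open>A\<close>. All of them are seen by \<open>x\<close> as
        well, together with \<open>u\<close>, so the place freed by \<open>u\<close> at
        \<open>x\<close> accounts for \<open>c\<close> at \<open>v\<close>.\<close>
      have "nbrs G v \<inter> S \<subseteq> A"
      proof
        fix s assume s: "s \<in> nbrs G v \<inter> S"
        show "s \<in> A"
        proof (rule ccontr)
          assume "s \<notin> A"
          then have "s \<in> zone G K A c" using s vc S(2) unfolding zone_def by blast
          then show False using s c(2) by blast
        qed
      qed
      then have "nbrs G v \<inter> S \<subseteq> nbrs G x" using x(2) S(2) by blast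
      moreover have "u \<in> nbrs G x" using nbrs_sym[OF cV(2), of x] x(1) by blast
      ultimately have "insert u (nbrs G v \<inter> S - {u}) \<subseteq> nbrs G x \<inter> S" using S(3) by blast
      then have "card (insert u (nbrs G v \<inter> S - {u})) \<le> card (nbrs G x \<inter> S)"
        using fin by (intro card_mono) auto
      moreover have "nbrs G v \<inter> ?S \<subseteq> insert c (nbrs G v \<inter> S - {u})" by blast
      then have "card (nbrs G v \<inter> ?S) \<le> Suc (card (nbrs G v \<inter> S - {u}))"
        using fin card_mono[of "insert c (nbrs G v \<inter> S - {u})" "nbrs G v \<inter> ?S"]
        by (simp add: card_insert_if split: if_splits)
      moreover have "card (nbrs G x \<inter> S) < t x" using x(1) nbrs_subset[of G u] Sv[of x] by blast
      ultimately show ?thesis using x(3) cI by linarith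
    qed
  qed
  then have "harmless G t (insert c (S - {u}))" using SV cV(1) by (auto simp: harmless_def)
  then show ?thesis using c(1) cS by blast
qed

lemma reducible_sound:
  assumes G: "simple_graph G" and t: "\<And>v. v \<in> verts G \<Longrightarrow> t v \<le> p" and K: "K \<subseteq> verts G" and u: "u \<in> K"
    and red: "reducible a m G t K u" "a * p < m"
  shows "annotated_bhs_yes G t k (K - {u}) \<longleftrightarrow> annotated_bhs_yes G t k K"
proof
  assume "annotated_bhs_yes G t k K"
  then obtain S where S: "harmless G t S" "S \<subseteq> K" "k \<le> card S" unfolding annotated_bhs_yes_def by blast
  have fin: "finite S" using G S(2) K by (auto simp: simple_graph_def intro: finite_subset)
  show "annotated_bhs_yes G t k (K - {u})"
  proof (cases "u \<in> S")
    case False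
    then show ?thesis using S unfolding annotated_bhs_yes_def by blast
  next
    case True
    have "\<not> (\<exists>x\<in>nbrs G u. t x \<le> 1)"
    proof
      assume "\<exists>x\<in>nbrs G u. t x \<le> 1"
      then obtain x where x: "x \<in> nbrs G u" "t x \<le> 1" by blast
      then have "card (nbrs G x \<inter> S) < 1" using S(1) nbrs_subset[of G u] unfolding harmless_def by fastforce
      moreover have "u \<in> nbrs G x" using x(1) u K by (auto intro: nbrs_sym)
      ultimately show False using True fin by auto
    qed
    then obtain A C where A: "A \<subseteq> verts G" "card A \<le> a" and C: "C \<subseteq> K - {u}" "card C = m"
      and ex: "exchangeable G t K A C u" using red(1) unfolding reducible_def by blast
    obtain c where c: "c \<in> C" "c \<notin> S" "harmless G t (insert c (S - {u}))"
      using exchange[OF G t K u A C red(2) ex S(1,2) True] by blast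
    have "card (insert c (S - {u})) = card S" using c(2) True fin card_Suc_Diff1 by fastforce
    moreover have "insert c (S - {u}) \<subseteq> K - {u}" using c(1) C(1) S(2) by blast
    ultimately show ?thesis using c(3) S(3) unfolding annotated_bhs_yes_def by metis
  qed
next
  assume "annotated_bhs_yes G t k (K - {u})"
  then show "annotated_bhs_yes G t k K" unfolding annotated_bhs_yes_def by blast
qed

text \<open>The required ratio of scattered candidates to \<open>R\<close>. The product bounds types
  over \<open>R\<close> times class size: \<open>4 * d * p + 1\<close> partners, the ways to look at
  a fixed \<open>A\<close>, and \<open>d + 4 ^ d\<close> possible sets \<open>A\<close> per vertex
  of \<open>R\<close>. The factor 12 is 2 for candidates that see too much of \<open>R\<close>,
  times 6 from \<open>B * card R \<le> 3 * card X \<le> 6 * card I\<close>. The summand 6 yields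
  \<open>card R \<le> card I\<close> and makes the final inequality strict.\<close>

definition density :: "nat \<Rightarrow> nat \<Rightarrow> nat" where
  "density d p = 12 * (4 * d * p + 1) * (2 ^ (4 * d) * (p + 2) ^ (2 ^ (4 * d))) * (d + 4 ^ d) + 6"

text \<open>\<open>Q\<close> is the loss of scattering at radius 2. The degree threshold
  \<open>L\<close> is chosen so that the vertices of degree at least \<open>L\<close> into
  \<open>K\<close> number at most \<open>card X / B\<close>, where \<open>X\<close> is the scattered
  set. The middle factor is the loss of \<open>packing\<close> at degree \<open>L\<close>; with it
  and \<open>B\<close>, the candidates without a neighbour of high degree also number at most
  \<open>card X / B\<close>.\<close>

definition kernel_bound :: "nat \<Rightarrow> nat \<Rightarrow> nat" where
  "kernel_bound d p = (let B = density d p; Q = scat2 d B; L = 4 * d * Q * B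
     in Q * ((2 * d + 1) * (2 * (L * d * (d + 1) + d) + 1)) * B)"

lemma card_le_fibres:
  assumes "finite I" "\<And>y. y \<in> f ` I \<Longrightarrow> card {x\<in>I. f x = y} \<le> m"
  shows "card I \<le> m * card (f ` I)"
proof -
  have "card I = card (\<Union>y\<in>f ` I. {x\<in>I. f x = y})" by (rule arg_cong[of _ _ card]) auto
  also have "\<dots> \<le> (\<Sum>y\<in>f ` I. card {x\<in>I. f x = y})" using assms(1) by (intro card_UN_le) auto
  also have "\<dots> \<le> (\<Sum>y\<in>f ` I. m)" using assms(2) by (intro sum_mono)
  finally show ?thesis by (simp add: mult.commute)
qed

text \<open>Candidates with equal signatures satisfy the last condition of \<open>exchangeable\<close>; the value
  \<open>Suc p\<close> stands for the absence of a constraint.\<close>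

definition signature :: "'a graph \<Rightarrow> ('a \<Rightarrow> nat) \<Rightarrow> nat \<Rightarrow> 'a set \<Rightarrow> 'a set \<Rightarrow> 'a \<Rightarrow> 'a set \<Rightarrow> nat" where
  "signature G t p K A u =
     restrict (\<lambda>B. Min (insert (Suc p) (t ` {x \<in> nbrs G u - A. nbrs G x \<inter> A \<inter> K = B}))) (Pow A)"

lemma signature_in:
  assumes "finite (verts G)"
  shows "signature G t p K A u \<in> Pow A \<rightarrow>\<^sub>E {0..Suc p}"
proof -
  have "finite (nbrs G u)" using assms nbrs_subset finite_subset by metis
  then show ?thesis unfolding signature_def by auto
qed

lemma signature_eqD:
  assumes "finite (verts G)" "signature G t p K A c = signature G t p K A u"
    and "x \<in> nbrs G c - A" "t x \<le> p"
  shows "\<exists>x'\<in>nbrs G u - A. nbrs G x \<inter> A \<inter> K = nbrs G x' \<inter> A \<inter> K \<and> t x' \<le> t x"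
proof -
  have fin: "finite (nbrs G v)" for v using assms(1) nbrs_subset finite_subset by metis
  let ?B = "nbrs G x \<inter> A \<inter> K"
  let ?M = "\<lambda>u. insert (Suc p) (t ` {x \<in> nbrs G u - A. nbrs G x \<inter> A \<inter> K = ?B})"
  have "?B \<in> Pow A" by blast
  then have eq: "Min (?M c) = Min (?M u)"
    using fun_cong[OF assms(2), of ?B] by (simp add: signature_def)
  have finM: "finite (?M v)" for v using fin by simp
  have "Min (?M c) \<le> t x" using assms(3) finM by (intro Min_le) auto
  then have le: "Min (?M u) \<le> t x" using eq by simp
  have "Min (?M u) \<in> ?M u" using finM by (intro Min_in) auto
  then have "Min (?M u) \<in> t ` {x \<in> nbrs G u - A. nbrs G x \<inter> A \<inter> K = ?B}" using le assms(4) by auto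
  then obtain x' where "x' \<in> nbrs G u - A" "nbrs G x' \<inter> A \<inter> K = ?B" "t x' = Min (?M u)" by auto
  then show ?thesis using le by (intro bexI[of _ x']) simp_all
qed

text \<open>Contracting the balls around \<open>I\<close> gives a sparse bipartite graph between
  \<open>R\<close> and \<open>I\<close>, in which \<open>P u\<close> is the neighbourhood of
  \<open>u\<close>. Most \<open>P u\<close> are small and few different ones occur, so more than
  \<open>m\<close> members of \<open>I\<close> share \<open>P u\<close> and look alike from it; then
  \<open>A = P u\<close> works. Zones stay inside the disjoint balls, and by \<open>hit\<close> each
  zone member has a neighbour in \<open>R\<close>, which then belongs to \<open>P u\<close>.\<close>

lemma exchangeable_exists:
  fixes G :: "'a graph"
  assumes sp: "sparse d G" and G: "simple_graph G" and d: "1 \<le> d"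
    and t: "\<And>v. v \<in> verts G \<Longrightarrow> t v \<le> p" and K: "K \<subseteq> verts G" and R: "R \<subseteq> verts G"
    and I: "I \<subseteq> K - R" "card R \<le> card I"
    and disj: "\<And>x x'. x \<in> I \<Longrightarrow> x' \<in> I \<Longrightarrow> x \<noteq> x' \<Longrightarrow> grow G R (grow G R {x}) \<inter> grow G R (grow G R {x'}) = {}"
    and hit: "\<And>s. s \<in> K - R \<Longrightarrow> nbrs G s \<inter> R \<noteq> {}"
    and large: "2 * m * (2 ^ (4 * d) * (p + 2) ^ (2 ^ (4 * d))) * (d + 4 ^ d) * card R < card I"
  shows "\<exists>u\<in>I. \<exists>A C. A \<subseteq> verts G \<and> card A \<le> 4 * d \<and> C \<subseteq> K - {u} \<and> card C = m \<and> exchangeable G t K A C u"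
proof -
  have finV: "finite (verts G)" using G by (simp add: simple_graph_def)
  have finR: "finite R" by (rule finite_subset[OF R finV])
  have finI: "finite I" using I K by (intro finite_subset[OF _ finV]) auto
  define ball where "ball u = grow G R (grow G R {u})" for u
  define P where "P u = {r\<in>R. \<exists>v\<in>ball u. {r, v} \<in> edges G}" for u
  have PR: "P u \<subseteq> R" for u by (auto simp: P_def)
  have finP: "finite (P u)" for u by (rule finite_subset[OF PR finR])
  have ballV: "ball u \<subseteq> verts G" if "u \<in> I" for u
    using that I K unfolding ball_def by (intro grow_subset_verts) auto
  have ballR: "ball u \<inter> R = {}" if "u \<in> I" for u
    using that I unfolding ball_def grow_def by auto
  have ballD: "x = x'" if "x \<in> I" "x' \<in> I" "v \<in> ball x" "v \<in> ball x'" for x x' v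
    using disj[of x x'] that unfolding ball_def by blast
  have c2: "connected_radius_le G 2 (ball u)" for u
    using connected_radius_le_grow[OF connected_radius_le_grow[of G 0 "{u}" R], of R]
    by (simp add: ball_def numeral_2_eq_2)
  define \<beta> where "\<beta> z = (if z \<in> R then {z} else ball z)" for z
  have RI: "R \<inter> I = {}" using I by blast
  have bip: "bip d R I P"
  proof -
    have "bip d R I (\<lambda>y. {x\<in>R. \<exists>u\<in>\<beta> x. \<exists>v\<in>\<beta> y. {u, v} \<in> edges G})"
    proof (rule bip_branch_sets[OF sp finR finI RI, of \<beta> 0 2])
      show "\<beta> z \<subseteq> verts G" if "z \<in> R \<union> I" for z using that R ballV[of z] by (auto simp: \<beta>_def)
      show "\<beta> z \<inter> \<beta> z' = {}" if "z \<in> R \<union> I" "z' \<in> R \<union> I" "z \<noteq> z'" for z z'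
        using that ballR[of z] ballR[of z'] ballD[of z z'] by (auto simp: \<beta>_def)
      show "connected_radius_le G 0 (\<beta> x)" if "x \<in> R" for x using that by (simp add: \<beta>_def)
      show "connected_radius_le G 2 (\<beta> y)" if "y \<in> I" for y using that RI c2[of y] by (auto simp: \<beta>_def)
    qed simp
    moreover have "{x\<in>R. \<exists>u\<in>\<beta> x. \<exists>v\<in>\<beta> y. {u, v} \<in> edges G} = P y" if "y \<in> I" for y
      using that RI by (auto simp: \<beta>_def P_def)
    ultimately show ?thesis by (rule bip_cong)
  qed
  define J where "J = {u\<in>I. card (P u) \<le> 4 * d}"
  have J: "J \<subseteq> I" "finite J" using finI by (auto simp: J_def)
  \<comment> \<open>Averaging: the sizes of the sets \<open>P u\<close> sum to at most
    \<open>d * (card R + card I) \<le> 2 * d * card I\<close>, so at most half of them exceed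
    \<open>4 * d\<close>.\<close>
  have "card I \<le> 2 * card J"
  proof -
    have "(4 * d + 1) * card (I - J) \<le> (\<Sum>u\<in>I - J. card (P u))"
      using sum_bounded_below[of "I - J" "4 * d + 1" "\<lambda>u. card (P u)"] by (force simp: J_def mult.commute)
    also have "\<dots> \<le> (\<Sum>u\<in>I. card (P u))" using finI by (intro sum_mono2) auto
    also have "\<dots> = (\<Sum>u\<in>I. card (P u \<inter> R))" using PR by (simp add: Int_absorb2)
    also have "\<dots> \<le> d * (card R + card I)" by (intro bipD(4)[OF bip]) auto
    also have "\<dots> \<le> d * (2 * card I)" using I(2) by (intro mult_le_mono2) linarith
    also have "\<dots> = 2 * d * card I" by simp
    finally have "(4 * d + 1) * card (I - J) \<le> 2 * d * card I" .
    moreover have "2 * d * (2 * card (I - J)) \<le> (4 * d + 1) * card (I - J)" by (simp add: distrib_right)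
    ultimately have "2 * d * (2 * card (I - J)) \<le> 2 * d * card I" by (rule le_trans[rotated])
    then have "2 * card (I - J) \<le> card I" using d by simp
    moreover have "card (I - J) = card I - card J" using J by (intro card_Diff_subset) auto
    ultimately show ?thesis by linarith
  qed
  define T where "T = 2 ^ (4 * d) * (p + 2) ^ (2 ^ (4 * d))"
  \<comment> \<open>The type of \<open>u\<close>. The set \<open>P u\<close> is part of it, so that
    one set \<open>A\<close> serves all candidates of the same type.\<close>
  define \<kappa> where "\<kappa> u = (P u, nbrs G u \<inter> P u, signature G t p K (P u) u)" for u
  have card\<kappa>: "card (\<kappa> ` J) \<le> T * ((d + 4 ^ d) * card R)"
  proof -
    define Z where "Z A = Pow A \<times> (Pow A \<rightarrow>\<^sub>E {0..Suc p})" for A :: "'a set"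
    have Z: "finite (Z A) \<and> card (Z A) \<le> T" if A: "A \<in> P ` J" for A
    proof -
      have fA: "finite A" "card A \<le> 4 * d" using A finP by (auto simp: J_def)
      then have "card (Z A) = 2 ^ card A * (p + 2) ^ (2 ^ card A)"
        by (simp add: Z_def card_cartesian_product card_Pow card_PiE)
      also have "\<dots> \<le> T" unfolding T_def using fA(2) by (intro mult_le_mono power_increasing) auto
      finally show ?thesis using fA by (auto simp: Z_def intro: finite_PiE)
    qed
    have "\<kappa> ` J \<subseteq> Sigma (P ` J) Z" using signature_in[OF finV] by (auto simp: \<kappa>_def Z_def)
    moreover have "finite (Sigma (P ` J) Z)" using J(2) Z by auto
    ultimately have "card (\<kappa> ` J) \<le> card (Sigma (P ` J) Z)" by (intro card_mono)
    also have "\<dots> = (\<Sum>A\<in>P ` J. card (Z A))" using J(2) Z by (intro card_SigmaI) auto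
    also have "\<dots> \<le> (\<Sum>A\<in>P ` J. T)" using Z by (intro sum_mono) auto
    also have "\<dots> = T * card (P ` J)" by simp
    also have "card (P ` J) \<le> card {P y |y. y \<in> I \<and> P y \<noteq> {}}"
    proof (rule card_mono)
      show "finite {P y |y. y \<in> I \<and> P y \<noteq> {}}" using finI by simp
      show "P ` J \<subseteq> {P y |y. y \<in> I \<and> P y \<noteq> {}}"
      proof
        fix A assume "A \<in> P ` J"
        then obtain u where u: "u \<in> J" "A = P u" by blast
        then have "u \<in> K - R" using J(1) I(1) by blast
        then obtain r where "r \<in> nbrs G u" "r \<in> R" using hit by blast
        then have "r \<in> P u" by (auto simp: P_def ball_def grow_def nbrs_def)
        then show "A \<in> {P y |y. y \<in> I \<and> P y \<noteq> {}}" using u J(1) by blast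
      qed
    qed
    also have "\<dots> \<le> (d + 4 ^ d) * card R" by (rule bip_neighbourhoods[OF bip])
    finally show ?thesis by simp
  qed
  have "\<exists>y\<in>\<kappa> ` J. m < card {x\<in>J. \<kappa> x = y}"
  proof (rule ccontr)
    assume "\<not> ?thesis"
    then have "card J \<le> m * card (\<kappa> ` J)" using J(2) by (intro card_le_fibres) auto
    also have "\<dots> \<le> m * (T * ((d + 4 ^ d) * card R))" by (intro mult_le_mono2 card\<kappa>)
    finally have "card I \<le> 2 * m * T * (d + 4 ^ d) * card R"
      using \<open>card I \<le> 2 * card J\<close> by (simp add: mult.assoc)
    then show False using large unfolding T_def by simp
  qed
  then obtain u where u: "u \<in> J" "m < card {x\<in>J. \<kappa> x = \<kappa> u}" by auto
  have "card ({x\<in>J. \<kappa> x = \<kappa> u} - {u}) \<ge> m" using u J(2) by simp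
  then obtain C where C: "C \<subseteq> {x\<in>J. \<kappa> x = \<kappa> u} - {u}" "card C = m"
    by (rule obtain_subset_with_card_n)
  have CI: "c \<in> I" and Pc: "P c = P u" and Nc: "nbrs G c \<inter> P u = nbrs G u \<inter> P u"
    and sc: "signature G t p K (P u) c = signature G t p K (P u) u" if "c \<in> C" for c
    using that C(1) J(1) by (auto simp: \<kappa>_def)
  have out: "x \<notin> R \<and> x \<in> grow G R {c}" if "c \<in> C" "x \<in> nbrs G c - P u" for c x
  proof -
    have "x \<in> R \<Longrightarrow> x \<in> P c" using that by (auto simp: P_def ball_def grow_def nbrs_def)
    then have "x \<notin> R" using that Pc by auto
    then show ?thesis using that by (auto simp: grow_def nbhd_def nbrs_def insert_commute)
  qed
  \<comment> \<open>A neighbour \<open>x\<close> of \<open>c\<close> that lies in \<open>R\<close>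
    would be in \<open>P c = P u\<close>, hence a neighbour outside \<open>P u\<close> avoids
    \<open>R\<close>. The same holds for the next vertex \<open>s\<close> on the path, so the path
    stays within the ball of \<open>c\<close>.\<close>
  have zone_ball: "s \<in> ball c \<and> s \<in> K - R" if c: "c \<in> C" and s: "s \<in> zone G K (P u) c" for c s
  proof (cases "s = c")
    case True
    then show ?thesis using CI[OF c] I by (auto simp: ball_def grow_def)
  next
    case False
    then obtain x where x: "s \<in> K - P u" "x \<in> nbrs G c - P u" "s \<in> nbrs G x"
      using s by (auto simp: zone_def)
    note o = out[OF c x(2)]
    have "s \<notin> R"
    proof
      assume "s \<in> R"
      moreover have "x \<in> ball c" using o unfolding ball_def grow_def[of G R "grow G R {c}"] by blast
      ultimately have "s \<in> P c" using x(3) by (auto simp: P_def nbrs_def)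
      then show False using x(1) Pc[OF c] by simp
    qed
    moreover have "s \<in> nbhd G (grow G R {c})" using o x(3) by (auto simp: nbhd_def nbrs_def insert_commute)
    ultimately show ?thesis using x(1) unfolding ball_def grow_def[of G R "grow G R {c}"] by blast
  qed
  have "exchangeable G t K (P u) C u"
    unfolding exchangeable_def
  proof (intro conjI ballI impI)
    show "nbrs G c \<inter> P u = nbrs G u \<inter> P u" if "c \<in> C" for c using Nc[OF that] .
    show "\<exists>y\<in>P u. s \<in> nbrs G y" if "c \<in> C" "s \<in> zone G K (P u) c" for c s
    proof -
      note z = zone_ball[OF that]
      then obtain r where r: "r \<in> nbrs G s" "r \<in> R" using hit by blast
      then have "r \<in> P c" using z by (auto simp: P_def nbrs_def)
      moreover have "s \<in> nbrs G r" using r z K by (auto intro: nbrs_sym)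
      ultimately show ?thesis using Pc[OF that(1)] by blast
    qed
    show "zone G K (P u) c \<inter> zone G K (P u) c' = {}" if "c \<in> C" "c' \<in> C" "c \<noteq> c'" for c c'
      using zone_ball that ballD[OF CI CI, of c c'] by blast
    show "\<exists>x'\<in>nbrs G u - P u. nbrs G x \<inter> P u \<inter> K \<subseteq> nbrs G x' \<and> t x' \<le> t x"
      if c: "c \<in> C" and x: "x \<in> nbrs G c - P u" for c x
    proof -
      have "t x \<le> p" using t[of x] x nbrs_subset[of G c] by blast
      then obtain x' where "x' \<in> nbrs G u - P u" "nbrs G x \<inter> P u \<inter> K = nbrs G x' \<inter> P u \<inter> K" "t x' \<le> t x"
        using signature_eqD[OF finV sc[OF c] x] by blast
      then show ?thesis by blast
    qed
  qed
  moreover have "P u \<subseteq> verts G" "card (P u) \<le> 4 * d" "u \<in> I" using PR R u(1) J by (auto simp: J_def)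
  moreover have "C \<subseteq> K - {u}" using C(1) J(1) I(1) by blast
  ultimately show ?thesis using C(2) by blast
qed

lemma irreducible_small:
  fixes G :: "'a graph"
  assumes sp: "sparse d G" and G: "simple_graph G" and d: "1 \<le> d"
    and t: "\<And>v. v \<in> verts G \<Longrightarrow> t v \<in> {1..p}" and K: "K \<subseteq> verts G"
    and irr: "\<And>u. u \<in> K \<Longrightarrow> \<not> reducible (4 * d) (4 * d * p + 1) G t K u"
  shows "card K \<le> kernel_bound d p * k \<or> annotated_bhs_yes G t k K"
proof (rule ccontr)
  assume neg: "\<not> ?thesis"
  define B where "B = density d p"
  define Q where "Q = scat2 d B"
  define L where "L = 4 * d * Q * B"
  define Q0 where "Q0 = (2 * d + 1) * (2 * (L * d * (d + 1) + d) + 1)"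
  have kb: "kernel_bound d p = Q * Q0 * B" by (simp add: kernel_bound_def Let_def B_def Q_def L_def Q0_def)
  have finV: "finite (verts G)" using G by (simp add: simple_graph_def)
  have finK: "finite K" by (rule finite_subset[OF K finV])
  have B6: "6 \<le> B" by (simp add: B_def density_def)
  then have B1: "1 \<le> B" by simp
  have Qpos: "0 < Q"
  proof -
    have 1: "0 < scat d (2 * B)" using d B1 by (intro scat_pos) auto
    then have "1 \<le> 2 * B * ((2 * d + 1) * scat d (2 * B))" using B1 by simp
    then have "0 < scat d (2 * B * ((2 * d + 1) * scat d (2 * B)))" using d by (rule scat_pos[rotated])
    then show ?thesis using 1 by (simp add: Q_def scat2_def)
  qed
  have L4: "4 * d \<le> L" using Qpos B1 by (simp add: L_def)
  obtain D X where D: "D \<subseteq> verts G" and X: "X \<subseteq> K" "B * card D \<le> card X" "card K \<le> Q * card X"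
    and disj: "\<forall>x\<in>X. \<forall>x'\<in>X. x \<noteq> x' \<longrightarrow> grow G D (grow G D {x}) \<inter> grow G D (grow G D {x'}) = {}"
    using scatter_radius_2[OF sp finV d B1 K] unfolding Q_def by blast
  define H where "H = {v\<in>verts G. L \<le> card (nbrs G v \<inter> K)}"
  have cH: "B * card H \<le> card X"
  proof -
    have "L * card H \<le> 4 * d * card K" unfolding H_def by (rule card_high_degree[OF sp G K L4])
    also have "\<dots> \<le> 4 * d * (Q * card X)" by (intro mult_le_mono2 X(3))
    finally have "4 * d * Q * (B * card H) \<le> 4 * d * Q * card X" by (simp add: L_def mult_ac)
    then show ?thesis using d Qpos by simp
  qed
  define K0 where "K0 = {s\<in>K. nbrs G s \<inter> H = {}}"
  have K0: "K0 \<subseteq> K" by (auto simp: K0_def)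
  have cK0: "B * card K0 \<le> card X"
  proof -
    have "card (nbrs G v \<inter> K0) \<le> L" if v: "v \<in> verts G" for v
    proof (cases "v \<in> H")
      case True
      have "nbrs G v \<inter> K0 = {}"
      proof (rule ccontr)
        assume "nbrs G v \<inter> K0 \<noteq> {}"
        then obtain s where s: "s \<in> nbrs G v" "s \<in> K0" by blast
        then have "v \<in> nbrs G s \<inter> H" using nbrs_sym[OF v s(1)] True by blast
        then show False using s(2) by (auto simp: K0_def)
      qed
      then show ?thesis by simp
    next
      case False
      have "card (nbrs G v \<inter> K0) \<le> card (nbrs G v \<inter> K)" using K0 finK by (intro card_mono) auto
      then show ?thesis using False v by (simp add: H_def)
    qed
    then obtain P where P: "P \<subseteq> K0" "card K0 \<le> Q0 * card P" "\<forall>v\<in>verts G. card (nbrs G v \<inter> P) \<le> 1"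
      using packing[OF sp G, of K0 L] K0 K unfolding Q0_def by blast
    \<comment> \<open>Every vertex sees at most one member of \<open>P\<close>. Since no candidate
      is reducible, a vertex that sees a candidate has threshold at least 2.\<close>
    have "harmless G t P" unfolding harmless_def
    proof (intro conjI ballI)
      show "P \<subseteq> verts G" using P(1) K0 K by blast
      fix v assume v: "v \<in> verts G"
      show "card (nbrs G v \<inter> P) < t v"
      proof (cases "nbrs G v \<inter> P = {}")
        case True
        then show ?thesis using t[OF v] by simp
      next
        case False
        then obtain s where s: "s \<in> nbrs G v" "s \<in> K" using P(1) K0 by blast
        have "v \<in> nbrs G s" by (rule nbrs_sym[OF v s(1)])
        then have "\<not> t v \<le> 1" using irr[OF s(2)] by (auto simp: reducible_def)
        then show ?thesis using bspec[OF P(3) v] by simp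
      qed
    qed
    moreover have "P \<subseteq> K" using P(1) K0 by (rule subset_trans)
    ultimately have "card P \<le> k" using neg unfolding annotated_bhs_yes_def by (meson nat_le_linear)
    then have "Q0 * card P \<le> Q0 * k" by (rule mult_le_mono2)
    then have "card K0 \<le> Q0 * k" using P(2) by (rule le_trans[rotated])
    then have "Q * (B * card K0) \<le> Q * B * (Q0 * k)" by simp
    also have "\<dots> \<le> card K" using neg unfolding kb by (simp add: mult_ac)
    also note X(3)
    finally show ?thesis using Qpos by simp
  qed
  define R where "R = D \<union> H \<union> K0"
  have R: "R \<subseteq> verts G" using D K0 K by (auto simp: R_def H_def)
  have cR: "B * card R \<le> 3 * card X"
  proof -
    have "card R \<le> card D + card H + card K0"
      unfolding R_def using card_Un_le[of "D \<union> H" K0] card_Un_le[of D H] by linarith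
    then have "B * card R \<le> B * (card D + card H + card K0)" by (rule mult_le_mono2)
    then show ?thesis using X(2) cH cK0 unfolding distrib_left by linarith
  qed
  define I where "I = X - R"
  have finR: "finite R" by (rule finite_subset[OF R finV])
  have cI: "card X \<le> card I + card R" unfolding I_def using diff_card_le_card_Diff[OF finR, of X] by linarith
  moreover have "6 * card R \<le> B * card R" using B6 by (rule mult_le_mono1)
  ultimately have RI: "card R \<le> card I" "card X \<le> 2 * card I" using cR by linarith+
  have "0 < card K" using neg by (cases "card K = 0") auto
  then have "0 < card X" using X(3) by (cases "card X = 0") auto
  then have "I \<noteq> {}" using RI(2) by (cases "I = {}") auto
  have hit: "nbrs G s \<inter> R \<noteq> {}" if "s \<in> K - R" for s using that by (auto simp: R_def K0_def)
  have IK: "I \<subseteq> K - R" using X(1) by (auto simp: I_def)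
  \<comment> \<open>Any member of \<open>I\<close> has a neighbour in \<open>R\<close>; positivity
    of \<open>card R\<close> then makes the following bound strict.\<close>
  then have "R \<noteq> {}" using hit \<open>I \<noteq> {}\<close> by blast
  then have "0 < card R" using finR by (simp add: card_gt_0_iff)
  have "6 * (2 * (4 * d * p + 1) * (2 ^ (4 * d) * (p + 2) ^ (2 ^ (4 * d))) * (d + 4 ^ d) * card R) < B * card R"
  proof -
    define c W E where "c = 4 * d * p + 1" and "W = (2::nat) ^ (4 * d) * (p + 2) ^ (2 ^ (4 * d))" and "E = d + 4 ^ d"
    have "B = 12 * c * W * E + 6" by (simp only: B_def density_def c_def W_def E_def)
    then have "6 * (2 * c * W * E * card R) < B * card R" using \<open>0 < card R\<close> by simp
    then show ?thesis by (simp only: c_def W_def E_def)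
  qed
  also have "\<dots> \<le> 6 * card I" using cR RI(2) by linarith
  finally have large: "2 * (4 * d * p + 1) * (2 ^ (4 * d) * (p + 2) ^ (2 ^ (4 * d))) * (d + 4 ^ d) * card R < card I"
    by (rule mult_less_cancel1[THEN iffD1, THEN conjunct2])
  have disjR: "grow G R (grow G R {x}) \<inter> grow G R (grow G R {x'}) = {}" if "x \<in> I" "x' \<in> I" "x \<noteq> x'" for x x'
  proof -
    have "grow G R (grow G R {y}) \<subseteq> grow G D (grow G D {y})" for y
      by (intro grow_mono) (auto simp: R_def)
    moreover have "grow G D (grow G D {x}) \<inter> grow G D (grow G D {x'}) = {}"
      using disj that by (simp add: I_def)
    ultimately show ?thesis by blast
  qed
  have tp: "t v \<le> p" if "v \<in> verts G" for v using t[OF that] by simp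
  have "\<exists>u\<in>I. \<exists>A C. A \<subseteq> verts G \<and> card A \<le> 4 * d \<and> C \<subseteq> K - {u} \<and>
      card C = 4 * d * p + 1 \<and> exchangeable G t K A C u"
    by (rule exchangeable_exists[OF sp G d]) (fact tp K R IK RI(1) disjR hit large)+
  then obtain u A C where u: "u \<in> I" "A \<subseteq> verts G" "card A \<le> 4 * d" "C \<subseteq> K - {u}"
      "card C = 4 * d * p + 1" "exchangeable G t K A C u"
    by blast
  then have "reducible (4 * d) (4 * d * p + 1) G t K u" unfolding reducible_def by blast
  then show False using irr[of u] u(1) IK by blast
qed

section \<open>Transfer along embeddings and the kernel\<close>

lemma arcs_within_relpow_image:
  assumes "\<And>u v. u \<in> B \<Longrightarrow> v \<in> B \<Longrightarrow> {u, v} \<in> edges G \<Longrightarrow> {f u, f v} \<in> edges G'"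
  shows "(c, v) \<in> arcs_within G B ^^ l \<Longrightarrow> (f c, f v) \<in> arcs_within G' (f ` B) ^^ l"
proof (induction l arbitrary: v)
  case (Suc l)
  then obtain w where w: "(c, w) \<in> arcs_within G B ^^ l" "(w, v) \<in> arcs_within G B" by auto
  then have "(f w, f v) \<in> arcs_within G' (f ` B)" using assms by (auto simp: arcs_within_def)
  then show ?case using Suc.IH[OF w(1)] by (rule relpow_Suc_I[rotated])
qed simp

lemma connected_radius_le_image:
  assumes "connected_radius_le G r B"
    and "\<And>u v. u \<in> B \<Longrightarrow> v \<in> B \<Longrightarrow> {u, v} \<in> edges G \<Longrightarrow> {f u, f v} \<in> edges G'"
  shows "connected_radius_le G' r (f ` B)"
proof -
  obtain c where c: "c \<in> B" "\<And>v. v \<in> B \<Longrightarrow> \<exists>l\<le>r. (c, v) \<in> arcs_within G B ^^ l"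
    using assms(1) unfolding connected_radius_le_def by blast
  have "\<exists>l\<le>r. (f c, f v) \<in> arcs_within G' (f ` B) ^^ l" if v: "v \<in> B" for v
  proof -
    obtain l where l: "l \<le> r" "(c, v) \<in> arcs_within G B ^^ l" using c(2)[OF v] by blast
    have "(f c, f v) \<in> arcs_within G' (f ` B) ^^ l"
      by (rule arcs_within_relpow_image[OF _ l(2)]) (fact assms(2))
    then show ?thesis using l(1) by blast
  qed
  then show ?thesis using c(1) unfolding connected_radius_le_def by blast
qed

lemma connected_radius_le_nonempty: "connected_radius_le G r B \<Longrightarrow> B \<noteq> {}"
  by (auto simp: connected_radius_le_def)

text \<open>The representatives \<open>g h\<close> embed the vertices of the minor into
  \<open>G\<close>. They bound their number and allow them to be renamed into another vertex
  type.\<close>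

lemma shallow_minorE:
  assumes "shallow_minor r H G"
  obtains \<phi> g where "simple_graph H"
    "\<And>h. h \<in> verts H \<Longrightarrow> \<phi> h \<subseteq> verts G \<and> connected_radius_le G r (\<phi> h) \<and> g h \<in> \<phi> h"
    "\<And>h h'. h \<in> verts H \<Longrightarrow> h' \<in> verts H \<Longrightarrow> h \<noteq> h' \<Longrightarrow> \<phi> h \<inter> \<phi> h' = {}"
    "\<And>h h'. {h, h'} \<in> edges H \<Longrightarrow> \<exists>u\<in>\<phi> h. \<exists>v\<in>\<phi> h'. {u, v} \<in> edges G"
    "inj_on g (verts H)"
proof -
  obtain \<phi> where H: "simple_graph H"
    and 1: "\<forall>h\<in>verts H. \<phi> h \<subseteq> verts G \<and> connected_radius_le G r (\<phi> h)"
    and 2: "\<forall>h\<in>verts H. \<forall>h'\<in>verts H. h \<noteq> h' \<longrightarrow> \<phi> h \<inter> \<phi> h' = {}"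
    and 3: "\<forall>h h'. {h, h'} \<in> edges H \<longrightarrow> (\<exists>u\<in>\<phi> h. \<exists>v\<in>\<phi> h'. {u, v} \<in> edges G)"
    using assms unfolding shallow_minor_def by (elim conjE exE)
  define g where "g h = (SOME x. x \<in> \<phi> h)" for h
  have g: "g h \<in> \<phi> h" if "h \<in> verts H" for h
  proof -
    have "\<exists>x. x \<in> \<phi> h" using connected_radius_le_nonempty[of G r "\<phi> h"] 1 that by blast
    then show ?thesis unfolding g_def by (rule someI_ex)
  qed
  have "inj_on g (verts H)"
  proof (rule inj_onI, rule ccontr)
    fix h h' assume h: "h \<in> verts H" "h' \<in> verts H" "g h = g h'" "h \<noteq> h'"
    then have "\<phi> h \<inter> \<phi> h' = {}" using 2 by simp
    then show False using g[OF h(1)] g[OF h(2)] h(3) by auto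
  qed
  then show ?thesis
  proof (rule that[OF H, rotated -1])
    show "\<phi> h \<subseteq> verts G \<and> connected_radius_le G r (\<phi> h) \<and> g h \<in> \<phi> h" if "h \<in> verts H" for h
      using 1 g that by simp
    show "\<phi> h \<inter> \<phi> h' = {}" if "h \<in> verts H" "h' \<in> verts H" "h \<noteq> h'" for h h'
      using 2 that by simp
    show "\<exists>u\<in>\<phi> h. \<exists>v\<in>\<phi> h'. {u, v} \<in> edges G" if "{h, h'} \<in> edges H" for h h'
      using 3 that by simp
  qed
qed

text \<open>\<open>sparse\<close> speaks only of minors on the vertex type of the graph, so a minor
  \<open>H\<close> of \<open>G'\<close> cannot be used for \<open>G\<close> directly. It is copied
  to the vertices \<open>f (g h)\<close>, where \<open>g h\<close> represents the branch set of
  \<open>h\<close>, and its branch sets are mapped by \<open>f\<close>.\<close>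

lemma sparse_hom:
  fixes G :: "'a graph" and G' :: "'b graph"
  assumes "sparse d G" "inj_on f (verts G')" "f ` verts G' \<subseteq> verts G"
    and hom: "\<And>u v. u \<in> verts G' \<Longrightarrow> v \<in> verts G' \<Longrightarrow> {u, v} \<in> edges G' \<Longrightarrow> {f u, f v} \<in> edges G"
  shows "sparse d G'"
  unfolding sparse_def
proof (intro allI impI)
  fix H :: "'b graph" assume "shallow_minor 5 H G'"
  then obtain \<phi> g where H: "simple_graph H"
    and 1: "\<And>h. h \<in> verts H \<Longrightarrow> \<phi> h \<subseteq> verts G' \<and> connected_radius_le G' 5 (\<phi> h) \<and> g h \<in> \<phi> h"
    and 2: "\<And>h h'. h \<in> verts H \<Longrightarrow> h' \<in> verts H \<Longrightarrow> h \<noteq> h' \<Longrightarrow> \<phi> h \<inter> \<phi> h' = {}"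
    and 3: "\<And>h h'. {h, h'} \<in> edges H \<Longrightarrow> \<exists>u\<in>\<phi> h. \<exists>v\<in>\<phi> h'. {u, v} \<in> edges G'"
    and g: "inj_on g (verts H)"
    by (rule shallow_minorE) blast
  define k where "k = f \<circ> g"
  have gV: "g ` verts H \<subseteq> verts G'" using 1 by blast
  have k: "inj_on k (verts H)"
    unfolding k_def using g inj_on_subset[OF assms(2) gV] by (rule comp_inj_on)
  define \<psi> where "\<psi> x = f ` \<phi> (the_inv_into (verts H) k x)" for x
  have \<psi>: "\<psi> (k h) = f ` \<phi> h" if "h \<in> verts H" for h
    by (simp add: \<psi>_def the_inv_into_f_f[OF k that])
  have Hsub: "e \<subseteq> verts H \<and> card e = 2" if "e \<in> edges H" for e using H that by (auto simp: simple_graph_def)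
  have "card ((`) k ` edges H) \<le> d * card (k ` verts H)"
  proof (rule sparse_minor[OF assms(1), of _ _ \<psi>])
    show "finite (k ` verts H)" using H by (simp add: simple_graph_def)
    show "e \<subseteq> k ` verts H \<and> card e = 2" if e: "e \<in> (`) k ` edges H" for e
    proof -
      obtain e' where e': "e' \<in> edges H" "e = k ` e'" using e by blast
      then show ?thesis using Hsub[OF e'(1)] card_image[OF inj_on_subset[OF k, of e']] by auto
    qed
    show "\<psi> x \<subseteq> verts G \<and> connected_radius_le G 5 (\<psi> x)" if x: "x \<in> k ` verts H" for x
    proof -
      obtain h where h: "h \<in> verts H" "x = k h" using x by blast
      have "connected_radius_le G 5 (f ` \<phi> h)"
        using 1[OF h(1)] hom by (intro connected_radius_le_image[of G']) auto
      moreover have "f ` \<phi> h \<subseteq> verts G" using 1[OF h(1)] assms(3) by (meson image_mono order_trans)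
      ultimately show ?thesis using h \<psi> by simp
    qed
    show "\<psi> x \<inter> \<psi> x' = {}" if x: "x \<in> k ` verts H" "x' \<in> k ` verts H" "x \<noteq> x'" for x x'
    proof -
      obtain h h' where h: "h \<in> verts H" "x = k h" "h' \<in> verts H" "x' = k h'" using x by blast
      then have "\<phi> h \<inter> \<phi> h' = {}" using x(3) by (intro 2) auto
      then have "f ` \<phi> h \<inter> f ` \<phi> h' = {}"
        using inj_on_image_Int[OF assms(2), of "\<phi> h" "\<phi> h'"] 1 h by simp
      then show ?thesis using h \<psi> by simp
    qed
    show "\<exists>u\<in>\<psi> x. \<exists>v\<in>\<psi> x'. {u, v} \<in> edges G" if x: "{x, x'} \<in> (`) k ` edges H" for x x'
    proof -
      obtain e where e: "e \<in> edges H" "{x, x'} = k ` e" using x by blast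
      obtain h where h: "h \<in> e" "x = k h" using e(2) by blast
      obtain h' where h': "h' \<in> e" "x' = k h'" using e(2) by blast
      have "e \<subseteq> {h, h'}"
      proof
        fix y assume "y \<in> e"
        then have "k y = k h \<or> k y = k h'" using e(2) h h' by blast
        then show "y \<in> {h, h'}" using inj_onD[OF k] \<open>y \<in> e\<close> h h' Hsub[OF e(1)] by blast
      qed
      then have "e = {h, h'}" using h h' by blast
      then obtain u v where uv: "u \<in> \<phi> h" "v \<in> \<phi> h'" "{u, v} \<in> edges G'" using 3 e(1) by blast
      have hV: "h \<in> verts H" "h' \<in> verts H" using h h' Hsub[OF e(1)] by auto
      have "{f u, f v} \<in> edges G" using hom[of u v] uv 1[OF hV(1)] 1[OF hV(2)] by blast
      then show ?thesis using uv(1,2) \<psi>[OF hV(1)] \<psi>[OF hV(2)] h h' by auto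
    qed
  qed
  moreover have "inj_on ((`) k) (edges H)"
    using Hsub by (intro inj_on_subset[OF inj_on_image_Pow[OF k]]) auto
  ultimately show "card (edges H) \<le> d * card (verts H)"
    by (simp add: card_image k)
qed

text \<open>The supremum in \<open>nabla\<close> is one of reals and bounds its members only if the
  densities are bounded above. The crude bound \<open>2 ^ card (verts G)\<close> suffices for that:
  a minor has at most as many vertices as \<open>G\<close>, and its edges are subsets of its vertex
  set.\<close>

lemma bounded_expansion_sparse:
  fixes \<G> :: "'a graph set"
  assumes "\<forall>G\<in>\<G>. simple_graph G" "bounded_expansion \<G>"
  shows "\<exists>d\<ge>1. \<forall>G\<in>\<G>. sparse d G"
proof -
  obtain f0 :: "nat \<Rightarrow> real" where f0: "\<forall>G\<in>\<G>. \<forall>r. nabla r G \<le> f0 r"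
    using assms(2) unfolding bounded_expansion_def by blast
  define d where "d = max 1 (nat \<lceil>f0 5\<rceil>)"
  have "sparse d G" if G: "G \<in> \<G>" for G
    unfolding sparse_def
  proof (intro allI impI)
    fix H :: "'a graph" assume H: "shallow_minor 5 H G"
    let ?M = "{H :: 'a graph. shallow_minor 5 H G}"
    let ?\<rho> = "\<lambda>H :: 'a graph. real (card (edges H)) / real (card (verts H))"
    have finV: "finite (verts G)" using assms(1) G by (simp add: simple_graph_def)
    have "?\<rho> H' \<le> 2 ^ card (verts G)" if minor: "shallow_minor 5 H' G" for H' :: "'a graph"
    proof -
      obtain \<phi> g where H': "simple_graph H'" and g: "inj_on g (verts H')"
        and 1: "\<And>h. h \<in> verts H' \<Longrightarrow> \<phi> h \<subseteq> verts G \<and> connected_radius_le G 5 (\<phi> h) \<and> g h \<in> \<phi> h"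
        by (rule shallow_minorE[OF minor]) blast
      have "g ` verts H' \<subseteq> verts G" using 1 by blast
      then have c: "card (verts H') \<le> card (verts G)" using card_inj_on_le[OF g _ finV] by blast
      have fin: "finite (verts H')" and sub: "edges H' \<subseteq> Pow (verts H')"
        using H' by (auto simp: simple_graph_def)
      then have "card (edges H') \<le> card (Pow (verts H'))" by (intro card_mono) auto
      also have "\<dots> \<le> 2 ^ card (verts G)" using c fin by (simp add: card_Pow power_increasing)
      finally have e: "real (card (edges H')) \<le> 2 ^ card (verts G)"
        by (metis of_nat_le_iff of_nat_numeral of_nat_power)
      show ?thesis
      proof (cases "card (verts H') = 0")
        case False
        then have "?\<rho> H' \<le> real (card (edges H'))" by (simp add: divide_le_eq mult_left_le_one_le mult_le_cancel_left1)
        then show ?thesis using e by linarith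
      qed simp
    qed
    then have "bdd_above (?\<rho> ` ?M)" by (intro bdd_aboveI[of _ "2 ^ card (verts G)"]) auto
    then have "?\<rho> H \<le> nabla 5 G" unfolding nabla_def using H by (intro cSUP_upper) auto
    also have "\<dots> \<le> f0 5" using f0 G by blast
    also have "\<dots> \<le> real d" unfolding d_def by linarith
    finally have \<rho>: "?\<rho> H \<le> real d" .
    have simple: "simple_graph H" using H by (simp add: shallow_minor_def)
    show "card (edges H) \<le> d * card (verts H)"
    proof (cases "card (verts H) = 0")
      case True
      then have "verts H = {}" using simple by (simp add: simple_graph_def)
      then have "edges H = {}" using simple by (auto simp: simple_graph_def)
      then show ?thesis by simp
    next
      case False
      then have "real (card (edges H)) \<le> real d * real (card (verts H))" using \<rho> by (simp add: divide_le_eq)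
      then show ?thesis by (metis of_nat_le_iff of_nat_mult)
    qed
  qed
  then show ?thesis by (intro exI[of _ d]) (auto simp: d_def)
qed

text \<open>Outside \<open>K\<close>, one vertex of least threshold represents all vertices with the same neighbourhood in
  \<open>K\<close>; ties are broken by the order of the vertices.\<close>

definition kept :: "nat graph \<Rightarrow> (nat \<Rightarrow> nat) \<Rightarrow> nat set \<Rightarrow> nat set" where
  "kept G t K = K \<union> {v \<in> verts G - K. nbrs G v \<inter> K \<noteq> {} \<and>
     \<not> (\<exists>w \<in> verts G - K. nbrs G w \<inter> K = nbrs G v \<inter> K \<and> (t w < t v \<or> t w = t v \<and> w < v))}"

text \<open>Edges without an end in \<open>K\<close> never count towards a solution inside
  \<open>K\<close>.\<close>

definition kernel_graph :: "nat graph \<Rightarrow> (nat \<Rightarrow> nat) \<Rightarrow> nat set \<Rightarrow> nat graph" where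
  "kernel_graph G t K = \<lparr>verts = kept G t K, edges = {e \<in> edges G. e \<subseteq> kept G t K \<and> e \<inter> K \<noteq> {}}\<rparr>"

lemma verts_kernel_graph [simp]: "verts (kernel_graph G t K) = kept G t K"
  by (simp add: kernel_graph_def)

lemma kept_subset: "K \<subseteq> verts G \<Longrightarrow> kept G t K \<subseteq> verts G"
  by (auto simp: kept_def)

text \<open>Descent along the lexicographic order of threshold and index: a vertex that is not kept
  has a smaller one with the same trace on \<open>K\<close>.\<close>

lemma kept_representative:
  assumes "v \<in> verts G - K" "nbrs G v \<inter> K \<noteq> {}"
  shows "\<exists>w\<in>kept G t K - K. nbrs G w \<inter> K = nbrs G v \<inter> K \<and> t w \<le> t v"
  using assms
proof (induction v rule: wf_induct_rule[OF wf_measures[of "[t, \<lambda>v. v]"]])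
  case (1 v)
  show ?case
  proof (cases "v \<in> kept G t K")
    case True
    then show ?thesis using 1(2) by blast
  next
    case False
    then obtain w where w: "w \<in> verts G - K" "nbrs G w \<inter> K = nbrs G v \<inter> K" "t w < t v \<or> t w = t v \<and> w < v"
      using 1(2,3) unfolding kept_def by blast
    then have "(w, v) \<in> measures [t, \<lambda>v. v]" by auto
    from 1(1)[OF this w(1)] w 1(3) obtain x where "x \<in> kept G t K - K" "nbrs G x \<inter> K = nbrs G w \<inter> K" "t x \<le> t w"
      by auto
    moreover have "t w \<le> t v" using w(3) by auto
    ultimately show ?thesis using w(2) by (intro bexI[of _ x]) auto
  qed
qed

lemma kernel_nbrs:
  assumes "v \<in> kept G t K" "K \<subseteq> verts G" "S \<subseteq> K"
  shows "nbrs (kernel_graph G t K) v \<inter> S = nbrs G v \<inter> S"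
proof -
  have "u \<in> nbrs (kernel_graph G t K) v \<longleftrightarrow> u \<in> nbrs G v" if "u \<in> S" for u
  proof -
    have u: "u \<in> K" "u \<in> verts G" "u \<in> kept G t K" using that assms(2,3) by (auto simp: kept_def)
    then show ?thesis using assms(1) by (simp add: nbrs_def kernel_graph_def)
  qed
  then show ?thesis by blast
qed

text \<open>A dropped vertex imposes nothing new: either it sees no candidate, and its threshold is
  positive, or its representative has the same trace on \<open>K\<close> and is at least as
  tight.\<close>

lemma kernel_equivalent:
  assumes t: "\<And>v. v \<in> verts G \<Longrightarrow> 1 \<le> t v" and K: "K \<subseteq> verts G"
  shows "annotated_bhs_yes (kernel_graph G t K) t k K \<longleftrightarrow> annotated_bhs_yes G t k K"
proof -
  have "harmless (kernel_graph G t K) t S \<longleftrightarrow> harmless G t S" if S: "S \<subseteq> K" for S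
  proof
    assume h: "harmless G t S"
    show "harmless (kernel_graph G t K) t S" unfolding harmless_def
    proof (intro conjI ballI)
      show "S \<subseteq> verts (kernel_graph G t K)" using S by (auto simp: kept_def)
      fix v assume "v \<in> verts (kernel_graph G t K)"
      then have v: "v \<in> kept G t K" by simp
      then show "card (nbrs (kernel_graph G t K) v \<inter> S) < t v"
        using h kernel_nbrs[OF v K S] kept_subset[OF K, of t] by (auto simp: harmless_def)
    qed
  next
    assume h: "harmless (kernel_graph G t K) t S"
    have *: "card (nbrs G v \<inter> S) < t v" if v: "v \<in> kept G t K" for v
      using h v kernel_nbrs[OF v K S] by (auto simp: harmless_def)
    show "harmless G t S" unfolding harmless_def
    proof (intro conjI ballI)
      show "S \<subseteq> verts G" using S K by blast
      fix v assume v: "v \<in> verts G"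
      consider "v \<in> K" | "v \<notin> K" "nbrs G v \<inter> K = {}" | "v \<notin> K" "nbrs G v \<inter> K \<noteq> {}" by blast
      then show "card (nbrs G v \<inter> S) < t v"
      proof cases
        case 1
        then show ?thesis by (intro *) (simp add: kept_def)
      next
        case 2
        then have "nbrs G v \<inter> S = {}" using S by blast
        then show ?thesis using t[OF v] by simp
      next
        case 3
        then obtain w where w: "w \<in> kept G t K" "nbrs G w \<inter> K = nbrs G v \<inter> K" "t w \<le> t v"
          using kept_representative[of v G K t] v by blast
        have "nbrs G v \<inter> S = nbrs G w \<inter> S" using w(2) S by blast
        then show ?thesis using *[OF w(1)] w(3) by simp
      qed
    qed
  qed
  then show ?thesis unfolding annotated_bhs_yes_def by blast
qed

text \<open>The tie-breaking order is total, so kept vertices outside \<open>K\<close> have distinct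
  nonempty traces on \<open>K\<close>, and \<open>bip_neighbourhoods\<close> counts the
  traces.\<close>

lemma card_kept:
  assumes "sparse d G" "simple_graph G" "K \<subseteq> verts G"
  shows "card (kept G t K) \<le> (1 + d + 4 ^ d) * card K"
proof -
  have finV: "finite (verts G)" using assms(2) by (simp add: simple_graph_def)
  have bip: "bip d K (verts G - K) (\<lambda>y. nbrs G y \<inter> K)"
    using assms(3) by (intro bip_nbrs[OF assms(1,2)]) auto
  let ?W = "kept G t K - K"
  have W: "v \<in> verts G - K" "nbrs G v \<inter> K \<noteq> {}"
      "\<And>w. w \<in> verts G - K \<Longrightarrow> nbrs G w \<inter> K = nbrs G v \<inter> K \<Longrightarrow> \<not> (t w < t v \<or> t w = t v \<and> w < v)"
    if "v \<in> ?W" for v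
    using that unfolding kept_def by blast+
  have "inj_on (\<lambda>y. nbrs G y \<inter> K) ?W"
  proof (rule inj_onI)
    fix v w assume vw: "v \<in> ?W" "w \<in> ?W" "nbrs G v \<inter> K = nbrs G w \<inter> K"
    show "v = w" using W(3)[OF vw(1) W(1)[OF vw(2)]] W(3)[OF vw(2) W(1)[OF vw(1)]] vw(3) by auto
  qed
  then have "card ?W = card ((\<lambda>y. nbrs G y \<inter> K) ` ?W)" by (simp add: card_image)
  also have "\<dots> \<le> card {nbrs G y \<inter> K |y. y \<in> verts G - K \<and> nbrs G y \<inter> K \<noteq> {}}"
    using W(1,2) finV by (intro card_mono) auto
  also have "\<dots> \<le> (d + 4 ^ d) * card K" by (rule bip_neighbourhoods[OF bip])
  finally have "card ?W \<le> (d + 4 ^ d) * card K" .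
  moreover have "card (kept G t K) \<le> card K + card ?W"
    using card_Un_le[of K ?W] by (simp add: kept_def)
  ultimately show ?thesis by (simp add: algebra_simps)
qed

lemma kernel_size:
  assumes "sparse d G" "simple_graph G" "K \<subseteq> verts G"
  shows "annotated_bhs_size (kernel_graph G t K) t k K \<le> (1 + d) * ((1 + d + 4 ^ d) * card K) + k"
proof -
  have finV: "finite (verts G)" using assms(2) by (simp add: simple_graph_def)
  have "finite (edges G)" using assms(2) by (intro finite_subset[OF _ finite_Pow_iff[THEN iffD2, OF finV]]) (auto simp: simple_graph_def)
  then have "card (edges (kernel_graph G t K)) \<le> card {e\<in>edges G. e \<subseteq> kept G t K}"
    by (intro card_mono) (auto simp: kernel_graph_def)
  also have "\<dots> \<le> d * card (kept G t K)" by (rule sparse_edges[OF assms(1,2) kept_subset[OF assms(3)]])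
  finally have "card (verts (kernel_graph G t K)) + card (edges (kernel_graph G t K)) \<le> (1 + d) * card (kept G t K)"
    by (simp add: kernel_graph_def)
  also have "\<dots> \<le> (1 + d) * ((1 + d + 4 ^ d) * card K)" by (intro mult_le_mono2 card_kept assms)
  finally show ?thesis by (simp add: annotated_bhs_size_def)
qed

lemma kernel_instance:
  assumes "bhs_instance p G t k" "K \<subseteq> verts G"
  shows "annotated_bhs_instance p (kernel_graph G t K) t k K"
proof -
  have sub: "kept G t K \<subseteq> verts G" by (rule kept_subset[OF assms(2)])
  then have "finite (kept G t K)"
    using assms(1) by (auto simp: bhs_instance_def simple_graph_def intro: finite_subset)
  then have "simple_graph (kernel_graph G t K)"
    using assms(1) by (auto simp: bhs_instance_def simple_graph_def kernel_graph_def)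
  moreover have "K \<subseteq> kept G t K" by (simp add: kept_def)
  ultimately show ?thesis
    using assms(1) sub unfolding annotated_bhs_instance_def bhs_instance_def verts_kernel_graph by blast
qed

section \<open>Programs deciding first-order conditions\<close>

definition is_polynomial :: "(nat \<Rightarrow> nat) \<Rightarrow> bool" where
  "is_polynomial f \<longleftrightarrow> (\<exists>q. \<forall>n. f n = poly q n)"

named_theorems polynomial_intros

lemma polynomial_const [polynomial_intros]: "is_polynomial (\<lambda>n. c)"
  unfolding is_polynomial_def by (intro exI[of _ "[:c:]"]) simp

lemma polynomial_id [polynomial_intros]: "is_polynomial (\<lambda>n. n)"
  unfolding is_polynomial_def by (intro exI[of _ "[:0, 1:]"]) simp

lemma polynomial_add [polynomial_intros]:
  "is_polynomial f \<Longrightarrow> is_polynomial g \<Longrightarrow> is_polynomial (\<lambda>n. f n + g n)"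
  unfolding is_polynomial_def by (elim exE, rule_tac x="q + qa" in exI, simp)

lemma polynomial_mult [polynomial_intros]:
  "is_polynomial f \<Longrightarrow> is_polynomial g \<Longrightarrow> is_polynomial (\<lambda>n. f n * g n)"
  unfolding is_polynomial_def by (elim exE, rule_tac x="q * qa" in exI, simp)

lemma polynomial_power [polynomial_intros]: "is_polynomial f \<Longrightarrow> is_polynomial (\<lambda>n. f n ^ k)"
  unfolding is_polynomial_def by (elim exE, rule_tac x="q ^ k" in exI, simp)

text \<open>Holds because natural coefficients are nonnegative. It turns a time bound in the number
  of vertices into one in the input length.\<close>

lemma poly_nat_mono: "m \<le> n \<Longrightarrow> poly q m \<le> poly q (n :: nat)"
  by (induction q) (auto intro!: add_mono mult_mono)

lemma polynomial_scat: "is_polynomial f \<Longrightarrow> is_polynomial (\<lambda>p. scat d (f p))"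
  unfolding scat_def by (intro polynomial_intros)

text \<open>The parameter \<open>p\<close> enters only through \<open>density\<close>, and every
  exponent depends on \<open>d\<close> alone.\<close>

lemma polynomial_kernel_bound: "is_polynomial (kernel_bound d)"
proof -
  have B: "is_polynomial (density d)" unfolding density_def by (intro polynomial_intros)
  then have "is_polynomial (\<lambda>p. scat2 d (density d p))"
    unfolding scat2_def by (intro polynomial_intros polynomial_scat)
  then show ?thesis unfolding kernel_bound_def[abs_def] Let_def using B by (intro polynomial_intros)
qed

section \<open>Total correctness with time bounds\<close>

definition runs :: "prog \<Rightarrow> store \<Rightarrow> nat \<Rightarrow> (store \<Rightarrow> bool) \<Rightarrow> bool" where
  "runs c s T Q \<longleftrightarrow> (\<exists>\<tau> s'. exec c s \<tau> s' \<and> \<tau> \<le> T \<and> Q s')"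

definition set_cell :: "name \<Rightarrow> nat \<Rightarrow> nat \<Rightarrow> store \<Rightarrow> store" where
  "set_cell x i a s = s(x := (s x)(i := a))"

lemma set_cell_apply [simp]:
  "set_cell x i a s y = (if y = x then (s x)(i := a) else s y)"
  by (simp add: set_cell_def)

lemma runs_Skip: "Q s \<Longrightarrow> runs Skip s 1 Q"
  unfolding runs_def using exec.Skip by blast

lemma runs_Write: "Q (set_cell x (eval_expr i s) (eval_expr e s) s) \<Longrightarrow> runs (Write x i e) s 1 Q"
  unfolding runs_def set_cell_def using exec.Write by blast

lemma runs_Seq: "runs c s T (\<lambda>s'. runs c' s' T' Q) \<Longrightarrow> runs (Seq c c') s (T + T') Q"
  unfolding runs_def using exec.Seq add_mono by blast

lemma runs_mono: "runs c s T Q \<Longrightarrow> T \<le> T' \<Longrightarrow> (\<And>s'. Q s' \<Longrightarrow> Q' s') \<Longrightarrow> runs c s T' Q'"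
  unfolding runs_def using le_trans by blast

lemma runs_Cond:
  assumes "eval_expr b s \<noteq> 0 \<Longrightarrow> runs c s T Q" "eval_expr b s = 0 \<Longrightarrow> runs c' s T Q"
  shows "runs (Cond b c c') s (T + 1) Q"
proof (cases "eval_expr b s = 0")
  case True
  then show ?thesis using assms(2) unfolding runs_def by (meson CondFalse add_le_mono1)
next
  case False
  then show ?thesis using assms(1) unfolding runs_def by (meson CondTrue add_le_mono1)
qed

text \<open>The counter is cell \<open>i\<close> of an array, so that nested loops can use different
  cells of the same array.\<close>

definition For :: "name \<Rightarrow> nat \<Rightarrow> prog \<Rightarrow> prog" where
  "For x i c = Seq (Write x (Const i) (Const 0))
     (While (Sub (Read ''n'' (Const 0)) (Read x (Const i)))
        (Seq c (Write x (Const i) (Add (Read x (Const i)) (Const 1)))))"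

text \<open>Each round costs the body, the increment and the successful test; the final 2 pays for
  the initialisation and the failing test.\<close>

lemma runs_For:
  assumes init: "I 0 (set_cell x i 0 s)"
    and inv: "\<And>a s. I a s \<Longrightarrow> s ''n'' 0 = n \<and> s x i = a"
    and step: "\<And>a s. a < n \<Longrightarrow> I a s \<Longrightarrow> runs c s T (\<lambda>s'. s' x i = a \<and> I (Suc a) (set_cell x i (Suc a) s'))"
  shows "runs (For x i c) s (n * (T + 2) + 2) (I n)"
proof -
  let ?W = "While (Sub (Read ''n'' (Const 0)) (Read x (Const i)))
        (Seq c (Write x (Const i) (Add (Read x (Const i)) (Const 1))))"
  have "runs ?W s ((n - a) * (T + 2) + 1) (I n)" if "I a s" "a \<le> n" for a s
    using that
  proof (induction "n - a" arbitrary: a s)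
    case 0
    then have "eval_expr (Sub (Read ''n'' (Const 0)) (Read x (Const i))) s = 0" "a = n"
      using inv[OF 0(2)] by auto
    then have "exec ?W s 1 s" by (intro exec.WhileFalse)
    then show ?case using 0(2) \<open>a = n\<close> unfolding runs_def by (intro exI[of _ 1] exI[of _ s]) auto
  next
    case (Suc m)
    then have a: "a < n" "n - Suc a = m" by auto
    obtain \<tau> s' where 1: "exec c s \<tau> s'" "\<tau> \<le> T" "s' x i = a" "I (Suc a) (set_cell x i (Suc a) s')"
      using step[OF a(1) Suc(3)] unfolding runs_def by blast
    obtain \<tau>' s'' where 2: "exec ?W (set_cell x i (Suc a) s') \<tau>' s''" "\<tau>' \<le> m * (T + 2) + 1" "I n s''"
      using Suc(1)[OF _ 1(4)] a unfolding runs_def by auto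
    have "exec (Write x (Const i) (Add (Read x (Const i)) (Const 1))) s' 1 (set_cell x i (Suc a) s')"
      using exec.Write[of x "Const i" "Add (Read x (Const i)) (Const 1)" s'] 1(3) by (simp add: set_cell_def)
    then have "exec (Seq c (Write x (Const i) (Add (Read x (Const i)) (Const 1)))) s (\<tau> + 1) (set_cell x i (Suc a) s')"
      by (rule exec.Seq[OF 1(1)])
    moreover have "eval_expr (Sub (Read ''n'' (Const 0)) (Read x (Const i))) s \<noteq> 0"
      using inv[OF Suc(3)] a by auto
    ultimately have "exec ?W s (\<tau> + 1 + \<tau>' + 1) s''" using 2(1) by (intro exec.WhileTrue) auto
    moreover have "\<tau> + 1 + \<tau>' + 1 \<le> (n - a) * (T + 2) + 1"
    proof -
      have "n - a = Suc m" using Suc(2) by simp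
      then show ?thesis using 1(2) 2(2) by simp
    qed
    ultimately show ?case using 2(3) unfolding runs_def by blast
  qed
  from this[OF init] have "runs ?W (set_cell x i 0 s) (n * (T + 2) + 1) (I n)" by simp
  then have "runs (For x i c) s (1 + (n * (T + 2) + 1)) (I n)"
    unfolding For_def by (intro runs_Seq runs_Write) simp
  then show ?thesis by simp
qed

text \<open>The number of variables in the reduction rule depends on \<open>p\<close>. Compiling
  formulas once and for all provides the nested loops for every \<open>p\<close> and reduces
  correctness of the program to \<open>sat\<close>. Equality of vertices is derived from
  \<open>FLess\<close>, which also serves the tie-breaking in \<open>kept\<close>.\<close>

datatype fm =
    FTrue
  | FAdj nat nat
  | FCand nat
  | FLe nat nat
  | FOne nat
  | FLess nat nat
  | FNeg fm
  | FAnd fm fm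
  | FEx fm

text \<open>\<open>sat G t K k \<phi> e\<close> and \<open>compile k \<phi>\<close> are used with free variables \<open>0, \<dots>, k - 1\<close>; a quantifier
  at level \<open>k\<close> binds the variable \<open>k\<close>.  The compiled formula leaves its truth value in cell \<open>k\<close>
  of the array \<open>r\<close> and keeps its variables in the array \<open>v\<close>.\<close>

primrec sat :: "nat graph \<Rightarrow> (nat \<Rightarrow> nat) \<Rightarrow> nat set \<Rightarrow> nat \<Rightarrow> fm \<Rightarrow> (nat \<Rightarrow> nat) \<Rightarrow> bool" where
  "sat G t K k FTrue e \<longleftrightarrow> True"
| "sat G t K k (FAdj i j) e \<longleftrightarrow> {e i, e j} \<in> edges G"
| "sat G t K k (FCand i) e \<longleftrightarrow> e i \<in> K"
| "sat G t K k (FLe i j) e \<longleftrightarrow> t (e i) \<le> t (e j)"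
| "sat G t K k (FOne i) e \<longleftrightarrow> t (e i) \<le> 1"
| "sat G t K k (FLess i j) e \<longleftrightarrow> e i < e j"
| "sat G t K k (FNeg \<phi>) e \<longleftrightarrow> \<not> sat G t K k \<phi> e"
| "sat G t K k (FAnd \<phi> \<psi>) e \<longleftrightarrow> sat G t K k \<phi> e \<and> sat G t K k \<psi> e"
| "sat G t K k (FEx \<phi>) e \<longleftrightarrow> (\<exists>x\<in>verts G. sat G t K (Suc k) \<phi> (e(k := x)))"

primrec wf_fm :: "nat \<Rightarrow> fm \<Rightarrow> bool" where
  "wf_fm k FTrue \<longleftrightarrow> True"
| "wf_fm k (FAdj i j) \<longleftrightarrow> i < k \<and> j < k"
| "wf_fm k (FCand i) \<longleftrightarrow> i < k"
| "wf_fm k (FLe i j) \<longleftrightarrow> i < k \<and> j < k"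
| "wf_fm k (FOne i) \<longleftrightarrow> i < k"
| "wf_fm k (FLess i j) \<longleftrightarrow> i < k \<and> j < k"
| "wf_fm k (FNeg \<phi>) \<longleftrightarrow> wf_fm k \<phi>"
| "wf_fm k (FAnd \<phi> \<psi>) \<longleftrightarrow> wf_fm k \<phi> \<and> wf_fm k \<psi>"
| "wf_fm k (FEx \<phi>) \<longleftrightarrow> wf_fm (Suc k) \<phi>"

abbreviation Var :: "nat \<Rightarrow> expr" where "Var i \<equiv> Read ''v'' (Const i)"

abbreviation Thr :: "expr \<Rightarrow> expr" where "Thr e \<equiv> Read ''in'' (Add (Const 2) e)"

abbreviation Entry :: "expr \<Rightarrow> expr \<Rightarrow> expr" where "Entry e e' \<equiv> Read ''in'' (Add (Read ''row'' e) e')"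

text \<open>Any nonzero number counts as true. Negation and comparison therefore use truncated
  subtraction, and a quantifier adds up the results of its body.\<close>

primrec compile :: "nat \<Rightarrow> fm \<Rightarrow> prog" where
  "compile k FTrue = Write ''r'' (Const k) (Const 1)"
| "compile k (FAdj i j) = Write ''r'' (Const k) (Entry (Var i) (Var j))"
| "compile k (FCand i) = Write ''r'' (Const k) (Read ''K'' (Var i))"
| "compile k (FLe i j) = Write ''r'' (Const k) (Sub (Const 1) (Sub (Thr (Var i)) (Thr (Var j))))"
| "compile k (FOne i) = Write ''r'' (Const k) (Sub (Const 2) (Thr (Var i)))"
| "compile k (FLess i j) = Write ''r'' (Const k) (Sub (Var j) (Var i))"
| "compile k (FNeg \<phi>) =
     Seq (compile k \<phi>) (Write ''r'' (Const k) (Sub (Const 1) (Read ''r'' (Const k))))"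
| "compile k (FAnd \<phi> \<psi>) = Seq (compile k \<phi>) (Cond (Read ''r'' (Const k)) (compile k \<psi>) Skip)"
| "compile k (FEx \<phi>) = Seq (Write ''r'' (Const k) (Const 0))
     (For ''v'' k (Seq (compile (Suc k) \<phi>)
        (Write ''r'' (Const k) (Add (Read ''r'' (Const k)) (Read ''r'' (Const (Suc k)))))))"

primrec fm_time :: "fm \<Rightarrow> nat \<Rightarrow> nat" where
  "fm_time FTrue n = 1"
| "fm_time (FAdj i j) n = 1"
| "fm_time (FCand i) n = 1"
| "fm_time (FLe i j) n = 1"
| "fm_time (FOne i) n = 1"
| "fm_time (FLess i j) n = 1"
| "fm_time (FNeg \<phi>) n = fm_time \<phi> n + 1"
| "fm_time (FAnd \<phi> \<psi>) n = fm_time \<phi> n + (fm_time \<psi> n + 1 + 1)"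
| "fm_time (FEx \<phi>) n = 1 + (n * (fm_time \<phi> n + 1 + 2) + 2)"

lemma polynomial_fm_time [polynomial_intros]: "is_polynomial (fm_time \<phi>)"
proof -
  have "is_polynomial (\<lambda>n. fm_time \<phi> n)"
  proof (induction \<phi>)
    case (FNeg \<phi>)
    then show ?case unfolding fm_time.simps by (intro polynomial_add polynomial_const)
  next
    case (FAnd \<phi> \<psi>)
    then show ?case unfolding fm_time.simps by (intro polynomial_add polynomial_const)
  next
    case (FEx \<phi>)
    then show ?case unfolding fm_time.simps
      by (intro polynomial_add polynomial_mult polynomial_const polynomial_id)
  qed (simp_all add: polynomial_const)
  then show ?thesis by simp
qed

text \<open>The array \<open>row\<close> holds the starting positions of the matrix rows. It is
  filled by repeated addition, since the machine cannot multiply.\<close>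

definition represents :: "store \<Rightarrow> nat \<Rightarrow> nat graph \<Rightarrow> (nat \<Rightarrow> nat) \<Rightarrow> nat set \<Rightarrow> bool" where
  "represents s n G t K \<longleftrightarrow> s ''n'' 0 = n \<and> verts G = {..<n} \<and>
     (\<forall>i<n. \<forall>j<n. s ''in'' (s ''row'' i + j) = of_bool ({i, j} \<in> edges G)) \<and>
     (\<forall>i<n. s ''in'' (2 + i) = t i) \<and> (\<forall>i<n. s ''K'' i = of_bool (i \<in> K))"

text \<open>The frame condition of \<open>compile\<close> at level \<open>k\<close>: only the
  scratch cells from \<open>k\<close> on may change.\<close>

definition same_upto :: "nat \<Rightarrow> store \<Rightarrow> store \<Rightarrow> bool" where
  "same_upto k s s' \<longleftrightarrow> (\<forall>x. x \<noteq> ''v'' \<and> x \<noteq> ''r'' \<longrightarrow> s' x = s x) \<and>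
     (\<forall>i<k. s' ''v'' i = s ''v'' i \<and> s' ''r'' i = s ''r'' i)"

lemma same_upto_represents: "same_upto k s s' \<Longrightarrow> represents s n G t K \<Longrightarrow> represents s' n G t K"
  by (simp add: same_upto_def represents_def)

lemma same_upto_trans: "same_upto k s s' \<Longrightarrow> same_upto k s' s'' \<Longrightarrow> same_upto k s s''"
  by (simp add: same_upto_def)

lemma sat_cong:
  "wf_fm k \<phi> \<Longrightarrow> (\<And>i. i < k \<Longrightarrow> e i = e' i) \<Longrightarrow> sat G t K k \<phi> e = sat G t K k \<phi> e'"
proof (induction \<phi> arbitrary: k e e')
  case (FEx \<phi>)
  have "sat G t K (Suc k) \<phi> (e(k := x)) = sat G t K (Suc k) \<phi> (e'(k := x))" for x
    using FEx.prems by (intro FEx.IH) (auto simp: less_Suc_eq)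
  then show ?case by simp
next
  case (FNeg \<phi>)
  have "sat G t K k \<phi> e = sat G t K k \<phi> e'"
    by (rule FNeg.IH[OF _ FNeg.prems(2)]) (use FNeg.prems(1) in simp)
  then show ?case by simp
next
  case (FAnd \<phi> \<psi>)
  have "sat G t K k \<phi> e = sat G t K k \<phi> e'"
    by (rule FAnd.IH(1)[OF _ FAnd.prems(2)]) (use FAnd.prems(1) in simp)
  moreover have "sat G t K k \<psi> e = sat G t K k \<psi> e'"
    by (rule FAnd.IH(2)[OF _ FAnd.prems(2)]) (use FAnd.prems(1) in simp)
  ultimately show ?case by simp
qed simp_all

lemma runs_compile:
  assumes "represents s n G t K" "wf_fm k \<phi>" "\<And>i. i < k \<Longrightarrow> s ''v'' i < n"
  shows "runs (compile k \<phi>) s (fm_time \<phi> n)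
    (\<lambda>s'. same_upto k s s' \<and> (s' ''r'' k \<noteq> 0 \<longleftrightarrow> sat G t K k \<phi> (s ''v'')))"
  using assms
proof (induction \<phi> arbitrary: k s)
  case (FNeg \<phi>)
  have "runs (compile k (FNeg \<phi>)) s (fm_time \<phi> n + 1)
    (\<lambda>s'. same_upto k s s' \<and> (s' ''r'' k \<noteq> 0 \<longleftrightarrow> sat G t K k (FNeg \<phi>) (s ''v'')))"
    unfolding compile.simps
  proof (rule runs_Seq, rule runs_mono[OF FNeg.IH[OF FNeg.prems(1) _ FNeg.prems(3)] order_refl])
    show "wf_fm k \<phi>" using FNeg.prems(2) by simp
    fix s' assume "same_upto k s s' \<and> (s' ''r'' k \<noteq> 0 \<longleftrightarrow> sat G t K k \<phi> (s ''v''))"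
    then show "runs (Write ''r'' (Const k) (Sub (Const 1) (Read ''r'' (Const k)))) s' 1
      (\<lambda>s'. same_upto k s s' \<and> (s' ''r'' k \<noteq> 0 \<longleftrightarrow> sat G t K k (FNeg \<phi>) (s ''v'')))"
      by (intro runs_Write) (simp add: same_upto_def Suc_le_eq)
  qed
  then show ?case by simp
next
  case (FAnd \<phi> \<psi>)
  have w: "wf_fm k \<phi>" "wf_fm k \<psi>" using FAnd.prems by auto
  have "runs (compile k (FAnd \<phi> \<psi>)) s (fm_time \<phi> n + (fm_time \<psi> n + 1 + 1))
    (\<lambda>s'. same_upto k s s' \<and> (s' ''r'' k \<noteq> 0 \<longleftrightarrow> sat G t K k (FAnd \<phi> \<psi>) (s ''v'')))"
    unfolding compile.simps
  proof (rule runs_Seq, rule runs_mono[OF FAnd.IH(1)[OF FAnd.prems(1) w(1) FAnd.prems(3)] order_refl])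
    fix s' assume s': "same_upto k s s' \<and> (s' ''r'' k \<noteq> 0 \<longleftrightarrow> sat G t K k \<phi> (s ''v''))"
    show "runs (Cond (Read ''r'' (Const k)) (compile k \<psi>) Skip) s' (fm_time \<psi> n + 1 + 1)
      (\<lambda>s'. same_upto k s s' \<and> (s' ''r'' k \<noteq> 0 \<longleftrightarrow> sat G t K k (FAnd \<phi> \<psi>) (s ''v'')))"
    proof (rule runs_Cond)
      assume r: "eval_expr (Read ''r'' (Const k)) s' \<noteq> 0"
      have rep: "represents s' n G t K" using s' FAnd.prems(1) same_upto_represents by blast
      have v: "s' ''v'' i < n" if "i < k" for i using FAnd.prems(3)[OF that] s' that by (simp add: same_upto_def)
      have "sat G t K k \<psi> (s' ''v'') = sat G t K k \<psi> (s ''v'')"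
        using s' by (intro sat_cong w(2)) (simp add: same_upto_def)
      then show "runs (compile k \<psi>) s' (fm_time \<psi> n + 1)
          (\<lambda>s'. same_upto k s s' \<and> (s' ''r'' k \<noteq> 0 \<longleftrightarrow> sat G t K k (FAnd \<phi> \<psi>) (s ''v'')))"
        using s' r same_upto_trans
        by (intro runs_mono[OF FAnd.IH(2)[OF rep w(2) v]]) auto
    next
      assume "eval_expr (Read ''r'' (Const k)) s' = 0"
      then show "runs Skip s' (fm_time \<psi> n + 1)
          (\<lambda>s'. same_upto k s s' \<and> (s' ''r'' k \<noteq> 0 \<longleftrightarrow> sat G t K k (FAnd \<phi> \<psi>) (s ''v'')))"
        using s' by (intro runs_mono[OF runs_Skip[of "\<lambda>x. x = s'"]]) auto
    qed
  qed
  then show ?case by simp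
next
  case (FEx \<phi>)
  let ?I = "\<lambda>a s'. same_upto k s s' \<and> s' ''v'' k = a \<and>
    (s' ''r'' k \<noteq> 0 \<longleftrightarrow> (\<exists>x<a. sat G t K (Suc k) \<phi> ((s ''v'')(k := x))))"
  have n: "s ''n'' 0 = n" and GV: "verts G = {..<n}" using FEx.prems(1) by (auto simp: represents_def)
  have "runs (compile k (FEx \<phi>)) s (1 + (n * (fm_time \<phi> n + 1 + 2) + 2)) (?I n)"
    unfolding compile.simps
  proof (rule runs_Seq, rule runs_Write, rule runs_For)
    fix a s' assume I: "?I a s'"
    then show "s' ''n'' 0 = n \<and> s' ''v'' k = a" using n by (simp add: same_upto_def)
    assume a: "a < n"
    have rep: "represents s' n G t K" using I FEx.prems(1) same_upto_represents by blast
    have v: "s' ''v'' i < n" if "i < Suc k" for i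
    proof (cases "i = k")
      case False
      then show ?thesis using FEx.prems(3)[of i] I that by (simp add: same_upto_def)
    qed (use I a in simp)
    have w: "wf_fm (Suc k) \<phi>" using FEx.prems(2) by simp
    \<comment> \<open>The cells of \<open>v\<close> above \<open>k\<close> hold leftovers of inner
      loops; \<open>sat_cong\<close> makes them irrelevant.\<close>
    have eq: "sat G t K (Suc k) \<phi> (s' ''v'') = sat G t K (Suc k) \<phi> ((s ''v'')(k := a))"
    proof (rule sat_cong[OF w])
      show "s' ''v'' i = ((s ''v'')(k := a)) i" if "i < Suc k" for i
        using I that by (cases "i = k") (simp_all add: same_upto_def)
    qed
    show "runs (Seq (compile (Suc k) \<phi>) (Write ''r'' (Const k) (Add (Read ''r'' (Const k)) (Read ''r'' (Const (Suc k))))))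
       s' (fm_time \<phi> n + 1) (\<lambda>s'. s' ''v'' k = a \<and> ?I (Suc a) (set_cell ''v'' k (Suc a) s'))"
    proof (rule runs_Seq, rule runs_mono[OF FEx.IH[OF rep w v] order_refl])
      fix s'' assume s'': "same_upto (Suc k) s' s'' \<and> (s'' ''r'' (Suc k) \<noteq> 0 \<longleftrightarrow> sat G t K (Suc k) \<phi> (s' ''v''))"
      show "runs (Write ''r'' (Const k) (Add (Read ''r'' (Const k)) (Read ''r'' (Const (Suc k))))) s'' 1
        (\<lambda>s'. s' ''v'' k = a \<and> ?I (Suc a) (set_cell ''v'' k (Suc a) s'))"
        using s'' I eq by (intro runs_Write) (simp add: same_upto_def less_Suc_eq, blast)
    qed
  qed (simp add: same_upto_def)
  then show ?case by (rule runs_mono) (auto simp: GV)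
qed (simp_all only: compile.simps fm_time.simps,
  (intro runs_Write, simp add: same_upto_def represents_def, (linarith | arith)?)+)

declare upt_Suc [simp del]

section \<open>Derived connectives and blocks of quantifiers\<close>

definition FOr :: "fm \<Rightarrow> fm \<Rightarrow> fm" where "FOr \<phi> \<psi> = FNeg (FAnd (FNeg \<phi>) (FNeg \<psi>))"
definition FImp :: "fm \<Rightarrow> fm \<Rightarrow> fm" where "FImp \<phi> \<psi> = FNeg (FAnd \<phi> (FNeg \<psi>))"
definition FIff :: "fm \<Rightarrow> fm \<Rightarrow> fm" where "FIff \<phi> \<psi> = FAnd (FImp \<phi> \<psi>) (FImp \<psi> \<phi>)"
definition FAll :: "fm \<Rightarrow> fm" where "FAll \<phi> = FNeg (FEx (FNeg \<phi>))"
definition FEq :: "nat \<Rightarrow> nat \<Rightarrow> fm" where "FEq i j = FAnd (FNeg (FLess i j)) (FNeg (FLess j i))"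
definition FConj :: "nat list \<Rightarrow> (nat \<Rightarrow> fm) \<Rightarrow> fm" where "FConj is \<phi> = foldr (\<lambda>i. FAnd (\<phi> i)) is FTrue"
definition FDisj :: "nat list \<Rightarrow> (nat \<Rightarrow> fm) \<Rightarrow> fm" where "FDisj is \<phi> = FNeg (FConj is (\<lambda>i. FNeg (\<phi> i)))"

primrec FExs :: "nat \<Rightarrow> fm \<Rightarrow> fm" where
  "FExs 0 \<phi> = \<phi>"
| "FExs (Suc m) \<phi> = FEx (FExs m \<phi>)"

lemma sat_FConj [simp]: "sat G t K k (FConj is \<phi>) e \<longleftrightarrow> (\<forall>i\<in>set is. sat G t K k (\<phi> i) e)"
  by (induction "is") (simp_all add: FConj_def)

lemma wf_FConj [simp]: "wf_fm k (FConj is \<phi>) \<longleftrightarrow> (\<forall>i\<in>set is. wf_fm k (\<phi> i))"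
  by (induction "is") (simp_all add: FConj_def)

lemma sat_connectives [simp]:
  "sat G t K k (FOr \<phi> \<psi>) e \<longleftrightarrow> sat G t K k \<phi> e \<or> sat G t K k \<psi> e"
  "sat G t K k (FImp \<phi> \<psi>) e \<longleftrightarrow> (sat G t K k \<phi> e \<longrightarrow> sat G t K k \<psi> e)"
  "sat G t K k (FIff \<phi> \<psi>) e \<longleftrightarrow> (sat G t K k \<phi> e \<longleftrightarrow> sat G t K k \<psi> e)"
  "sat G t K k (FAll \<phi>) e \<longleftrightarrow> (\<forall>x\<in>verts G. sat G t K (Suc k) \<phi> (e(k := x)))"
  "sat G t K k (FEq i j) e \<longleftrightarrow> e i = e j"
  "sat G t K k (FDisj is \<chi>) e \<longleftrightarrow> (\<exists>i\<in>set is. sat G t K k (\<chi> i) e)"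
  by (auto simp: FOr_def FImp_def FIff_def FAll_def FEq_def FDisj_def)

lemma wf_connectives [simp]:
  "wf_fm k (FOr \<phi> \<psi>) \<longleftrightarrow> wf_fm k \<phi> \<and> wf_fm k \<psi>"
  "wf_fm k (FImp \<phi> \<psi>) \<longleftrightarrow> wf_fm k \<phi> \<and> wf_fm k \<psi>"
  "wf_fm k (FIff \<phi> \<psi>) \<longleftrightarrow> wf_fm k \<phi> \<and> wf_fm k \<psi>"
  "wf_fm k (FAll \<phi>) \<longleftrightarrow> wf_fm (Suc k) \<phi>"
  "wf_fm k (FEq i j) \<longleftrightarrow> i < k \<and> j < k"
  "wf_fm k (FDisj is \<chi>) \<longleftrightarrow> (\<forall>i\<in>set is. wf_fm k (\<chi> i))"
  by (auto simp: FOr_def FImp_def FIff_def FAll_def FEq_def FDisj_def)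

lemma wf_FExs [simp]: "wf_fm k (FExs m \<phi>) \<longleftrightarrow> wf_fm (k + m) \<phi>"
  by (induction m arbitrary: k) simp_all

lemma sat_FExs:
  "sat G t K k (FExs m \<phi>) e \<longleftrightarrow>
    (\<exists>f. f ` {k..<k + m} \<subseteq> verts G \<and> sat G t K (k + m) \<phi> (\<lambda>i. if i \<in> {k..<k + m} then f i else e i))"
proof (induction m arbitrary: k e)
  case (Suc m)
  let ?P = "\<lambda>f. f ` {k..<k + Suc m} \<subseteq> verts G \<and>
     sat G t K (k + Suc m) \<phi> (\<lambda>i. if i \<in> {k..<k + Suc m} then f i else e i)"
  have eq: "(\<lambda>i. if i \<in> {Suc k..<Suc k + m} then f i else (e(k := x)) i) =
      (\<lambda>i. if i \<in> {k..<k + Suc m} then (f(k := x)) i else e i)" for f x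
    by auto
  have im: "(f(k := x)) ` {k..<k + Suc m} = insert x (f ` {Suc k..<Suc k + m})" for f :: "nat \<Rightarrow> nat" and x
    by (auto simp: image_iff atLeastLessThan_iff Bex_def Suc_le_eq)
  have "sat G t K k (FExs (Suc m) \<phi>) e \<longleftrightarrow> (\<exists>x\<in>verts G. \<exists>f. f ` {Suc k..<Suc k + m} \<subseteq> verts G \<and>
      sat G t K (Suc k + m) \<phi> (\<lambda>i. if i \<in> {Suc k..<Suc k + m} then f i else (e(k := x)) i))"
    by (simp only: FExs.simps sat.simps Suc.IH)
  also have "\<dots> \<longleftrightarrow> (\<exists>x f. ?P (f(k := x)))"
    unfolding eq im by auto
  also have "\<dots> \<longleftrightarrow> (\<exists>f. ?P f)"
  proof
    assume "\<exists>f. ?P f"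
    then obtain f where "?P f" ..
    then have "?P (f(k := f k))" unfolding fun_upd_triv .
    then show "\<exists>x f. ?P (f(k := x))" by blast
  qed blast
  finally show ?case .
qed simp

section \<open>The reduction rule as a formula\<close>

definition in_A :: "nat \<Rightarrow> nat \<Rightarrow> fm" where
  "in_A a j = FDisj [1..<Suc a] (\<lambda>i. FEq i j)"

text \<open>The argument \<open>b\<close> is the level at which the formula is used, hence also the
  number of its bound variable.\<close>

definition zone_fm :: "nat \<Rightarrow> nat \<Rightarrow> nat \<Rightarrow> nat \<Rightarrow> fm" where
  "zone_fm a b c s = FOr (FEq c s) (FAnd (FCand s) (FAnd (FNeg (in_A a s))
     (FEx (FAnd (FAdj c b) (FAnd (FNeg (in_A a b)) (FAdj b s))))))"

text \<open>The free variables are \<open>u\<close> (variable \<open>0\<close>), an enumeration of \<open>A\<close> (variables \<open>1, \<dots>, a\<close>) and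
  an enumeration of \<open>C\<close> (variables \<open>a + 1, \<dots>, a + m\<close>).\<close>

definition exchange_fm :: "nat \<Rightarrow> nat \<Rightarrow> fm" where
  "exchange_fm a m = (let N = Suc a + m; A = [1..<Suc a]; C = [Suc a..<N] in
     FAnd (FConj C (\<lambda>c. FAnd (FCand c) (FNeg (FEq 0 c))))
    (FAnd (FConj C (\<lambda>c. FConj [Suc c..<N] (\<lambda>c'. FAnd (FNeg (FEq c c'))
            (FAll (FNeg (FAnd (zone_fm a (Suc N) c N) (zone_fm a (Suc N) c' N)))))))
    (FAnd (FConj C (\<lambda>c. FConj A (\<lambda>y. FIff (FAdj c y) (FAdj 0 y))))
    (FAnd (FConj C (\<lambda>c. FAll (FImp (zone_fm a (Suc N) c N) (FDisj A (\<lambda>y. FAdj y N)))))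
         (FConj C (\<lambda>c. FAll (FImp (FAnd (FAdj c N) (FNeg (in_A a N)))
            (FEx (FAnd (FAnd (FAdj 0 (Suc N)) (FNeg (in_A a (Suc N)))) (FAnd (FLe (Suc N) N)
              (FConj A (\<lambda>y. FImp (FAnd (FAdj N y) (FCand y)) (FAdj (Suc N) y))))))))))))) "

definition reducible_fm :: "nat \<Rightarrow> nat \<Rightarrow> fm" where
  "reducible_fm a m = FOr (FEx (FAnd (FAdj 0 1) (FOne 1))) (FExs (a + m) (exchange_fm a m))"

lemma wf_in_A: "j < k \<Longrightarrow> a < k \<Longrightarrow> wf_fm k (in_A a j)"
  by (simp add: in_A_def)

lemma wf_zone_fm: "c < b \<Longrightarrow> s < b \<Longrightarrow> a < b \<Longrightarrow> wf_fm b (zone_fm a b c s)"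
  by (simp add: zone_fm_def wf_in_A)

lemma wf_reducible_fm: "wf_fm 1 (reducible_fm a m)"
  by (simp add: reducible_fm_def exchange_fm_def Let_def wf_zone_fm wf_in_A)

lemma sat_in_A [simp]: "sat G t K k (in_A a j) e \<longleftrightarrow> e j \<in> e ` {1..<Suc a}"
  unfolding in_A_def sat_connectives set_upt image_iff by (rule bex_cong) auto

lemma adj_iff: "x \<in> verts G \<Longrightarrow> {y, x} \<in> edges G \<longleftrightarrow> x \<in> nbrs G y"
  by (simp add: nbrs_def insert_commute)

lemma sat_zone_fm:
  assumes "c < b" "s < b" "a < b" "e s \<in> verts G"
  shows "sat G t K b (zone_fm a b c s) e \<longleftrightarrow> e s \<in> zone G K (e ` {1..<Suc a}) (e c)"
proof -
  have A: "e(b := x) ` {1..<Suc a} = e ` {1..<Suc a}" for x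
    using assms(3) by (simp add: fun_upd_image)
  have "sat G t K b (zone_fm a b c s) e \<longleftrightarrow> e c = e s \<or> e s \<in> K \<and> e s \<notin> e ` {1..<Suc a} \<and>
      (\<exists>x\<in>verts G. {e c, x} \<in> edges G \<and> x \<notin> e ` {1..<Suc a} \<and> {x, e s} \<in> edges G)"
    using assms(1-3) A by (simp add: zone_fm_def del: fun_upd_image)
  also have "\<dots> \<longleftrightarrow> e s \<in> zone G K (e ` {1..<Suc a}) (e c)"
    using assms(4) nbrs_subset[of G "e c"] by (auto simp: zone_def adj_iff)
  finally show ?thesis .
qed

lemma sat_exchange_fm:
  assumes e: "\<And>i. i < Suc a + m \<Longrightarrow> e i \<in> verts G" and K: "K \<subseteq> verts G"
  defines "A \<equiv> e ` {1..<Suc a}" and "C \<equiv> e ` {Suc a..<Suc a + m}"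
  shows "sat G t K (Suc a + m) (exchange_fm a m) e \<longleftrightarrow>
    inj_on e {Suc a..<Suc a + m} \<and> C \<subseteq> K - {e 0} \<and> exchangeable G t K A C (e 0)"
proof -
  define N where "N = Suc a + m"
  have aN: "Suc a \<le> N" by (simp add: N_def)
  have A1: "e(N := x) ` {1..<Suc a} = A" "e(N := x, Suc N := y) ` {1..<Suc a} = A" for x y
    using aN by (simp_all add: fun_upd_image A_def)
  have idx: "i < N" if "i \<in> {1..<Suc a}" for i using that aN by auto
  have ne: "i \<noteq> N" "i \<noteq> Suc N" if "i \<in> {1..<Suc a} \<or> i \<in> {Suc a..<N}" for i
    using that aN by auto
  have z: "sat G t K (Suc N) (zone_fm a (Suc N) c N) (e(N := x)) \<longleftrightarrow> x \<in> zone G K A (e c)"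
    if "c < N" "x \<in> verts G" for c x
    using sat_zone_fm[of c "Suc N" N a "e(N := x)" G t K] that aN A1 by simp
  have zV: "zone G K A (e c) \<subseteq> verts G" if "c < N" for c
    using K e that by (auto simp: zone_def N_def)
  have 1: "(\<forall>c\<in>{Suc a..<N}. e c \<in> K \<and> e 0 \<noteq> e c) \<longleftrightarrow> C \<subseteq> K - {e 0}"
    by (auto simp: C_def N_def)
  \<comment> \<open>By symmetry only pairs \<open>c < c'\<close> are tested. Distinctness of the
    values makes the enumeration of \<open>C\<close> injective, which pins down
    \<open>card C\<close>.\<close>
  have 2: "(\<forall>c\<in>{Suc a..<N}. \<forall>c'\<in>{Suc c..<N}. e c \<noteq> e c' \<and>
        (\<forall>x\<in>verts G. \<not> (x \<in> zone G K A (e c) \<and> x \<in> zone G K A (e c')))) \<longleftrightarrow>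
      inj_on e {Suc a..<N} \<and> (\<forall>c\<in>C. \<forall>c'\<in>C. c \<noteq> c' \<longrightarrow> zone G K A c \<inter> zone G K A c' = {})"
    (is "?L \<longleftrightarrow> ?R")
  proof
    assume L: ?L
    have lt: "e c \<noteq> e c' \<and> zone G K A (e c) \<inter> zone G K A (e c') = {}"
      if "c \<in> {Suc a..<N}" "c' \<in> {Suc a..<N}" "c < c'" for c c'
    proof -
      have "c' \<in> {Suc c..<N}" using that by simp
      then have "e c \<noteq> e c'" "\<forall>x\<in>verts G. \<not> (x \<in> zone G K A (e c) \<and> x \<in> zone G K A (e c'))"
        using L that(1) by blast+
      then show ?thesis using zV[of c] that by auto
    qed
    have "inj_on e {Suc a..<N}"
    proof (rule inj_onI)
      fix c c' assume "c \<in> {Suc a..<N}" "c' \<in> {Suc a..<N}" "e c = e c'"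
      then show "c = c'" using lt[of c c'] lt[of c' c] by (cases c c' rule: linorder_cases) auto
    qed
    moreover have "zone G K A (e c) \<inter> zone G K A (e c') = {}"
      if "c \<in> {Suc a..<N}" "c' \<in> {Suc a..<N}" "e c \<noteq> e c'" for c c'
      using lt[of c c'] lt[of c' c] that by (cases c c' rule: linorder_cases) auto
    ultimately show ?R unfolding C_def N_def[symmetric] by blast
  next
    assume R: ?R
    show ?L
    proof (intro ballI)
      fix c c' assume c: "c \<in> {Suc a..<N}" "c' \<in> {Suc c..<N}"
      then have c': "c' \<in> {Suc a..<N}" by simp
      then have ne: "e c \<noteq> e c'" using R c inj_onD[of e "{Suc a..<N}" c c'] by auto
      moreover have "e c \<in> C" "e c' \<in> C" using c(1) c' by (auto simp: C_def N_def)
      ultimately have "zone G K A (e c) \<inter> zone G K A (e c') = {}" using R by blast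
      then show "e c \<noteq> e c' \<and> (\<forall>x\<in>verts G. \<not> (x \<in> zone G K A (e c) \<and> x \<in> zone G K A (e c')))"
        using ne by blast
    qed
  qed
  have 3: "(\<forall>c\<in>{Suc a..<N}. \<forall>y\<in>{1..<Suc a}. ({e c, e y} \<in> edges G) = ({e 0, e y} \<in> edges G)) \<longleftrightarrow>
      (\<forall>c\<in>C. nbrs G c \<inter> A = nbrs G (e 0) \<inter> A)"
  proof -
    have "({e c, e y} \<in> edges G) = (e y \<in> nbrs G (e c))" if "y \<in> {1..<Suc a}" for c y
      using e idx[OF that] by (intro adj_iff) (simp add: N_def)
    moreover have "(\<forall>y\<in>{1..<Suc a}. (e y \<in> nbrs G u) = (e y \<in> nbrs G v)) \<longleftrightarrow> nbrs G u \<inter> A = nbrs G v \<inter> A" for u v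
      unfolding A_def by blast
    ultimately show ?thesis unfolding C_def N_def[symmetric] by simp
  qed
  have 4: "(\<forall>c\<in>{Suc a..<N}. \<forall>x\<in>verts G. x \<in> zone G K A (e c) \<longrightarrow> (\<exists>y\<in>{1..<Suc a}. {e y, x} \<in> edges G)) \<longleftrightarrow>
      (\<forall>c\<in>C. \<forall>s\<in>zone G K A c. \<exists>y\<in>A. s \<in> nbrs G y)"
  proof -
    have "(\<forall>x\<in>verts G. x \<in> zone G K A (e c) \<longrightarrow> (\<exists>y\<in>{1..<Suc a}. {e y, x} \<in> edges G)) \<longleftrightarrow>
        (\<forall>s\<in>zone G K A (e c). \<exists>y\<in>A. s \<in> nbrs G y)" if "c \<in> {Suc a..<N}" for c
      using zV[of c] that by (auto simp: A_def adj_iff)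
    then show ?thesis unfolding C_def N_def[symmetric] by simp
  qed
  have 5: "(\<forall>c\<in>{Suc a..<N}. \<forall>x\<in>verts G. {e c, x} \<in> edges G \<and> x \<notin> A \<longrightarrow>
        (\<exists>x'\<in>verts G. ({e 0, x'} \<in> edges G \<and> x' \<notin> A) \<and> t x' \<le> t x \<and>
           (\<forall>y\<in>{1..<Suc a}. {x, e y} \<in> edges G \<and> e y \<in> K \<longrightarrow> {x', e y} \<in> edges G))) \<longleftrightarrow>
      (\<forall>c\<in>C. \<forall>x\<in>nbrs G c - A. \<exists>x'\<in>nbrs G (e 0) - A. nbrs G x \<inter> A \<inter> K \<subseteq> nbrs G x' \<and> t x' \<le> t x)"
  proof -
    have y: "({x, e y} \<in> edges G) = (e y \<in> nbrs G x)" if "y \<in> {1..<Suc a}" for x y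
      using e idx[OF that] by (intro adj_iff) (simp add: N_def)
    have "(\<forall>y\<in>{1..<Suc a}. {x, e y} \<in> edges G \<and> e y \<in> K \<longrightarrow> {x', e y} \<in> edges G) \<longleftrightarrow>
        nbrs G x \<inter> A \<inter> K \<subseteq> nbrs G x'" for x x'
      using y by (auto simp: A_def)
    moreover have "(\<exists>x'\<in>verts G. {e 0, x'} \<in> edges G \<and> x' \<notin> A \<and> P x') \<longleftrightarrow> (\<exists>x'\<in>nbrs G (e 0) - A. P x')" for P
      using nbrs_subset[of G "e 0"] by (auto simp: adj_iff)
    moreover have "(\<forall>x\<in>verts G. {e c, x} \<in> edges G \<and> x \<notin> A \<longrightarrow> P x) \<longleftrightarrow> (\<forall>x\<in>nbrs G (e c) - A. P x)" for P c
      using nbrs_subset[of G "e c"] by (auto simp: adj_iff)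
    ultimately show ?thesis unfolding C_def N_def[symmetric] by (simp add: conj_commute[of "t _ \<le> t _"])
  qed
  have "sat G t K N (exchange_fm a m) e \<longleftrightarrow>
    (\<forall>c\<in>{Suc a..<N}. e c \<in> K \<and> e 0 \<noteq> e c) \<and>
    (\<forall>c\<in>{Suc a..<N}. \<forall>c'\<in>{Suc c..<N}. e c \<noteq> e c' \<and>
        (\<forall>x\<in>verts G. \<not> (x \<in> zone G K A (e c) \<and> x \<in> zone G K A (e c')))) \<and>
    (\<forall>c\<in>{Suc a..<N}. \<forall>y\<in>{1..<Suc a}. ({e c, e y} \<in> edges G) = ({e 0, e y} \<in> edges G)) \<and>
    (\<forall>c\<in>{Suc a..<N}. \<forall>x\<in>verts G. x \<in> zone G K A (e c) \<longrightarrow> (\<exists>y\<in>{1..<Suc a}. {e y, x} \<in> edges G)) \<and>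
    (\<forall>c\<in>{Suc a..<N}. \<forall>x\<in>verts G. {e c, x} \<in> edges G \<and> x \<notin> A \<longrightarrow>
        (\<exists>x'\<in>verts G. ({e 0, x'} \<in> edges G \<and> x' \<notin> A) \<and> t x' \<le> t x \<and>
           (\<forall>y\<in>{1..<Suc a}. {x, e y} \<in> edges G \<and> e y \<in> K \<longrightarrow> {x', e y} \<in> edges G)))"
    unfolding exchange_fm_def Let_def N_def[symmetric]
    using z A1 aN by (simp add: Ball_def Bex_def del: fun_upd_image cong: conj_cong)
  then show ?thesis unfolding 1 2 3 4 5 N_def[symmetric] exchangeable_def by blast
qed

lemma sat_reducible_fm:
  assumes fin: "finite (verts G)" and K: "K \<subseteq> verts G" and e: "e 0 \<in> K" and m: "1 \<le> m"
  shows "sat G t K 1 (reducible_fm a m) e \<longleftrightarrow> reducible a m G t K (e 0)"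
proof -
  let ?N = "Suc a + m"
  let ?env = "\<lambda>f i. if i \<in> {1..<1 + (a + m)} then f i else e i"
  have 1: "sat G t K 1 (FEx (FAnd (FAdj 0 1) (FOne 1))) e \<longleftrightarrow> (\<exists>x\<in>nbrs G (e 0). t x \<le> 1)"
    using nbrs_subset[of G "e 0"] by (auto simp: adj_iff)
  have env: "?env f i \<in> verts G" if "f ` {1..<1 + (a + m)} \<subseteq> verts G" "i < ?N" for f i
    using that e K by (cases "i = 0") auto
  have sat_ex: "sat G t K ?N (exchange_fm a m) (?env f) \<longleftrightarrow> inj_on (?env f) {Suc a..<?N} \<and>
      ?env f ` {Suc a..<?N} \<subseteq> K - {?env f 0} \<and>
      exchangeable G t K (?env f ` {1..<Suc a}) (?env f ` {Suc a..<?N}) (?env f 0)"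
    if "f ` {1..<1 + (a + m)} \<subseteq> verts G" for f
    by (rule sat_exchange_fm[OF _ K]) (rule env[OF that])
  have 2: "sat G t K 1 (FExs (a + m) (exchange_fm a m)) e \<longleftrightarrow>
      (\<exists>A C. A \<subseteq> verts G \<and> card A \<le> a \<and> C \<subseteq> K - {e 0} \<and> card C = m \<and> exchangeable G t K A C (e 0))"
  proof
    assume "sat G t K 1 (FExs (a + m) (exchange_fm a m)) e"
    then obtain f where f: "f ` {1..<1 + (a + m)} \<subseteq> verts G" "sat G t K (1 + (a + m)) (exchange_fm a m) (?env f)"
      unfolding sat_FExs by blast
    define A C where "A = ?env f ` {1..<Suc a}" and "C = ?env f ` {Suc a..<?N}"
    have "sat G t K ?N (exchange_fm a m) (?env f)" using f(2) by simp
    then have *: "inj_on (?env f) {Suc a..<?N}" "C \<subseteq> K - {?env f 0}" "exchangeable G t K A C (?env f 0)"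
      unfolding sat_ex[OF f(1)] A_def C_def by blast+
    have "card C = m" using card_image[OF *(1)] by (simp add: C_def)
    moreover have "card A \<le> a" unfolding A_def using card_image_le[of "{1..<Suc a}" "?env f"] by simp
    moreover have "A \<subseteq> verts G" unfolding A_def using f(1) by auto
    moreover have "?env f 0 = e 0" by simp
    ultimately show "\<exists>A C. A \<subseteq> verts G \<and> card A \<le> a \<and> C \<subseteq> K - {e 0} \<and> card C = m \<and> exchangeable G t K A C (e 0)"
      using *(2,3) by metis
  next
    assume "\<exists>A C. A \<subseteq> verts G \<and> card A \<le> a \<and> C \<subseteq> K - {e 0} \<and> card C = m \<and> exchangeable G t K A C (e 0)"
    then obtain A C where A: "A \<subseteq> verts G" "card A \<le> a" and C: "C \<subseteq> K - {e 0}" "card C = m"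
      and ex: "exchangeable G t K A C (e 0)" by blast
    have finA: "finite A" by (rule finite_subset[OF A(1) fin])
    have finC: "finite C" using C(1) K by (intro finite_subset[OF _ fin]) auto
    \<comment> \<open>An enumeration of \<open>A\<close> by exactly \<open>a\<close> variables needs
      an element to repeat. There is one: \<open>C\<close> is nonempty because
      \<open>1 \<le> m\<close>, and its members lie in their own zones, which must be adjacent to
      \<open>A\<close>.\<close>
    have "A \<noteq> {}"
    proof -
      have "C \<noteq> {}" using C(2) m by auto
      then obtain c where "c \<in> C" by blast
      moreover have "c \<in> zone G K A c" by (simp add: zone_def)
      ultimately show ?thesis using ex unfolding exchangeable_def by blast
    qed
    then have cA: "0 < card A" using finA by (simp add: card_gt_0_iff)
    obtain g where g: "bij_betw g {0..<card A} A" using ex_bij_betw_nat_finite[OF finA] by blast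
    obtain h where h: "bij_betw h {0..<m} C" using ex_bij_betw_nat_finite[OF finC] C(2) by blast
    \<comment> \<open>Variables beyond \<open>card A\<close> repeat the last element of
      \<open>A\<close>, since only \<open>card A \<le> a\<close> is known; \<open>C\<close> is
      enumerated without repetition.\<close>
    define f where "f i = (if i < Suc a then g (min (i - 1) (card A - 1)) else h (i - Suc a))" for i
    have fA: "f ` {1..<Suc a} = A"
    proof
      show "f ` {1..<Suc a} \<subseteq> A"
        using bij_betw_apply[OF g] cA by (auto simp: f_def)
      show "A \<subseteq> f ` {1..<Suc a}"
      proof
        fix y assume "y \<in> A"
        then have "y \<in> g ` {0..<card A}" using g by (simp add: bij_betw_def)
        then obtain j where j: "j < card A" "y = g j" by auto
        then have "f (Suc j) = y" "Suc j \<in> {1..<Suc a}" using A(2) by (auto simp: f_def min_def)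
        then show "y \<in> f ` {1..<Suc a}" by blast
      qed
    qed
    have shift: "bij_betw (\<lambda>i. i - Suc a) {Suc a..<?N} {0..<m}"
      by (rule bij_betw_byWitness[where f' = "\<lambda>i. i + Suc a"]) auto
    have fC: "bij_betw f {Suc a..<?N} C"
      using bij_betw_trans[OF shift h] by (rule bij_betw_cong[THEN iffD1, rotated]) (auto simp: f_def)
    have eA: "?env f ` {1..<Suc a} = A" unfolding fA[symmetric] by (rule image_cong) auto
    have eC: "bij_betw (?env f) {Suc a..<?N} C"
      using fC by (rule bij_betw_cong[THEN iffD1, rotated]) auto
    have sub: "f ` {1..<1 + (a + m)} \<subseteq> verts G"
    proof
      fix y assume "y \<in> f ` {1..<1 + (a + m)}"
      then obtain i where i: "i \<in> {1..<1 + (a + m)}" "y = f i" by blast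
      then have "i \<in> {1..<Suc a} \<or> i \<in> {Suc a..<?N}" by auto
      then have "y \<in> A \<union> C" using i(2) fA fC by (auto simp: bij_betw_def)
      then show "y \<in> verts G" using A(1) C(1) K by blast
    qed
    have "sat G t K ?N (exchange_fm a m) (?env f)"
      unfolding sat_ex[OF sub] eA bij_betw_imp_surj_on[OF eC]
      using bij_betw_imp_inj_on[OF eC] C(1) ex by simp
    then show "sat G t K 1 (FExs (a + m) (exchange_fm a m)) e"
      unfolding sat_FExs using sub by (intro exI[of _ f]) simp
  qed
  show ?thesis unfolding reducible_fm_def reducible_def sat_connectives 1 2 ..
qed

section \<open>The vertices of the kernel as a formula\<close>

definition kept_fm :: fm where
  "kept_fm = FOr (FCand 0) (FAnd (FEx (FAnd (FCand 1) (FAdj 0 1)))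
     (FNeg (FEx (FAnd (FNeg (FCand 1)) (FAnd (FAll (FImp (FCand 2) (FIff (FAdj 1 2) (FAdj 0 2))))
        (FOr (FNeg (FLe 0 1)) (FAnd (FLe 1 0) (FLess 1 0))))))))"

lemma wf_kept_fm: "wf_fm 1 kept_fm"
  by (simp add: kept_fm_def)

lemma sat_kept_fm:
  assumes K: "K \<subseteq> verts G" and e: "e 0 \<in> verts G"
  shows "sat G t K 1 kept_fm e \<longleftrightarrow> e 0 \<in> kept G t K"
proof -
  have 1: "(\<exists>x\<in>verts G. x \<in> K \<and> {e 0, x} \<in> edges G) \<longleftrightarrow> nbrs G (e 0) \<inter> K \<noteq> {}"
    using K by (auto simp: adj_iff nbrs_def insert_commute)
  have 2: "(\<forall>x\<in>verts G. x \<in> K \<longrightarrow> ({w, x} \<in> edges G) = ({e 0, x} \<in> edges G)) \<longleftrightarrow>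
      nbrs G w \<inter> K = nbrs G (e 0) \<inter> K" for w
  proof -
    have "(\<forall>x\<in>verts G. x \<in> K \<longrightarrow> ({w, x} \<in> edges G) = ({e 0, x} \<in> edges G)) \<longleftrightarrow>
        (\<forall>x\<in>K. (x \<in> nbrs G w) = (x \<in> nbrs G (e 0)))"
      using K by (auto simp: adj_iff)
    also have "\<dots> \<longleftrightarrow> nbrs G w \<inter> K = nbrs G (e 0) \<inter> K" by blast
    finally show ?thesis .
  qed
  have 3: "\<not> t (e 0) \<le> t w \<or> t w \<le> t (e 0) \<and> w < e 0 \<longleftrightarrow> t w < t (e 0) \<or> t w = t (e 0) \<and> w < e 0" for w
    by auto
  have "sat G t K 1 kept_fm e \<longleftrightarrow> e 0 \<in> K \<or> (\<exists>x\<in>verts G. x \<in> K \<and> {e 0, x} \<in> edges G) \<and>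
     \<not> (\<exists>w\<in>verts G. w \<notin> K \<and> (\<forall>x\<in>verts G. x \<in> K \<longrightarrow> ({w, x} \<in> edges G) = ({e 0, x} \<in> edges G)) \<and>
       (\<not> t (e 0) \<le> t w \<or> t w \<le> t (e 0) \<and> w < e 0))"
    by (simp add: kept_fm_def numeral_2_eq_2)
  then show ?thesis unfolding 1 2 3 using e by (auto simp: kept_def)
qed

section \<open>The kernelization program\<close>

definition emit :: "expr \<Rightarrow> prog" where
  "emit e = Seq (Write ''out'' (Read ''outlen'' (Const 0)) e)
     (Write ''outlen'' (Const 0) (Add (Read ''outlen'' (Const 0)) (Const 1)))"

text \<open>Such relations compose by concatenating the emitted lists, so the output of a nest of
  loops is a list expression of the same shape as the program. Loop variables below \<open>k\<close>
  are protected, those of inner loops are not.\<close>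

definition emits :: "nat \<Rightarrow> store \<Rightarrow> nat list \<Rightarrow> store \<Rightarrow> bool" where
  "emits k s l s' \<longleftrightarrow> (\<forall>x. x \<noteq> ''v'' \<and> x \<noteq> ''out'' \<and> x \<noteq> ''outlen'' \<longrightarrow> s' x = s x) \<and>
     (\<forall>i<k. s' ''v'' i = s ''v'' i) \<and> result s' = result s @ l"

lemma emits_refl: "emits k s [] s"
  by (simp add: emits_def)

lemma emits_trans: "emits k s l s' \<Longrightarrow> emits k s' l' s'' \<Longrightarrow> emits k s (l @ l') s''"
  by (simp add: emits_def)

lemma emits_array: "emits k s l s' \<Longrightarrow> x \<noteq> ''v'' \<Longrightarrow> x \<noteq> ''out'' \<Longrightarrow> x \<noteq> ''outlen'' \<Longrightarrow> s' x = s x"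
  by (simp add: emits_def)

lemma emits_var: "emits k s l s' \<Longrightarrow> i < k \<Longrightarrow> s' ''v'' i = s ''v'' i"
  by (simp add: emits_def)

lemma runs_emit:
  assumes "e = eval_expr ex s"
  shows "runs (emit ex) s 2 (emits k s [e])"
proof -
  have "runs (emit ex) s (1 + 1) (emits k s [e])"
    unfolding emit_def
  proof (intro runs_Seq runs_Write)
    let ?s = "set_cell ''out'' (s ''outlen'' 0) e s"
    have "map ((s ''out'')(s ''outlen'' 0 := e)) [0..<s ''outlen'' 0] = map (s ''out'') [0..<s ''outlen'' 0]"
      by (rule map_cong) auto
    then show "emits k s [e] (set_cell ''outlen'' (eval_expr (Const 0)
          (set_cell ''out'' (eval_expr (Read ''outlen'' (Const 0)) s) (eval_expr ex s) s))
        (eval_expr (Add (Read ''outlen'' (Const 0)) (Const 1))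
          (set_cell ''out'' (eval_expr (Read ''outlen'' (Const 0)) s) (eval_expr ex s) s))
        (set_cell ''out'' (eval_expr (Read ''outlen'' (Const 0)) s) (eval_expr ex s) s))"
      using assms by (simp add: emits_def result_def upt_Suc)
  qed
  then show ?thesis by (simp add: numeral_2_eq_2)
qed

lemma runs_emits_Seq:
  assumes "runs c s T (emits k s l)" "\<And>s'. emits k s l s' \<Longrightarrow> runs c' s' T' (emits k s' l')"
  shows "runs (Seq c c') s (T + T') (emits k s (l @ l'))"
proof (rule runs_Seq, rule runs_mono[OF assms(1) order_refl])
  fix s' assume s': "emits k s l s'"
  show "runs c' s' T' (emits k s (l @ l'))"
    by (rule runs_mono[OF assms(2)[OF s'] order_refl]) (rule emits_trans[OF s'])
qed

lemma runs_emits_For: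
  assumes n: "s ''n'' 0 = n"
    and body: "\<And>a l s'. a < n \<Longrightarrow> emits k s l s' \<Longrightarrow> s' ''v'' k = a \<Longrightarrow> runs c s' T (emits (Suc k) s' (g a))"
  shows "runs (For ''v'' k c) s (n * (T + 2) + 2) (emits k s (concat (map g [0..<n])))"
proof (rule runs_mono)
  let ?I = "\<lambda>a s'. emits k s (concat (map g [0..<a])) s' \<and> s' ''v'' k = a"
  show "runs (For ''v'' k c) s (n * (T + 2) + 2) (?I n)"
  proof (rule runs_For)
    show "?I 0 (set_cell ''v'' k 0 s)" by (simp add: emits_def result_def)
    show "s' ''n'' 0 = n \<and> s' ''v'' k = a" if "?I a s'" for a s'
      using that n emits_array[of k s _ s' "''n''"] by auto
    fix a s' assume a: "a < n" and I: "?I a s'"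
    show "runs c s' T (\<lambda>s'. s' ''v'' k = a \<and> ?I (Suc a) (set_cell ''v'' k (Suc a) s'))"
    proof (rule runs_mono[OF body[OF a] order_refl])
      show "emits k s (concat (map g [0..<a])) s'" "s' ''v'' k = a" using I by auto
      fix s'' assume e: "emits (Suc k) s' (g a) s''"
      have "s'' ''v'' k = a" using emits_var[OF e, of k] I by simp
      moreover have "emits k s' (g a) (set_cell ''v'' k (Suc a) s'')"
        using e by (simp add: emits_def result_def)
      then have "emits k s (concat (map g [0..<a]) @ g a) (set_cell ''v'' k (Suc a) s'')"
        using I by (blast intro: emits_trans)
      ultimately show "s'' ''v'' k = a \<and> ?I (Suc a) (set_cell ''v'' k (Suc a) s'')"
        by (simp add: upt_Suc)
    qed
  qed
qed auto

abbreviation Kept :: "expr \<Rightarrow> expr" where "Kept e \<equiv> Read ''keep'' e"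

abbreviation InK :: "expr \<Rightarrow> expr" where "InK e \<equiv> Read ''K'' e"

definition emit_thresholds :: prog where
  "emit_thresholds = For ''v'' 0 (Cond (Kept (Var 0)) (emit (Thr (Var 0))) Skip)"

definition emit_candidates :: prog where
  "emit_candidates = For ''v'' 0 (Cond (Kept (Var 0)) (emit (InK (Var 0))) Skip)"

definition emit_row :: prog where
  "emit_row = For ''v'' (Suc 0) (Cond (Kept (Var 1))
     (Cond (Add (InK (Var 0)) (InK (Var 1))) (emit (Entry (Var 0) (Var 1))) (emit (Const 0))) Skip)"

definition emit_matrix :: prog where
  "emit_matrix = For ''v'' 0 (Cond (Kept (Var 0)) emit_row Skip)"

definition emit_all :: prog where
  "emit_all = Seq (emit (Read ''in'' (Const 0))) (Seq (emit (Read ''num'' (Const 0)))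
    (Seq emit_thresholds (Seq emit_candidates emit_matrix)))"

definition row_time :: "nat \<Rightarrow> nat" where
  "row_time n = n * (((2 + 1) + 1) + 2) + 2"

definition emit_time :: "nat \<Rightarrow> nat" where
  "emit_time n = 2 + (2 + ((n * ((2 + 1) + 2) + 2) + ((n * ((2 + 1) + 2) + 2) +
     (n * ((row_time n + 1) + 2) + 2))))"

lemma concat_filter:
  "concat (map (\<lambda>a. if P a then g a else []) xs) = concat (map g (filter P xs))"
  by (induction xs) simp_all

lemma runs_emits_Cond:
  assumes "eval_expr b s \<noteq> 0 \<Longrightarrow> runs c s T (emits k s l)" "eval_expr b s \<noteq> 0 \<longleftrightarrow> P" "1 \<le> T"
  shows "runs (Cond b c Skip) s (T + 1) (emits k s (if P then l else []))"
proof (rule runs_Cond)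
  assume "eval_expr b s = 0"
  then show "runs Skip s T (emits k s (if P then l else []))"
    using assms(2) by (intro runs_mono[OF runs_Skip[of "emits k s []"] assms(3)] emits_refl) simp
qed (use assms in simp)

lemma runs_emit_all:
  assumes rep: "represents s n G t K"
    and keep: "\<And>i. i < n \<Longrightarrow> s ''keep'' i = of_bool (i \<in> kept G t K)"
    and num: "s ''num'' 0 = length (filter (\<lambda>i. i \<in> kept G t K) [0..<n])"
  shows "runs emit_all s (emit_time n)
    (emits 0 s (encode_annotated_bhs (filter (\<lambda>i. i \<in> kept G t K) [0..<n]) (kernel_graph G t K) t (s ''in'' 0) K))"
proof -
  let ?P = "\<lambda>i. i \<in> kept G t K"
  let ?vs = "filter ?P [0..<n]"
  have n: "s ''n'' 0 = n" using rep by (simp add: represents_def)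
  let ?A = "\<lambda>u v. of_bool ({u, v} \<in> edges (kernel_graph G t K)) :: nat"
  have thr: "runs emit_thresholds s1 (n * ((2 + 1) + 2) + 2)
      (emits 0 s1 (map t ?vs))" if s1: "emits 0 s l s1" for s1 l
    unfolding emit_thresholds_def
  proof (rule runs_mono[OF runs_emits_For[where g = "\<lambda>a. if ?P a then [t a] else []"] order_refl])
    show "s1 ''n'' 0 = n" using emits_array[OF s1, of "''n''"] n by simp
    fix a l' s2 assume a: "a < n" and s2: "emits 0 s1 l' s2" "s2 ''v'' 0 = a"
    have arr: "s2 x = s x" if "x \<noteq> ''v''" "x \<noteq> ''out''" "x \<noteq> ''outlen''" for x
      using emits_array[OF s1 that] emits_array[OF s2(1) that] by simp
    show "runs (Cond (Kept (Var 0)) (emit (Thr (Var 0))) Skip) s2 (2 + 1) (emits (Suc 0) s2 (if ?P a then [t a] else []))"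
      using arr[of "''keep''"] arr[of "''in''"] keep[OF a] rep a s2(2)
      by (intro runs_emits_Cond runs_emit) (simp_all add: represents_def)
  qed (simp add: concat_filter)
  have cand: "runs emit_candidates s1 (n * ((2 + 1) + 2) + 2)
      (emits 0 s1 (map (\<lambda>v. of_bool (v \<in> K)) ?vs))" if s1: "emits 0 s l s1" for s1 l
    unfolding emit_candidates_def
  proof (rule runs_mono[OF runs_emits_For[where g = "\<lambda>a. if ?P a then [of_bool (a \<in> K)] else []"] order_refl])
    show "s1 ''n'' 0 = n" using emits_array[OF s1, of "''n''"] n by simp
    fix a l' s2 assume a: "a < n" and s2: "emits 0 s1 l' s2" "s2 ''v'' 0 = a"
    have arr: "s2 x = s x" if "x \<noteq> ''v''" "x \<noteq> ''out''" "x \<noteq> ''outlen''" for x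
      using emits_array[OF s1 that] emits_array[OF s2(1) that] by simp
    show "runs (Cond (Kept (Var 0)) (emit (InK (Var 0))) Skip) s2 (2 + 1)
        (emits (Suc 0) s2 (if ?P a then [of_bool (a \<in> K)] else []))"
      using arr[of "''keep''"] arr[of "''K''"] keep[OF a] rep a s2(2)
      by (intro runs_emits_Cond runs_emit) (simp_all add: represents_def)
  qed (simp add: concat_filter)
  have matrix: "runs emit_matrix s1 (n * ((row_time n + 1) + 2) + 2)
      (emits 0 s1 (adjacency_matrix ?vs (kernel_graph G t K)))" if s1: "emits 0 s l s1" for s1 l
    unfolding emit_matrix_def
  proof (rule runs_mono[OF runs_emits_For[where g =
        "\<lambda>u. if ?P u then concat (map (\<lambda>v. if ?P v then [?A u v] else []) [0..<n]) else []"] order_refl])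
    show n1: "s1 ''n'' 0 = n" using emits_array[OF s1, of "''n''"] n by simp
    fix u l' s2 assume u: "u < n" and s2: "emits 0 s1 l' s2" "s2 ''v'' 0 = u"
    have arr: "s2 x = s x" if "x \<noteq> ''v''" "x \<noteq> ''out''" "x \<noteq> ''outlen''" for x
      using emits_array[OF s1 that] emits_array[OF s2(1) that] by simp
    show "runs (Cond (Kept (Var 0)) emit_row Skip)
        s2 (row_time n + 1)
        (emits (Suc 0) s2 (if ?P u then concat (map (\<lambda>v. if ?P v then [?A u v] else []) [0..<n]) else []))"
    proof (rule runs_emits_Cond)
      show "eval_expr (Kept (Var 0)) s2 \<noteq> 0 \<longleftrightarrow> ?P u" using arr[of "''keep''"] keep[OF u] s2(2) by simp
      assume "eval_expr (Kept (Var 0)) s2 \<noteq> 0"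
      then have Pu: "?P u" using arr[of "''keep''"] keep[OF u] s2(2) by simp
      show "runs emit_row s2 (row_time n)
          (emits (Suc 0) s2 (concat (map (\<lambda>v. if ?P v then [?A u v] else []) [0..<n])))"
        unfolding emit_row_def row_time_def
      proof (rule runs_emits_For)
        show "s2 ''n'' 0 = n" using arr[of "''n''"] n by simp
        fix v l'' s3 assume v: "v < n" and s3: "emits (Suc 0) s2 l'' s3" "s3 ''v'' (Suc 0) = v"
        have arr3: "s3 x = s x" if "x \<noteq> ''v''" "x \<noteq> ''out''" "x \<noteq> ''outlen''" for x
          using emits_array[OF s3(1) that] arr[OF that] by simp
        have u3: "s3 ''v'' 0 = u" using emits_var[OF s3(1), of 0] s2(2) by simp
        have KP: "?P v" if "eval_expr (Kept (Var 1)) s3 \<noteq> 0" using that arr3[of "''keep''"] keep[OF v] s3(2) by simp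
        have AK: "eval_expr (Add (InK (Var 0)) (InK (Var 1))) s3 \<noteq> 0 \<longleftrightarrow> u \<in> K \<or> v \<in> K"
          using arr3[of "''K''"] rep u v u3 s3(2) by (simp add: represents_def)
        have En: "eval_expr (Entry (Var 0) (Var 1)) s3 = of_bool ({u, v} \<in> edges G)"
          using arr3[of "''in''"] arr3[of "''row''"] rep u v u3 s3(2) by (simp add: represents_def)
        show "runs (Cond (Kept (Var 1)) (Cond (Add (InK (Var 0)) (InK (Var 1))) (emit (Entry (Var 0) (Var 1))) (emit (Const 0))) Skip)
          s3 ((2 + 1) + 1) (emits (Suc (Suc 0)) s3 (if ?P v then [?A u v] else []))"
        proof (rule runs_emits_Cond)
          show "eval_expr (Kept (Var 1)) s3 \<noteq> 0 \<longleftrightarrow> ?P v" using arr3[of "''keep''"] keep[OF v] s3(2) by simp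
          assume "eval_expr (Kept (Var 1)) s3 \<noteq> 0"
          then have Pv: "?P v" by (rule KP)
          show "runs (Cond (Add (InK (Var 0)) (InK (Var 1))) (emit (Entry (Var 0) (Var 1))) (emit (Const 0))) s3 (2 + 1)
              (emits (Suc (Suc 0)) s3 [?A u v])"
          proof (rule runs_Cond; rule runs_emit)
            assume "eval_expr (Add (InK (Var 0)) (InK (Var 1))) s3 \<noteq> 0"
            then show "?A u v = eval_expr (Entry (Var 0) (Var 1)) s3"
              unfolding En using AK Pu Pv by (auto simp: kernel_graph_def)
          next
            assume "eval_expr (Add (InK (Var 0)) (InK (Var 1))) s3 = 0"
            then show "?A u v = eval_expr (Const 0) s3" using AK by (auto simp: kernel_graph_def)
          qed
        qed simp
      qed
    qed (simp add: row_time_def)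
  qed (simp add: concat_filter adjacency_matrix_def)
  have "runs emit_all s (emit_time n) (emits 0 s ([s ''in'' 0] @ [length ?vs] @ map t ?vs @
      map (\<lambda>v. of_bool (v \<in> K)) ?vs @ adjacency_matrix ?vs (kernel_graph G t K)))"
    unfolding emit_all_def emit_time_def
  proof (rule runs_emits_Seq)
    show "runs (emit (Read ''in'' (Const 0))) s 2 (emits 0 s [s ''in'' 0])" by (rule runs_emit) simp
    fix s1 assume s1: "emits 0 s [s ''in'' 0] s1"
    show "runs (Seq (emit (Read ''num'' (Const 0)))
    (Seq emit_thresholds
    (Seq emit_candidates
         emit_matrix))) s1 (2 + ((n * ((2 + 1) + 2) + 2) + ((n * ((2 + 1) + 2) + 2) +
     (n * ((row_time n + 1) + 2) + 2))))
      (emits 0 s1 ([length ?vs] @ map t ?vs @ map (\<lambda>v. of_bool (v \<in> K)) ?vs @ adjacency_matrix ?vs (kernel_graph G t K)))"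
    proof (rule runs_emits_Seq)
      show "runs (emit (Read ''num'' (Const 0))) s1 2 (emits 0 s1 [length ?vs])"
        using emits_array[OF s1, of "''num''"] num by (intro runs_emit) simp
      fix s2 assume "emits 0 s1 [length ?vs] s2"
      then have s2: "emits 0 s ([s ''in'' 0] @ [length ?vs]) s2" by (rule emits_trans[OF s1])
      show "runs (Seq emit_thresholds
    (Seq emit_candidates
         emit_matrix)) s2 ((n * ((2 + 1) + 2) + 2) + ((n * ((2 + 1) + 2) + 2) +
     (n * ((row_time n + 1) + 2) + 2)))
      (emits 0 s2 (map t ?vs @ map (\<lambda>v. of_bool (v \<in> K)) ?vs @ adjacency_matrix ?vs (kernel_graph G t K)))"
      proof (rule runs_emits_Seq[OF thr[OF s2]])
        fix s3 assume "emits 0 s2 (map t ?vs) s3"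
        note s3 = emits_trans[OF s2 this]
        show "runs (Seq emit_candidates
         emit_matrix) s3 ((n * ((2 + 1) + 2) + 2) +
     (n * ((row_time n + 1) + 2) + 2))
      (emits 0 s3 (map (\<lambda>v. of_bool (v \<in> K)) ?vs @ adjacency_matrix ?vs (kernel_graph G t K)))"
        proof (rule runs_emits_Seq[OF cand[OF s3]])
          fix s4 assume "emits 0 s3 (map (\<lambda>v. of_bool (v \<in> K)) ?vs) s4"
          from matrix[OF emits_trans[OF s3 this]]
          show "runs emit_matrix s4 (n * ((row_time n + 1) + 2) + 2)
           (emits 0 s4 (adjacency_matrix ?vs (kernel_graph G t K)))" .
        qed
      qed
    qed
  qed
  then show ?thesis by (simp add: encode_annotated_bhs_def)
qed

lemma represents_set_cell [simp]:
  assumes "x \<noteq> ''n''" "x \<noteq> ''in''" "x \<noteq> ''row''" "x \<noteq> ''K''"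
  shows "represents (set_cell x i a s) n G t K \<longleftrightarrow> represents s n G t K"
  using assms by (simp add: represents_def)

section \<open>Dropping candidates until none is reducible\<close>

definition sweep :: "nat \<Rightarrow> nat \<Rightarrow> nat graph \<Rightarrow> (nat \<Rightarrow> nat) \<Rightarrow> nat list \<Rightarrow> nat set \<Rightarrow> nat set" where
  "sweep a m G t = fold (\<lambda>v K. if v \<in> K \<and> reducible a m G t K v then K - {v} else K)"

lemma sweep_subset: "sweep a m G t xs K \<subseteq> K"
proof (induction xs arbitrary: K)
  case (Cons x xs)
  have "sweep a m G t (x # xs) K = sweep a m G t xs (if x \<in> K \<and> reducible a m G t K x then K - {x} else K)"
    by (simp add: sweep_def)
  also have "\<dots> \<subseteq> (if x \<in> K \<and> reducible a m G t K x then K - {x} else K)" by (rule Cons)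
  finally show ?case by (auto split: if_splits)
qed (simp add: sweep_def)

text \<open>A sweep only removes candidates. If the outcome is \<open>K\<close>, nothing was removed
  on the way, so every test was made against \<open>K\<close> itself and failed.\<close>

lemma sweep_fixed:
  assumes "sweep a m G t xs K = K" "v \<in> set xs" "v \<in> K"
  shows "\<not> reducible a m G t K v"
  using assms
proof (induction xs arbitrary: K)
  case (Cons x xs)
  define K' where "K' = (if x \<in> K \<and> reducible a m G t K x then K - {x} else K)"
  have s: "sweep a m G t (x # xs) K = sweep a m G t xs K'" by (simp add: sweep_def K'_def)
  then have "K \<subseteq> K'" using sweep_subset[of a m G t xs K'] Cons.prems(1) by simp
  then have K': "K' = K" "x \<in> K \<Longrightarrow> \<not> reducible a m G t K x" by (auto simp: K'_def split: if_splits)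
  then show ?case using Cons.IH[of K] Cons.prems s by auto
qed simp

lemma sweep_equivalent:
  assumes G: "simple_graph G" and t: "\<And>v. v \<in> verts G \<Longrightarrow> t v \<le> p" and m: "a * p < m" and K: "K \<subseteq> verts G"
  shows "annotated_bhs_yes G t k (sweep a m G t xs K) \<longleftrightarrow> annotated_bhs_yes G t k K"
  using K
proof (induction xs arbitrary: K)
  case (Cons x xs)
  define K' where "K' = (if x \<in> K \<and> reducible a m G t K x then K - {x} else K)"
  have "annotated_bhs_yes G t k K' \<longleftrightarrow> annotated_bhs_yes G t k K"
    using reducible_sound[OF G t Cons.prems _ _ m] by (simp add: K'_def)
  moreover have "K' \<subseteq> verts G" using Cons.prems by (auto simp: K'_def)
  moreover have "sweep a m G t (x # xs) K = sweep a m G t xs K'" by (simp add: sweep_def K'_def)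
  ultimately show ?case using Cons.IH[of K'] by simp
qed (simp add: sweep_def)

text \<open>Every round that changes the set removes an element. Hence \<open>n\<close> rounds from
  \<open>n\<close> vertices reach a fixed point, and a counted loop can replace a test for
  stability.\<close>

lemma funpow_shrinking_fixed:
  assumes "\<And>K. f K \<subseteq> K" "finite K" "card K \<le> m"
  shows "f ((f ^^ m) K) = (f ^^ m) K"
  using assms(2,3)
proof (induction m arbitrary: K)
  case 0
  then have "K = {}" by simp
  then show ?case using assms(1)[of "{}"] by simp
next
  case (Suc m)
  have eq: "(f ^^ Suc m) K = (f ^^ m) (f K)" by (simp add: funpow_swap1)
  show ?case
  proof (cases "f K = K")
    case True
    then have "(f ^^ i) K = K" for i by (induction i) simp_all
    then show ?thesis using True by simp
  next
    case False
    then have "f K \<subset> K" using assms(1)[of K] by blast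
    then have "finite (f K)" "card (f K) \<le> m"
      using Suc.prems psubset_card_mono[of K "f K"] by (auto intro: finite_subset)
    then show ?thesis unfolding eq by (rule Suc.IH)
  qed
qed

definition reduce_step :: "fm \<Rightarrow> prog" where
  "reduce_step \<phi> = Cond (InK (Var 0))
     (Seq (compile 1 \<phi>) (Cond (Read ''r'' (Const 1)) (Write ''K'' (Var 0) (Const 0)) Skip)) Skip"

definition step_time :: "fm \<Rightarrow> nat \<Rightarrow> nat" where
  "step_time \<phi> n = fm_time \<phi> n + (1 + 1) + 1"

lemma runs_reduce_step:
  assumes rep: "represents s n G t K" and v: "s ''v'' 0 < n" and K: "K \<subseteq> verts G" and m: "1 \<le> m"
    and K': "K' = (if s ''v'' 0 \<in> K \<and> reducible a m G t K (s ''v'' 0) then K - {s ''v'' 0} else K)"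
  shows "runs (reduce_step (reducible_fm a m)) s (step_time (reducible_fm a m) n)
    (\<lambda>s'. represents s' n G t K' \<and> s' ''v'' 0 = s ''v'' 0 \<and>
       (\<forall>x. x \<noteq> ''v'' \<and> x \<noteq> ''r'' \<and> x \<noteq> ''K'' \<longrightarrow> s' x = s x))" (is "runs _ _ _ ?Q")
  unfolding reduce_step_def step_time_def
proof (rule runs_Cond)
  have InK: "eval_expr (InK (Var 0)) s = of_bool (s ''v'' 0 \<in> K)" using rep v by (simp add: represents_def)
  {
    assume "eval_expr (InK (Var 0)) s = 0"
    then have "K' = K" using K' InK by simp
    then show "runs Skip s (fm_time (reducible_fm a m) n + (1 + 1)) ?Q"
      using rep by (intro runs_mono[OF runs_Skip[of ?Q]]) auto
  }
  assume "eval_expr (InK (Var 0)) s \<noteq> 0"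
  then have vK: "s ''v'' 0 \<in> K" using InK by simp
  have fin: "finite (verts G)" using rep by (simp add: represents_def)
  have lt: "s ''v'' i < n" if "i < 1" for i using v that by simp
  show "runs (Seq (compile 1 (reducible_fm a m)) (Cond (Read ''r'' (Const 1)) (Write ''K'' (Var 0) (Const 0)) Skip)) s
     (fm_time (reducible_fm a m) n + (1 + 1)) ?Q"
  proof (rule runs_Seq, rule runs_mono[OF runs_compile[OF rep wf_reducible_fm lt] order_refl])
    fix s1 assume "same_upto 1 s s1 \<and> (s1 ''r'' 1 \<noteq> 0 \<longleftrightarrow> sat G t K 1 (reducible_fm a m) (s ''v''))"
    then have s1: "same_upto 1 s s1" and r: "s1 ''r'' 1 \<noteq> 0 \<longleftrightarrow> reducible a m G t K (s ''v'' 0)"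
      using sat_reducible_fm[where e = "s ''v''", OF fin K vK m] by auto
    have rep1: "represents s1 n G t K" by (rule same_upto_represents[OF s1 rep])
    have v1: "s1 ''v'' 0 = s ''v'' 0" using s1 by (simp add: same_upto_def)
    show "runs (Cond (Read ''r'' (Const 1)) (Write ''K'' (Var 0) (Const 0)) Skip) s1 (1 + 1) ?Q"
    proof (rule runs_Cond)
      assume "eval_expr (Read ''r'' (Const 1)) s1 \<noteq> 0"
      then have "K' = K - {s ''v'' 0}" using r vK K' by simp
      then show "runs (Write ''K'' (Var 0) (Const 0)) s1 1 ?Q"
        using rep1 v1 s1 by (intro runs_Write) (simp add: represents_def same_upto_def)
    next
      assume "eval_expr (Read ''r'' (Const 1)) s1 = 0"
      then have "K' = K" using r K' by simp
      then show "runs Skip s1 1 ?Q"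
        using rep1 v1 s1 by (intro runs_Skip) (simp add: same_upto_def)
    qed
  qed
qed

definition sweep_prog :: "fm \<Rightarrow> prog" where
  "sweep_prog \<phi> = For ''v'' 0 (reduce_step \<phi>)"

definition sweep_time :: "fm \<Rightarrow> nat \<Rightarrow> nat" where
  "sweep_time \<phi> n = n * (step_time \<phi> n + 2) + 2"

lemma runs_sweep:
  assumes rep: "represents s n G t K" and K: "K \<subseteq> verts G" and m: "1 \<le> m"
  shows "runs (sweep_prog (reducible_fm a m)) s (sweep_time (reducible_fm a m) n)
    (\<lambda>s'. represents s' n G t (sweep a m G t [0..<n] K) \<and>
       (\<forall>x. x \<noteq> ''v'' \<and> x \<noteq> ''r'' \<and> x \<noteq> ''K'' \<longrightarrow> s' x = s x))"
proof -
  let ?I = "\<lambda>b s'. represents s' n G t (sweep a m G t [0..<b] K) \<and> s' ''v'' 0 = b \<and>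
     (\<forall>x. x \<noteq> ''v'' \<and> x \<noteq> ''r'' \<and> x \<noteq> ''K'' \<longrightarrow> s' x = s x)"
  show ?thesis
    unfolding sweep_prog_def sweep_time_def
  proof (rule runs_mono[OF runs_For[where I = ?I] order_refl])
    show "?I 0 (set_cell ''v'' 0 0 s)" using rep by (simp add: represents_def sweep_def)
    show "s' ''n'' 0 = n \<and> s' ''v'' 0 = b" if "?I b s'" for b s' using that unfolding represents_def by blast
    fix b s' assume b: "b < n" and I: "?I b s'"
    let ?K = "sweep a m G t [0..<b] K"
    have K1: "?K \<subseteq> verts G" using sweep_subset K by blast
    have eq: "sweep a m G t [0..<Suc b] K = (if b \<in> ?K \<and> reducible a m G t ?K b then ?K - {b} else ?K)"
      by (simp add: sweep_def upt_Suc)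
    have rep': "represents s' n G t ?K" and lt: "s' ''v'' 0 < n" using I b by auto
    have eq': "sweep a m G t [0..<Suc b] K =
        (if s' ''v'' 0 \<in> ?K \<and> reducible a m G t ?K (s' ''v'' 0) then ?K - {s' ''v'' 0} else ?K)"
      using eq I by simp
    show "runs (reduce_step (reducible_fm a m)) s' (step_time (reducible_fm a m) n)
        (\<lambda>s'. s' ''v'' 0 = b \<and> ?I (Suc b) (set_cell ''v'' 0 (Suc b) s'))"
      by (rule runs_mono[OF runs_reduce_step[OF rep' lt K1 m eq'] order_refl]) (use I in simp)
  qed auto
qed

definition rounds_prog :: "fm \<Rightarrow> prog" where
  "rounds_prog \<phi> = For ''j'' 0 (sweep_prog \<phi>)"

definition rounds_time :: "fm \<Rightarrow> nat \<Rightarrow> nat" where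
  "rounds_time \<phi> n = n * (sweep_time \<phi> n + 2) + 2"

lemma runs_rounds:
  assumes rep: "represents s n G t K" and K: "K \<subseteq> verts G" and m: "1 \<le> m"
  shows "runs (rounds_prog (reducible_fm a m)) s (rounds_time (reducible_fm a m) n)
    (\<lambda>s'. represents s' n G t ((sweep a m G t [0..<n] ^^ n) K) \<and>
       (\<forall>x. x \<noteq> ''v'' \<and> x \<noteq> ''r'' \<and> x \<noteq> ''K'' \<and> x \<noteq> ''j'' \<longrightarrow> s' x = s x))"
proof -
  let ?I = "\<lambda>b s'. represents s' n G t ((sweep a m G t [0..<n] ^^ b) K) \<and> s' ''j'' 0 = b \<and>
     (\<forall>x. x \<noteq> ''v'' \<and> x \<noteq> ''r'' \<and> x \<noteq> ''K'' \<and> x \<noteq> ''j'' \<longrightarrow> s' x = s x)"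
  show ?thesis
    unfolding rounds_prog_def rounds_time_def
  proof (rule runs_mono[OF runs_For[where I = ?I] order_refl])
    show "?I 0 (set_cell ''j'' 0 0 s)" using rep by (simp add: represents_def)
    show "s' ''n'' 0 = n \<and> s' ''j'' 0 = b" if "?I b s'" for b s' using that unfolding represents_def by blast
    fix b s' assume b: "b < n" and I: "?I b s'"
    have "(sweep a m G t [0..<n] ^^ b) K \<subseteq> verts G" for b
    proof (induction b)
      case (Suc b)
      then show ?case using sweep_subset by fastforce
    qed (simp add: K)
    then have "runs (sweep_prog (reducible_fm a m)) s' (sweep_time (reducible_fm a m) n)
      (\<lambda>s''. represents s'' n G t (sweep a m G t [0..<n] ((sweep a m G t [0..<n] ^^ b) K)) \<and>
         (\<forall>x. x \<noteq> ''v'' \<and> x \<noteq> ''r'' \<and> x \<noteq> ''K'' \<longrightarrow> s'' x = s' x))"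
      using I by (intro runs_sweep m) auto
    then show "runs (sweep_prog (reducible_fm a m)) s' (sweep_time (reducible_fm a m) n)
        (\<lambda>s'. s' ''j'' 0 = b \<and> ?I (Suc b) (set_cell ''j'' 0 (Suc b) s'))"
    proof (rule runs_mono[OF _ order_refl])
      fix s'' assume "represents s'' n G t (sweep a m G t [0..<n] ((sweep a m G t [0..<n] ^^ b) K)) \<and>
         (\<forall>x. x \<noteq> ''v'' \<and> x \<noteq> ''r'' \<and> x \<noteq> ''K'' \<longrightarrow> s'' x = s' x)"
      then show "s'' ''j'' 0 = b \<and> ?I (Suc b) (set_cell ''j'' 0 (Suc b) s'')" using I by simp
    qed
  qed auto
qed

section \<open>Marking the kept vertices and counting candidates\<close>

definition keep_step :: prog where
  "keep_step = Cond (Read ''r'' (Const 1))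
     (Seq (Write ''keep'' (Var 0) (Const 1))
       (Write ''num'' (Const 0) (Add (Read ''num'' (Const 0)) (Const 1)))) Skip"

definition count_step :: prog where
  "count_step = Write ''cnt'' (Const 0) (Add (Read ''cnt'' (Const 0)) (InK (Var 0)))"

definition mark_prog :: prog where
  "mark_prog = For ''v'' 0 (Seq (compile 1 kept_fm) (Seq keep_step count_step))"

definition mark_time :: "nat \<Rightarrow> nat" where
  "mark_time n = n * (fm_time kept_fm n + ((1 + 1 + 1) + 1) + 2) + 2"

lemma runs_mark:
  assumes rep: "represents s n G t K" and K: "K \<subseteq> verts G"
    and init: "s ''keep'' = (\<lambda>_. 0)" "s ''num'' 0 = 0" "s ''cnt'' 0 = 0"
  shows "runs mark_prog s (mark_time n)
    (\<lambda>s'. represents s' n G t K \<and> (\<forall>i<n. s' ''keep'' i = of_bool (i \<in> kept G t K)) \<and>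
       s' ''num'' 0 = length (filter (\<lambda>i. i \<in> kept G t K) [0..<n]) \<and> s' ''cnt'' 0 = card K \<and>
       s' ''in'' = s ''in'' \<and> s' ''out'' = s ''out'' \<and> s' ''outlen'' = s ''outlen'')"
proof -
  have GV: "verts G = {..<n}" using rep by (simp add: represents_def)
  let ?P = "\<lambda>i. i \<in> kept G t K"
  let ?I = "\<lambda>a s'. represents s' n G t K \<and> s' ''v'' 0 = a \<and>
       (\<forall>i. s' ''keep'' i = of_bool (i < a \<and> ?P i)) \<and>
       s' ''num'' 0 = length (filter ?P [0..<a]) \<and> s' ''cnt'' 0 = card (K \<inter> {..<a}) \<and>
       s' ''in'' = s ''in'' \<and> s' ''out'' = s ''out'' \<and> s' ''outlen'' = s ''outlen''"
  show ?thesis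
    unfolding mark_prog_def mark_time_def
  proof (rule runs_mono[OF runs_For[where I = ?I] order_refl])
    show "?I 0 (set_cell ''v'' 0 0 s)" using rep init by (simp add: represents_def)
    show "s' ''n'' 0 = n \<and> s' ''v'' 0 = a" if "?I a s'" for a s' using that unfolding represents_def by blast
    show "represents s' n G t K \<and> (\<forall>i<n. s' ''keep'' i = of_bool (?P i)) \<and>
         s' ''num'' 0 = length (filter ?P [0..<n]) \<and> s' ''cnt'' 0 = card K \<and>
         s' ''in'' = s ''in'' \<and> s' ''out'' = s ''out'' \<and> s' ''outlen'' = s ''outlen''" if "?I n s'" for s'
      using that K GV by (simp add: Int_absorb2)
    fix a s' assume a: "a < n" and I: "?I a s'"
    have rep': "represents s' n G t K" and va: "s' ''v'' 0 = a" using I by blast+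
    have lt: "s' ''v'' i < n" if "i < 1" for i using that va a by simp
    have sat: "sat G t K 1 kept_fm (s' ''v'') \<longleftrightarrow> ?P a"
      using sat_kept_fm[OF K, of "s' ''v''" t] va a GV by simp
    have card_Suc: "card (K \<inter> {..<Suc a}) = card (K \<inter> {..<a}) + of_bool (a \<in> K)"
      by (simp add: lessThan_Suc)
    show "runs (Seq (compile 1 kept_fm) (Seq keep_step count_step)) s'
       (fm_time kept_fm n + ((1 + 1 + 1) + 1)) (\<lambda>s'. s' ''v'' 0 = a \<and> ?I (Suc a) (set_cell ''v'' 0 (Suc a) s'))"
    proof (rule runs_Seq, rule runs_mono[OF runs_compile[OF rep' wf_kept_fm lt] order_refl])
      fix s1 assume "same_upto 1 s' s1 \<and> (s1 ''r'' 1 \<noteq> 0 \<longleftrightarrow> sat G t K 1 kept_fm (s' ''v''))"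
      then have s1: "same_upto 1 s' s1" and r: "s1 ''r'' 1 \<noteq> 0 \<longleftrightarrow> ?P a" using sat by auto
      have rep1: "represents s1 n G t K" by (rule same_upto_represents[OF s1 rep'])
      have arr: "s1 x = s' x" if "x \<noteq> ''v''" "x \<noteq> ''r''" for x using s1 that by (simp add: same_upto_def)
      have v1: "s1 ''v'' 0 = a" using s1 va by (simp add: same_upto_def)
      let ?J = "\<lambda>s2. represents s2 n G t K \<and> s2 ''v'' 0 = a \<and>
         (\<forall>i. s2 ''keep'' i = of_bool (i < Suc a \<and> ?P i)) \<and>
         s2 ''num'' 0 = length (filter ?P [0..<Suc a]) \<and> s2 ''cnt'' 0 = card (K \<inter> {..<a}) \<and>
         s2 ''in'' = s ''in'' \<and> s2 ''out'' = s ''out'' \<and> s2 ''outlen'' = s ''outlen''"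
      show "runs (Seq keep_step count_step) s1
          ((1 + 1 + 1) + 1) (\<lambda>s'. s' ''v'' 0 = a \<and> ?I (Suc a) (set_cell ''v'' 0 (Suc a) s'))"
      proof (rule runs_Seq, rule runs_mono[OF _ order_refl, where Q = ?J])
        show "runs keep_step s1 (1 + 1 + 1) ?J"
          unfolding keep_step_def
        proof (rule runs_Cond)
          assume "eval_expr (Read ''r'' (Const 1)) s1 \<noteq> 0"
          then have Pa: "?P a" using r by simp
          show "runs (Seq (Write ''keep'' (Var 0) (Const 1))
                   (Write ''num'' (Const 0) (Add (Read ''num'' (Const 0)) (Const 1)))) s1 (1 + 1) ?J"
            using rep1 v1 arr I Pa
            by (intro runs_Seq runs_Write) (simp add: upt_Suc less_Suc_eq)
        next
          assume "eval_expr (Read ''r'' (Const 1)) s1 = 0"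
          then have Pa: "\<not> ?P a" using r by simp
          then have eq: "i < Suc a \<and> ?P i \<longleftrightarrow> i < a \<and> ?P i" for i by (auto simp: less_Suc_eq)
          have "?J s1" unfolding eq using rep1 v1 arr I Pa by (simp add: upt_Suc)
          then show "runs Skip s1 (1 + 1) ?J" by (intro runs_mono[OF runs_Skip[of ?J]]) auto
        qed
        fix s2 assume J: "?J s2"
        then have "s2 ''K'' a = of_bool (a \<in> K)" using a by (simp add: represents_def)
        then show "runs count_step s2 1
            (\<lambda>s'. s' ''v'' 0 = a \<and> ?I (Suc a) (set_cell ''v'' 0 (Suc a) s'))"
          unfolding count_step_def using J card_Suc by (intro runs_Write) simp
      qed
    qed
  qed
qed

section \<open>Preparing the arrays and the complete program\<close>

definition setup_prog :: prog where
  "setup_prog = Seq (Write ''n'' (Const 0) (Read ''in'' (Const 1)))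
    (Seq (Write ''acc'' (Const 0) (Add (Const 2) (Read ''n'' (Const 0))))
      (For ''v'' 0 (Seq (Write ''row'' (Var 0) (Read ''acc'' (Const 0)))
        (Seq (Write ''acc'' (Const 0) (Add (Read ''acc'' (Const 0)) (Read ''n'' (Const 0))))
             (Write ''K'' (Var 0) (Const 1))))))"

definition setup_time :: "nat \<Rightarrow> nat" where
  "setup_time n = 1 + (1 + (n * (1 + (1 + 1) + 2) + 2))"

lemma runs_setup:
  assumes n: "s ''in'' 1 = n"
  shows "runs setup_prog s (setup_time n)
    (\<lambda>s'. s' ''n'' 0 = n \<and> (\<forall>i<n. s' ''row'' i = 2 + n + n * i \<and> s' ''K'' i = 1) \<and>
      (\<forall>x. x \<noteq> ''n'' \<and> x \<noteq> ''acc'' \<and> x \<noteq> ''row'' \<and> x \<noteq> ''K'' \<and> x \<noteq> ''v'' \<longrightarrow> s' x = s x))"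
proof -
  let ?I = "\<lambda>a s'. s' ''n'' 0 = n \<and> s' ''v'' 0 = a \<and> s' ''acc'' 0 = 2 + n + n * a \<and>
      (\<forall>i<a. s' ''row'' i = 2 + n + n * i \<and> s' ''K'' i = 1) \<and>
      (\<forall>x. x \<noteq> ''n'' \<and> x \<noteq> ''acc'' \<and> x \<noteq> ''row'' \<and> x \<noteq> ''K'' \<and> x \<noteq> ''v'' \<longrightarrow> s' x = s x)"
  let ?s0 = "set_cell ''n'' (eval_expr (Const 0) s) (eval_expr (Read ''in'' (Const 1)) s) s"
  show ?thesis
    unfolding setup_prog_def setup_time_def
  proof (rule runs_Seq, rule runs_Write, rule runs_Seq, rule runs_Write,
      rule runs_mono[OF runs_For[where I = ?I] order_refl])
    show "?I 0 (set_cell ''v'' 0 0 (set_cell ''acc'' (eval_expr (Const 0) ?s0)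
        (eval_expr (Add (Const 2) (Read ''n'' (Const 0))) ?s0) ?s0))"
      using n by simp
    show "s' ''n'' 0 = n \<and> s' ''v'' 0 = a" if "?I a s'" for a s' using that by blast
    show "runs (Seq (Write ''row'' (Var 0) (Read ''acc'' (Const 0)))
          (Seq (Write ''acc'' (Const 0) (Add (Read ''acc'' (Const 0)) (Read ''n'' (Const 0))))
               (Write ''K'' (Var 0) (Const 1)))) s' (1 + (1 + 1))
        (\<lambda>s'. s' ''v'' 0 = a \<and> ?I (Suc a) (set_cell ''v'' 0 (Suc a) s'))" if "a < n" "?I a s'" for a s'
      using that by (intro runs_Seq runs_Write) (simp add: less_Suc_eq)
  qed auto
qed

text \<open>Multiplication by a constant of the program, unfolded into additions; it allows
  \<open>card K\<close> to be compared with \<open>b * k\<close>.\<close>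

primrec times_expr :: "nat \<Rightarrow> expr \<Rightarrow> expr" where
  "times_expr 0 e = Const 0"
| "times_expr (Suc c) e = Add e (times_expr c e)"

lemma eval_times_expr [simp]: "eval_expr (times_expr c e) s = c * eval_expr e s"
  by (induction c) simp_all

text \<open>The word \<open>[0, 0]\<close> encodes the empty graph with \<open>k = 0\<close>, a
  trivial yes-instance, and is emitted when there are more than \<open>b * k\<close>
  candidates.\<close>

definition decide_step :: "nat \<Rightarrow> prog" where
  "decide_step b = Cond (Sub (Read ''cnt'' (Const 0)) (times_expr b (Read ''in'' (Const 0))))
     (Seq (emit (Const 0)) (emit (Const 0))) emit_all"

definition kernel_prog :: "nat \<Rightarrow> nat \<Rightarrow> nat \<Rightarrow> prog" where
  "kernel_prog a m b = Seq setup_prog (Seq (rounds_prog (reducible_fm a m)) (Seq mark_prog (decide_step b)))"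

text \<open>The summand \<open>4 + emit_time n\<close> bounds both branches of the final decision;
  the short output takes 4 steps.\<close>

definition kernel_time :: "nat \<Rightarrow> nat \<Rightarrow> nat \<Rightarrow> nat" where
  "kernel_time a m n = setup_time n + (rounds_time (reducible_fm a m) n + (mark_time n + (4 + emit_time n + 1)))"

lemma polynomial_kernel_time: "is_polynomial (kernel_time a m)"
proof -
  have "is_polynomial (\<lambda>n. kernel_time a m n)"
    unfolding kernel_time_def setup_time_def rounds_time_def sweep_time_def step_time_def mark_time_def
      emit_time_def row_time_def
    by (intro polynomial_add polynomial_mult polynomial_const polynomial_id polynomial_fm_time)
  then show ?thesis by simp
qed

lemma runs_kernel_prog:
  fixes K :: "nat set"
  assumes G: "verts G = {..<n}" and n: "s ''in'' 1 = n" and t: "\<And>i. i < n \<Longrightarrow> s ''in'' (2 + i) = t i"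
    and adj: "\<And>i j. i < n \<Longrightarrow> j < n \<Longrightarrow> s ''in'' (2 + n + n * i + j) = of_bool ({i, j} \<in> edges G)"
    and zero: "\<And>x. x \<noteq> ''in'' \<Longrightarrow> x \<noteq> ''inlen'' \<Longrightarrow> s x = (\<lambda>_. 0)" and m: "1 \<le> m"
    and K: "K = (sweep a m G t [0..<n] ^^ n) {..<n}"
  shows "runs (kernel_prog a m b) s (kernel_time a m n)
    (\<lambda>s'. result s' = (if b * s ''in'' 0 < card K then [0, 0]
       else encode_annotated_bhs (filter (\<lambda>i. i \<in> kept G t K) [0..<n]) (kernel_graph G t K) t (s ''in'' 0) K))"
    (is "runs _ _ _ ?Q")
  unfolding kernel_prog_def kernel_time_def
proof (rule runs_Seq, rule runs_mono[OF runs_setup[where s = s, OF n] order_refl])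
  fix s1 assume s1: "s1 ''n'' 0 = n \<and> (\<forall>i<n. s1 ''row'' i = 2 + n + n * i \<and> s1 ''K'' i = 1) \<and>
      (\<forall>x. x \<noteq> ''n'' \<and> x \<noteq> ''acc'' \<and> x \<noteq> ''row'' \<and> x \<noteq> ''K'' \<and> x \<noteq> ''v'' \<longrightarrow> s1 x = s x)"
  have rep1: "represents s1 n G t {..<n}"
    unfolding represents_def using s1 G t adj by simp
  have "K \<subseteq> {..<n}"
  proof -
    have "(sweep a m G t [0..<n] ^^ i) {..<n} \<subseteq> {..<n}" for i
    proof (induction i)
      case (Suc i)
      then show ?case using sweep_subset[of a m G t "[0..<n]" "(sweep a m G t [0..<n] ^^ i) {..<n}"] by simp
    qed simp
    then show ?thesis using K by blast
  qed
  then have KV: "K \<subseteq> verts G" using G by simp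
  show "runs (Seq (rounds_prog (reducible_fm a m)) (Seq mark_prog (decide_step b))) s1
     (rounds_time (reducible_fm a m) n + (mark_time n + (4 + emit_time n + 1))) ?Q"
  proof (rule runs_Seq, rule runs_mono[OF runs_rounds[OF rep1 _ m] order_refl])
    show "{..<n} \<subseteq> verts G" using G by simp
    fix s2 assume "represents s2 n G t ((sweep a m G t [0..<n] ^^ n) {..<n}) \<and>
       (\<forall>x. x \<noteq> ''v'' \<and> x \<noteq> ''r'' \<and> x \<noteq> ''K'' \<and> x \<noteq> ''j'' \<longrightarrow> s2 x = s1 x)"
    then have rep2: "represents s2 n G t K"
      and arr2: "\<And>x. x \<noteq> ''v'' \<Longrightarrow> x \<noteq> ''r'' \<Longrightarrow> x \<noteq> ''K'' \<Longrightarrow> x \<noteq> ''j'' \<Longrightarrow> s2 x = s1 x"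
      using K by auto
    have in2: "s2 ''in'' = s ''in''" and z2: "s2 ''keep'' = (\<lambda>_. 0)" "s2 ''num'' 0 = 0" "s2 ''cnt'' 0 = 0" "s2 ''outlen'' 0 = 0"
      using arr2 s1 zero by simp_all
    show "runs (Seq mark_prog (decide_step b)) s2 (mark_time n + (4 + emit_time n + 1)) ?Q"
    proof (rule runs_Seq, rule runs_mono[OF runs_mark[OF rep2 KV z2(1-3)] order_refl], elim conjE)
      fix s3 assume rep3: "represents s3 n G t K"
        and keep3: "\<forall>i<n. s3 ''keep'' i = of_bool (i \<in> kept G t K)"
        and num3: "s3 ''num'' 0 = length (filter (\<lambda>i. i \<in> kept G t K) [0..<n])"
        and cnt3: "s3 ''cnt'' 0 = card K"
        and in3: "s3 ''in'' = s2 ''in''" and len3: "s3 ''outlen'' = s2 ''outlen''"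
      have res: "result s3 = []" using len3 z2(4) by (simp add: result_def)
      show "runs (decide_step b) s3 (4 + emit_time n + 1) ?Q"
        unfolding decide_step_def
      proof (rule runs_Cond)
        assume "eval_expr (Sub (Read ''cnt'' (Const 0)) (times_expr b (Read ''in'' (Const 0)))) s3 \<noteq> 0"
        then have lt: "b * s ''in'' 0 < card K" using cnt3 in3 in2 by simp
        have "runs (Seq (emit (Const 0)) (emit (Const 0))) s3 (2 + 2) (emits 0 s3 ([0] @ [0]))"
          by (intro runs_emits_Seq runs_emit) simp_all
        then show "runs (Seq (emit (Const 0)) (emit (Const 0))) s3 (4 + emit_time n) ?Q"
          by (rule runs_mono) (use lt res in \<open>simp_all add: emits_def\<close>)
      next
        assume "eval_expr (Sub (Read ''cnt'' (Const 0)) (times_expr b (Read ''in'' (Const 0)))) s3 = 0"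
        then have le: "\<not> b * s ''in'' 0 < card K" using cnt3 in3 in2 by simp
        show "runs emit_all s3 (4 + emit_time n) ?Q"
          by (rule runs_mono[OF runs_emit_all[OF rep3 _ num3]]) (use le res keep3 in3 in2 in \<open>simp_all add: emits_def\<close>)
      qed
    qed
  qed
qed

text \<open>The program knows vertices only by their positions in \<open>vs\<close>; this is the
  isomorphic copy of the graph on which it works.\<close>

definition index_graph :: "'a list \<Rightarrow> 'a graph \<Rightarrow> nat graph" where
  "index_graph vs G = \<lparr>verts = {..<length vs},
     edges = {{i, j} |i j. i < length vs \<and> j < length vs \<and> {vs ! i, vs ! j} \<in> edges G}\<rparr>"

lemma verts_index_graph [simp]: "verts (index_graph vs G) = {..<length vs}"
  by (simp add: index_graph_def)

lemma edges_index_graph: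
  "i < length vs \<Longrightarrow> j < length vs \<Longrightarrow> {i, j} \<in> edges (index_graph vs G) \<longleftrightarrow> {vs ! i, vs ! j} \<in> edges G"
  by (auto simp: index_graph_def doubleton_eq_iff insert_commute)

lemma simple_index_graph:
  assumes "simple_graph G"
  shows "simple_graph (index_graph vs G)"
proof -
  have "i \<noteq> j" if "{vs ! i, vs ! j} \<in> edges G" for i j
    using that assms by (auto simp: simple_graph_def)
  then show ?thesis by (auto simp: simple_graph_def index_graph_def)
qed

context
  fixes G :: "'a graph" and vs :: "'a list"
  assumes vs: "enumerates vs G"
begin

lemma bij_nth: "bij_betw ((!) vs) {..<length vs} (verts G)"
  using vs by (auto simp: enumerates_def intro: bij_betw_nth)

lemma nbrs_index_graph:
  assumes "i < length vs"
  shows "(!) vs ` nbrs (index_graph vs G) i = nbrs G (vs ! i)"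
proof -
  have "(!) vs ` nbrs (index_graph vs G) i = (!) vs ` {j\<in>{..<length vs}. {vs ! j, vs ! i} \<in> edges G}"
    unfolding nbrs_def verts_index_graph using assms edges_index_graph[of _ vs i G]
    by (intro arg_cong[of _ _ "(`) ((!) vs)"] Collect_cong) auto
  also have "\<dots> = {u\<in>(!) vs ` {..<length vs}. {u, vs ! i} \<in> edges G}" by blast
  finally show ?thesis unfolding bij_betw_imp_surj_on[OF bij_nth] nbrs_def .
qed

lemma harmless_index_graph:
  assumes S: "S \<subseteq> {..<length vs}"
  shows "harmless (index_graph vs G) (\<lambda>i. t (vs ! i)) S \<longleftrightarrow> harmless G t ((!) vs ` S)"
proof -
  have inj: "inj_on ((!) vs) {..<length vs}" by (rule bij_betw_imp_inj_on[OF bij_nth])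
  have card: "card (nbrs (index_graph vs G) i \<inter> S) = card (nbrs G (vs ! i) \<inter> (!) vs ` S)"
    if i: "i < length vs" for i
  proof -
    have N: "nbrs (index_graph vs G) i \<subseteq> {..<length vs}" using nbrs_subset[of "index_graph vs G"] by simp
    have "nbrs G (vs ! i) \<inter> (!) vs ` S = (!) vs ` (nbrs (index_graph vs G) i \<inter> S)"
      unfolding nbrs_index_graph[OF i, symmetric] by (rule inj_on_image_Int[OF inj N S, symmetric])
    moreover have "inj_on ((!) vs) (nbrs (index_graph vs G) i \<inter> S)" by (rule inj_on_subset[OF inj]) (use S in blast)
    ultimately show ?thesis by (simp add: card_image)
  qed
  have "(\<forall>v\<in>verts G. card (nbrs G v \<inter> (!) vs ` S) < t v) \<longleftrightarrow>
      (\<forall>i\<in>{..<length vs}. card (nbrs G (vs ! i) \<inter> (!) vs ` S) < t (vs ! i))"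
    unfolding bij_betw_imp_surj_on[OF bij_nth, symmetric] by blast
  moreover have "(!) vs ` S \<subseteq> verts G" using S bij_betw_imp_surj_on[OF bij_nth] by blast
  ultimately show ?thesis using S card by (simp add: harmless_def)
qed

lemma bhs_yes_index_graph:
  "annotated_bhs_yes (index_graph vs G) (\<lambda>i. t (vs ! i)) k {..<length vs} \<longleftrightarrow> bhs_yes G t k"
proof -
  have inj: "inj_on ((!) vs) {..<length vs}" by (rule bij_betw_imp_inj_on[OF bij_nth])
  have c: "card ((!) vs ` S) = card S" if "S \<subseteq> {..<length vs}" for S
    using inj_on_subset[OF inj that] by (rule card_image)
  show ?thesis
  proof
    assume "annotated_bhs_yes (index_graph vs G) (\<lambda>i. t (vs ! i)) k {..<length vs}"
    then obtain S where "harmless (index_graph vs G) (\<lambda>i. t (vs ! i)) S" "S \<subseteq> {..<length vs}" "k \<le> card S"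
      unfolding annotated_bhs_yes_def by blast
    then show "bhs_yes G t k" unfolding bhs_yes_def using harmless_index_graph c by metis
  next
    assume "bhs_yes G t k"
    then obtain S where S: "harmless G t S" "k \<le> card S" unfolding bhs_yes_def by blast
    then have "S \<subseteq> (!) vs ` {..<length vs}" using bij_betw_imp_surj_on[OF bij_nth] by (simp add: harmless_def)
    then obtain S' where "S' \<subseteq> {..<length vs}" "S = (!) vs ` S'" by (meson subset_image_iff)
    then show "annotated_bhs_yes (index_graph vs G) (\<lambda>i. t (vs ! i)) k {..<length vs}"
      unfolding annotated_bhs_yes_def using S harmless_index_graph c by metis
  qed
qed

lemma sparse_index_graph: "sparse d G \<Longrightarrow> sparse d (index_graph vs G)"
  using bij_nth edges_index_graph[of _ vs _ G]
  by (intro sparse_hom[of d G "(!) vs"]) (auto simp: bij_betw_def)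

end

section \<open>Positions in the encoding and the final kernelization\<close>

lemma nth_concat_rows:
  assumes "i < length us" "j < length vs"
  shows "concat (map (\<lambda>u. map (g u) vs) us) ! (length vs * i + j) = g (us ! i) (vs ! j)"
  using assms
proof (induction us arbitrary: i)
  case (Cons u us)
  show ?case
  proof (cases i)
    case 0
    then show ?thesis using Cons.prems by (simp add: nth_append)
  next
    case (Suc l)
    have "length vs * i + j = length (map (g u) vs) + (length vs * l + j)" using Suc by simp
    then show ?thesis using Cons Suc by (simp only: list.map concat.simps nth_append_length_plus) simp
  qed
qed simp

lemma length_concat_rows: "length (concat (map (\<lambda>u. map (g u) vs) us)) = length us * length vs"
  by (induction us) simp_all

lemma length_le_word_size: "length w \<le> word_size w"
  unfolding word_size_def by (induction w) simp_all

lemma encode_bhs_nth: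
  assumes "w = encode_bhs vs G t k" "n = length vs"
  shows "length w = 2 + n + n * n" "w ! 0 = k" "w ! 1 = n"
    and "i < n \<Longrightarrow> w ! (2 + i) = t (vs ! i)"
    and "i < n \<Longrightarrow> j < n \<Longrightarrow> w ! (2 + n + n * i + j) = of_bool ({vs ! i, vs ! j} \<in> edges G)"
proof -
  show "length w = 2 + n + n * n" "w ! 0 = k" "w ! 1 = n"
    using assms by (simp_all add: encode_bhs_def adjacency_matrix_def length_concat_rows)
  show "w ! (2 + i) = t (vs ! i)" if "i < n"
    using assms that by (simp add: encode_bhs_def nth_append)
  show "w ! (2 + n + n * i + j) = of_bool ({vs ! i, vs ! j} \<in> edges G)" if "i < n" "j < n"
  proof -
    have "w = ([k, n] @ map t vs) @ adjacency_matrix vs G" using assms by (simp add: encode_bhs_def)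
    moreover have "2 + n + n * i + j = length ([k, n] @ map t vs) + (n * i + j)" using assms by simp
    ultimately have "w ! (2 + n + n * i + j) = adjacency_matrix vs G ! (n * i + j)"
      by (simp only: nth_append_length_plus)
    then show ?thesis using that assms(2) unfolding adjacency_matrix_def by (simp add: nth_concat_rows)
  qed
qed

lemma length_encode_annotated_bhs:
  "length (encode_annotated_bhs vs G t k K) = 2 + 2 * length vs + length vs * length vs"
  by (simp add: encode_annotated_bhs_def adjacency_matrix_def length_concat_rows)

text \<open>The summand \<open>2 + 2 * n + n * n\<close> in the time bound pays for the length of
  the output, which \<open>computes_within\<close> charges; the kernel has at most \<open>n\<close>
  vertices. The case \<open>b * k < card K\<close> is a yes-instance by
  \<open>irreducible_small\<close>.\<close>

lemma kernelization:
  fixes G :: "'a graph"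
  assumes sp: "sparse d G" and d: "1 \<le> d" and inst: "bhs_instance p G t k" and vs: "enumerates vs G"
    and q: "\<And>n. kernel_time (4 * d) (4 * d * p + 1) n + (2 + 2 * n + n * n) = poly q n"
  defines "a \<equiv> 4 * d" and "m \<equiv> 4 * d * p + 1" and "b \<equiv> kernel_bound d p"
  shows "\<exists>(G' :: nat graph) t' k' K' vs'.
    annotated_bhs_instance p G' t' k' K' \<and> enumerates vs' G' \<and>
    computes_within (kernel_prog a m b) (encode_bhs vs G t k) (encode_annotated_bhs vs' G' t' k' K')
      (poly q (word_size (encode_bhs vs G t k))) \<and>
    (bhs_yes G t k \<longleftrightarrow> annotated_bhs_yes G' t' k' K') \<and>
    annotated_bhs_size G' t' k' K' \<le> ((1 + d) * ((1 + d + 4 ^ d) * b) + 1) * k"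
proof -
  define n where "n = length vs"
  define w where "w = encode_bhs vs G t k"
  define H where "H = index_graph vs G"
  define t0 where "t0 i = t (vs ! i)" for i
  define K where "K = (sweep a m H t0 [0..<n] ^^ n) {..<n}"
  have HV: "verts H = {..<n}" by (simp add: H_def n_def)
  have simple: "simple_graph H" unfolding H_def using inst by (intro simple_index_graph) (simp add: bhs_instance_def)
  have sparse: "sparse d H" unfolding H_def by (rule sparse_index_graph[OF vs sp])
  have t0: "t0 v \<in> {1..p}" if "v \<in> verts H" for v
  proof -
    have "vs ! v \<in> verts G" using vs that HV by (auto simp: enumerates_def n_def)
    then show ?thesis using inst by (simp add: bhs_instance_def t0_def)
  qed
  have m: "a * p < m" "1 \<le> m" by (simp_all add: a_def m_def)
  have iter: "(sweep a m H t0 [0..<n] ^^ i) {..<n} \<subseteq> verts H \<and>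
      (annotated_bhs_yes H t0 k ((sweep a m H t0 [0..<n] ^^ i) {..<n}) \<longleftrightarrow> annotated_bhs_yes H t0 k {..<n})" for i
  proof (induction i)
    case (Suc i)
    let ?K = "(sweep a m H t0 [0..<n] ^^ i) {..<n}"
    have tp: "t0 v \<le> p" if "v \<in> verts H" for v using t0[OF that] by simp
    have "annotated_bhs_yes H t0 k (sweep a m H t0 [0..<n] ?K) \<longleftrightarrow> annotated_bhs_yes H t0 k ?K"
      by (rule sweep_equivalent[OF simple tp m(1)]) (use Suc in auto)
    moreover have "sweep a m H t0 [0..<n] ?K \<subseteq> verts H" using sweep_subset Suc by blast
    ultimately show ?case using Suc by simp
  qed (simp add: HV)
  have KV: "K \<subseteq> verts H" and Kyes: "annotated_bhs_yes H t0 k K \<longleftrightarrow> bhs_yes G t k"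
    using iter[of n] bhs_yes_index_graph[OF vs, of t k]
    unfolding K_def H_def t0_def n_def by blast+
  have "sweep a m H t0 [0..<n] K = K"
    unfolding K_def by (rule funpow_shrinking_fixed) (simp_all add: sweep_subset)
  then have irr: "\<not> reducible (4 * d) (4 * d * p + 1) H t0 K u" if "u \<in> K" for u
    using sweep_fixed[of a m H t0 "[0..<n]" K u] that KV HV unfolding a_def m_def by auto
  have small: "card K \<le> b * k \<or> annotated_bhs_yes H t0 k K"
    unfolding b_def by (rule irreducible_small[OF sparse simple d t0 KV irr])
  note w = encode_bhs_nth[OF w_def n_def]
  have lw: "load w ''in'' i = w ! i" if "i < length w" for i using that by (simp add: load_def)
  have run: "runs (kernel_prog a m b) (load w) (kernel_time a m n)
    (\<lambda>s'. result s' = (if b * load w ''in'' 0 < card K then [0, 0]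
      else encode_annotated_bhs (filter (\<lambda>i. i \<in> kept H t0 K) [0..<n]) (kernel_graph H t0 K) t0 (load w ''in'' 0) K))"
  proof (rule runs_kernel_prog[OF HV _ _ _ _ m(2) K_def])
    show "load w ''in'' 1 = n" using lw[of 1] w(1,3) by simp
    show "load w ''in'' (2 + i) = t0 i" if "i < n" for i
      using lw[of "2 + i"] w(1) w(4)[OF that] that by (simp add: t0_def)
    show "load w ''in'' (2 + n + n * i + j) = of_bool ({i, j} \<in> edges H)" if "i < n" "j < n" for i j
    proof -
      have "n * i + j < n * Suc i" using that by simp
      also have "\<dots> \<le> n * n" using that by (intro mult_le_mono2) simp
      finally have "2 + n + n * i + j < length w" using w(1) by simp
      then show ?thesis using lw w(5)[OF that] edges_index_graph[of i vs j G] that by (simp add: H_def n_def)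
    qed
    show "load w x = (\<lambda>_. 0)" if "x \<noteq> ''in''" "x \<noteq> ''inlen''" for x using that by (auto simp: load_def)
  qed
  have k: "load w ''in'' 0 = k" using lw[of 0] w(1,2) by simp
  have time: "kernel_time a m n + (2 + 2 * n + n * n) \<le> poly q (word_size w)"
  proof -
    have "n \<le> word_size w" using length_le_word_size[of w] w(1) by simp
    then show ?thesis unfolding a_def m_def q by (rule poly_nat_mono)
  qed
  show ?thesis
  proof (cases "b * k < card K")
    case True
    \<comment> \<open>The trivial yes-instance has size 0, so it respects the bound even for
      \<open>k = 0\<close>.\<close>
    let ?E = "\<lparr>verts = {}, edges = {}\<rparr> :: nat graph"
    have "computes_within (kernel_prog a m b) w (encode_annotated_bhs [] ?E t0 0 {}) (poly q (word_size w))"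
    proof -
      obtain \<tau> s where "exec (kernel_prog a m b) (load w) \<tau> s" "\<tau> \<le> kernel_time a m n" "result s = [0, 0]"
        using run True unfolding runs_def k by auto
      then show ?thesis using time unfolding computes_within_def
        by (intro exI[of _ \<tau>] exI[of _ s]) (auto simp: encode_annotated_bhs_def adjacency_matrix_def)
    qed
    moreover have "annotated_bhs_instance p ?E t0 0 {}" "enumerates [] ?E"
      by (simp_all add: annotated_bhs_instance_def bhs_instance_def simple_graph_def enumerates_def)
    moreover have "bhs_yes G t k" using small True Kyes by simp
    moreover have "annotated_bhs_yes ?E t0 0 {}" by (simp add: annotated_bhs_yes_def harmless_def)
    moreover have "annotated_bhs_size ?E t0 0 {} \<le> ((1 + d) * ((1 + d + 4 ^ d) * b) + 1) * k" by (simp add: annotated_bhs_size_def)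
    ultimately show ?thesis unfolding w_def[symmetric] by blast
  next
    case False
    let ?vs = "filter (\<lambda>i. i \<in> kept H t0 K) [0..<n]"
    have kV: "kept H t0 K \<subseteq> {..<n}" using kept_subset[OF KV, of t0] HV by simp
    have "computes_within (kernel_prog a m b) w (encode_annotated_bhs ?vs (kernel_graph H t0 K) t0 k K) (poly q (word_size w))"
    proof -
      obtain \<tau> s where "exec (kernel_prog a m b) (load w) \<tau> s" "\<tau> \<le> kernel_time a m n"
          "result s = encode_annotated_bhs ?vs (kernel_graph H t0 K) t0 k K"
        using run False unfolding runs_def k by auto
      moreover have "length (encode_annotated_bhs ?vs (kernel_graph H t0 K) t0 k K) \<le> 2 + 2 * n + n * n"
      proof -
        have "length ?vs \<le> n" using length_filter_le[of _ "[0..<n]"] by simp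
        then show ?thesis unfolding length_encode_annotated_bhs by (intro add_mono mult_le_mono) auto
      qed
      ultimately show ?thesis using time unfolding computes_within_def
        by (intro exI[of _ \<tau>] exI[of _ s]) auto
    qed
    moreover have "annotated_bhs_instance p (kernel_graph H t0 K) t0 k K"
      using simple t0 by (intro kernel_instance KV) (simp add: bhs_instance_def)
    moreover have "enumerates ?vs (kernel_graph H t0 K)" using kV by (auto simp: enumerates_def)
    moreover have "bhs_yes G t k \<longleftrightarrow> annotated_bhs_yes (kernel_graph H t0 K) t0 k K"
    proof -
      have "1 \<le> t0 v" if "v \<in> verts H" for v using t0[OF that] by simp
      from kernel_equivalent[OF this KV] show ?thesis using Kyes by simp
    qed
    moreover have "annotated_bhs_size (kernel_graph H t0 K) t0 k K \<le> ((1 + d) * ((1 + d + 4 ^ d) * b) + 1) * k"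
    proof -
      have "annotated_bhs_size (kernel_graph H t0 K) t0 k K \<le> (1 + d) * ((1 + d + 4 ^ d) * card K) + k"
        by (rule kernel_size[OF sparse simple KV])
      also have "\<dots> \<le> (1 + d) * ((1 + d + 4 ^ d) * (b * k)) + k"
        using False by (intro add_mono mult_le_mono2) auto
      also have "\<dots> = ((1 + d) * ((1 + d + 4 ^ d) * b) + 1) * k" by (simp add: algebra_simps)
      finally show ?thesis .
    qed
    ultimately show ?thesis unfolding w_def[symmetric] by blast
  qed
qed

theorem theorem6:
  fixes \<G> :: "'a graph set"
  assumes "\<forall>G\<in>\<G>. simple_graph G"
    and "bounded_expansion \<G>"
  shows "\<exists>f :: nat poly. \<forall>p :: nat. \<exists>(c :: prog) (q :: nat poly).
    \<forall>(G :: 'a graph) t k vs. G \<in> \<G> \<and> bhs_instance p G t k \<and> enumerates vs G \<longrightarrow>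
      (\<exists>(G' :: nat graph) t' k' K' vs'.
         annotated_bhs_instance p G' t' k' K' \<and> enumerates vs' G' \<and>
         computes_within c (encode_bhs vs G t k) (encode_annotated_bhs vs' G' t' k' K')
           (poly q (word_size (encode_bhs vs G t k))) \<and>
         (bhs_yes G t k \<longleftrightarrow> annotated_bhs_yes G' t' k' K') \<and>
         annotated_bhs_size G' t' k' K' \<le> poly f p * k)"
proof -
  obtain d where d: "1 \<le> d" and sp: "\<And>G. G \<in> \<G> \<Longrightarrow> sparse d G"
    using bounded_expansion_sparse[OF assms] by blast
  \<comment> \<open>The constant \<open>d\<close> comes from the class alone, so a single
    \<open>f\<close> serves every \<open>p\<close>; the program and its time bound \<open>q\<close>
    are chosen afterwards.\<close>
  have "is_polynomial (\<lambda>p. (1 + d) * ((1 + d + 4 ^ d) * kernel_bound d p) + 1)"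
    by (intro polynomial_intros polynomial_kernel_bound)
  then obtain f where f: "\<And>p. (1 + d) * ((1 + d + 4 ^ d) * kernel_bound d p) + 1 = poly f p"
    unfolding is_polynomial_def by blast
  show ?thesis
  proof (rule exI[of _ f], rule allI)
    fix p
    have "is_polynomial (\<lambda>n. kernel_time (4 * d) (4 * d * p + 1) n + (2 + 2 * n + n * n))"
      by (intro polynomial_intros polynomial_kernel_time)
    then obtain q where q: "\<And>n. kernel_time (4 * d) (4 * d * p + 1) n + (2 + 2 * n + n * n) = poly q n"
      unfolding is_polynomial_def by blast
    show "\<exists>(c :: prog) (q :: nat poly).
      \<forall>(G :: 'a graph) t k vs. G \<in> \<G> \<and> bhs_instance p G t k \<and> enumerates vs G \<longrightarrow>
        (\<exists>(G' :: nat graph) t' k' K' vs'.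
           annotated_bhs_instance p G' t' k' K' \<and> enumerates vs' G' \<and>
           computes_within c (encode_bhs vs G t k) (encode_annotated_bhs vs' G' t' k' K')
             (poly q (word_size (encode_bhs vs G t k))) \<and>
           (bhs_yes G t k \<longleftrightarrow> annotated_bhs_yes G' t' k' K') \<and>
           annotated_bhs_size G' t' k' K' \<le> poly f p * k)"
    proof (intro exI[of _ "kernel_prog (4 * d) (4 * d * p + 1) (kernel_bound d p)"] exI[of _ q] allI impI, elim conjE)
      fix G t k vs assume "G \<in> \<G>" "bhs_instance p G t k" "enumerates vs G"
      from kernelization[OF sp[OF this(1)] d this(2,3) q]
      show "\<exists>(G' :: nat graph) t' k' K' vs'.
         annotated_bhs_instance p G' t' k' K' \<and> enumerates vs' G' \<and>
         computes_within (kernel_prog (4 * d) (4 * d * p + 1) (kernel_bound d p)) (encode_bhs vs G t k)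
           (encode_annotated_bhs vs' G' t' k' K') (poly q (word_size (encode_bhs vs G t k))) \<and>
         (bhs_yes G t k \<longleftrightarrow> annotated_bhs_yes G' t' k' K') \<and>
         annotated_bhs_size G' t' k' K' \<le> poly f p * k"
        unfolding f .
    qed
  qed
qed

end
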